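(* Let $\ell\ge1$, $0<q<1$, and $z_1,\ldots,z_{\ell+1}\in\mathbb C^*$, with $x_{\ell+1,i}:=z_i$. For integers $p_{\ell+1,1}\ge\cdots\ge p_{\ell+1,\ell+1}$ define $${}^{MB}\Psi^{\mathfrak{gl}_{\ell+1}}_{z_1,\ldots,z_{\ell+1}}(\underline p_{\ell+1})=(q,q)_\infty^{\ell(\ell-1)/2}\int_{\mathcal S}\ \prod_{1\le j\le n\le\ell}\frac{dx_{n,j}}{2\pi\imath x_{n,j}}\ \prod_{n=1}^{\ell+1}\prod_{j=1}^n\Big(\frac{x_{n,j}}{x_{n-1,j}}\Big)^{p_{\ell+1,n}}\prod_{n=1}^{\ell}\frac{\prod_{k=1}^n\prod_{m=1}^{n+1}\Gamma_q(x_{n,k}^{-1}x_{n+1,m})}{n!\,\prod_{s\ne p}\Gamma_q(x_{n,s}x_{n,p}^{-1})},$$ and set ${}^{MB}\Psi^{\mathfrak{gl}_{\ell+1}}_{z}(\underline p_{\ell+1})=0$ for all other $\underline p_{\ell+1}\in\mathbb Z^{\ell+1}$. Then: 1. ${}^{MB}\Psi^{\mathfrak{gl}_{\ell+1}}_{z_{\sigma(1)},\ldots,z_{\sigma(\ell+1)}}(\underline p_{\ell+1})={}^{MB}\Psi^{\mathfrak{gl}_{\ell+1}}_{z_1,\ldots,z_{\ell+1}}(\underline p_{\ell+1})$ for all $\sigma\in\mathfrak S_{\ell+1}$. 2. For $r=1,\ldots,\ell+1$, $$\mathcal H_r^{\mathfrak{gl}_{\ell+1}}(\underline p_{\ell+1})\,{}^{MB}\Psi_z(\underline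 p_{\ell+1})=\chi_r(z)\,{}^{MB}\Psi_z(\underline p_{\ell+1}),$$ $$q^{-r(r-1)/2}\,\mathcal H_r^\vee(z)\,{}^{MB}\Psi_z(\underline p_{\ell+1})=\Big(\prod_{i=\ell+2-r}^{\ell+1}q^{p_{\ell+1,i}}\Big)\,{}^{MB}\Psi_z(\underline p_{\ell+1}),$$ where $\chi_r(z)=\sum_{i_1<\cdots<i_r}z_{i_1}\cdots z_{i_r}$.
   Context: $\Gamma_q(x)=\prod_{j=0}^\infty(1-xq^j)^{-1}$; $(q,q)_\infty=\prod_{m=1}^\infty(1-q^m)$; $x_{n-1,n}:=1$ for all $n$ (so the factor with $j=n$ is $x_{n,n}^{p_{\ell+1,n}}$). In the denominator, $s,p\in\{1,\ldots,n\}$. The contour $\mathcal S$: each $x_{n,j}$ ($1\le j\le n\le\ell$) runs once counterclockwise over a circle around $0$, with radii chosen so that $|x_{n+1,m}x_{n,k}^{-1}|<1$ for all $1\le n\le \ell$, $1\le k\le n$, $1\le m\le n+1$ (the radii at fixed $n$ being equal). Hamiltonians of the $q$-deformed $\mathfrak{gl}_{\ell+1}$-Toda chain: $$\mathcal H_r^{\mathfrak{gl}_{\ell+1}}(\underline p_{\ell+1})=\sum_{i_1<\cdots<i_r}\Big(\widetilde X_{i_1}^{1-\delta_{i_2-i_1,1}}\cdots\widetilde X_{i_{r-1}}^{1-\delta_{i_r-i_{r-1},1}}\widetilde X_{i_r}^{1-\delta_{i_{r+1}-i_r,1}}\Big)T_{i_1}\cdots T_{i_r},\qquad i_{r+1}:=\ell+2,$$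 the sum over $\{i_1<\cdots<i_r\}\subset\{1,\ldots,\ell+1\}$, where $T_i$ shifts $p_{\ell+1,i}$ to $p_{\ell+1,i}+1$, $\widetilde X_i=1-q^{p_{\ell+1,i}-p_{\ell+1,i+1}+1}$ for $i\le\ell$, $\widetilde X_{\ell+1}=1$. Dual Hamiltonians: $$\mathcal H_r^\vee(z)=q^{r(r-1)/2}\sum_{|I|=r}\ \prod_{i\in I,\,j\notin I}\frac{z_j}{z_j-z_i}\ \prod_{i\in I}T_{z_i},$$ the sum over $r$-element subsets $I\subset\{1,\ldots,\ell+1\}$, where $T_{z_i}$ replaces $z_i$ by $qz_i$ (equations involving them are for pairwise distinct $z_i$). *)

theory Defs
  imports "HOL-Complex_Analysis.Complex_Analysis" "HOL-Combinatorics.Permutations"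
begin

(* Tuples p_{l+1,1}, ..., p_{l+1,l+1} and z_1, ..., z_{l+1} are functions on nat of which only
   the values on {1..l+1} matter; an array x_{n,j} is a function on pairs (n, j). *)

(* At a pole 1 - x q^j = 0 the value is 0, as inverse 0 = 0; hence 1 / q_Gamma q x is
   the entire function prod_j (1 - x q^j) of x at every point, poles of q_Gamma included. *)
definition q_Gamma :: "real \<Rightarrow> complex \<Rightarrow> complex" where
  "q_Gamma q x = (\<Prod>j. inverse (1 - x * of_real q ^ j))"

definition qq_inf :: "real \<Rightarrow> real" where
  "qq_inf q = (\<Prod>m. 1 - q ^ Suc m)"

(* The radius of the circles carrying x_{n,1}, ..., x_{n,n} is rho n. *)
definition admissible_radii :: "nat \<Rightarrow> (nat \<Rightarrow> complex) \<Rightarrow> (nat \<Rightarrow> real) \<Rightarrow> bool" where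
  "admissible_radii l z \<rho> \<longleftrightarrow>
     (\<forall>n\<in>{1..l}. 0 < \<rho> n) \<and>
     (\<forall>n\<in>{1..<l}. \<rho> (n + 1) < \<rho> n) \<and>
     (\<forall>m\<in>{1..l+1}. norm (z m) < \<rho> l)"

(* Integral of F against the product of dx_{n,j} / (2 pi i x_{n,j}) over the listed index pairs,
   each variable running over the circle of radius rho n about 0; the entries of x at all
   other index pairs are kept as parameters. *)
primrec torus_integral ::
    "(nat \<Rightarrow> real) \<Rightarrow> (nat \<times> nat) list \<Rightarrow> ((nat \<times> nat \<Rightarrow> complex) \<Rightarrow> complex)
      \<Rightarrow> (nat \<times> nat \<Rightarrow> complex) \<Rightarrow> complex" where
  "torus_integral \<rho> [] F x = F x"
| "torus_integral \<rho> (v # vs) F x =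
     contour_integral (circlepath 0 (\<rho> (fst v)))
       (\<lambda>w. torus_integral \<rho> vs F (x(v := w)) / (2 * of_real pi * \<i> * w))"

definition mb_indices :: "nat \<Rightarrow> (nat \<times> nat) list" where
  "mb_indices l = [(n, j). n \<leftarrow> rev [1..<Suc l], j \<leftarrow> [1..<Suc n]]"

(* The entries that are not integrated over: x_{l+1,i} = z_i and x_{n-1,n} = 1. *)
definition mb_frame :: "nat \<Rightarrow> (nat \<Rightarrow> complex) \<Rightarrow> nat \<times> nat \<Rightarrow> complex" where
  "mb_frame l z = (\<lambda>(n, j). if n = l + 1 then z j else 1)"

definition mb_integrand ::
    "nat \<Rightarrow> real \<Rightarrow> (nat \<Rightarrow> int) \<Rightarrow> (nat \<times> nat \<Rightarrow> complex) \<Rightarrow> complex" where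
  "mb_integrand l q p x =
     (\<Prod>n=1..l+1. \<Prod>j=1..n. (x (n, j) / x (n - 1, j)) powi p n) *
     (\<Prod>n=1..l.
        (\<Prod>k=1..n. \<Prod>m=1..n+1. q_Gamma q (inverse (x (n, k)) * x (n + 1, m))) /
        (fact n *
         (\<Prod>(s, t)\<in>{(s, t). s \<in> {1..n} \<and> t \<in> {1..n} \<and> s \<noteq> t}.
            q_Gamma q (x (n, s) * inverse (x (n, t))))))"

definition mb_Psi ::
    "nat \<Rightarrow> real \<Rightarrow> (nat \<Rightarrow> real) \<Rightarrow> (nat \<Rightarrow> complex) \<Rightarrow> (nat \<Rightarrow> int) \<Rightarrow> complex" where
  "mb_Psi l q \<rho> z p =
     (if \<forall>i\<in>{1..l}. p (i + 1) \<le> p i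
      then of_real (qq_inf q) ^ (l * (l - 1) div 2) *
           torus_integral \<rho> (mb_indices l) (mb_integrand l q p) (mb_frame l z)
      else 0)"

definition X_tilde :: "nat \<Rightarrow> real \<Rightarrow> (nat \<Rightarrow> int) \<Rightarrow> nat \<Rightarrow> real" where
  "X_tilde l q p i = (if i \<le> l then 1 - q powi (p i - p (i + 1) + 1) else 1)"

(* is lists i_1 < ... < i_r followed by i_{r+1} = l + 2. The product T_{i_1} ... T_{i_r} of
   commuting shifts raises all coordinates in I by 1. *)
definition toda_H ::
    "nat \<Rightarrow> real \<Rightarrow> nat \<Rightarrow> ((nat \<Rightarrow> int) \<Rightarrow> complex) \<Rightarrow> (nat \<Rightarrow> int) \<Rightarrow> complex" where
  "toda_H l q r f p =
     (\<Sum>I\<in>{I. I \<subseteq> {1..l+1} \<and> card I = r}.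
        (let is = sorted_list_of_set I @ [l + 2] in
          of_real (\<Prod>k<r. X_tilde l q p (is ! k) ^
                           (1 - (if is ! (k + 1) - is ! k = 1 then 1 else 0)))) *
        f (\<lambda>i. if i \<in> I then p i + 1 else p i))"

definition toda_H_dual ::
    "nat \<Rightarrow> real \<Rightarrow> nat \<Rightarrow> ((nat \<Rightarrow> complex) \<Rightarrow> complex) \<Rightarrow> (nat \<Rightarrow> complex) \<Rightarrow> complex" where
  "toda_H_dual l q r g z =
     of_real q ^ (r * (r - 1) div 2) *
     (\<Sum>I\<in>{I. I \<subseteq> {1..l+1} \<and> card I = r}.
        (\<Prod>i\<in>I. \<Prod>j\<in>{1..l+1} - I. z j / (z j - z i)) *
        g (\<lambda>i. if i \<in> I then of_real q * z i else z i))"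

definition toda_chi :: "nat \<Rightarrow> nat \<Rightarrow> (nat \<Rightarrow> complex) \<Rightarrow> complex" where
  "toda_chi l r z = (\<Sum>I\<in>{I. I \<subseteq> {1..l+1} \<and> card I = r}. \<Prod>i\<in>I. z i)"

end

theory Submission
  imports Defs
begin

text \<open>
  Integrating row by row, the function of the \<open>(n+1)\<close>-st row is the pairing, over the torus of the
  \<open>n\<close>-th row, of the kernel \<open>\<Prod> \<Gamma>\<^sub>q (x\<^sub>n\<^sub>+\<^sub>1\<^sub>,\<^sub>m / x\<^sub>n\<^sub>,\<^sub>k)\<close> with the function of the \<open>n\<close>-th row, and this makes sense
  for all integers \<open>p\<close>. Both systems of equations hold for all integers \<open>p\<close>, by induction on \<open>n\<close>.
  Substituting \<open>x\<^sub>i / q\<close> for \<open>x\<^sub>i\<close> and moving the contour back shows that the adjoint of a dual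
  operator acts on the kernel by multiplication with a rational function. For the dual equations this reduces the
  claim to a duality of two rational functions of sizes \<open>n + 1\<close> and \<open>n\<close>. For the Toda equations, the
  terms that the new factor \<open>1 - q\<^bsup>p\<^sub>n - p\<^sub>n\<^sub>+\<^sub>1 + 1\<^esup>\<close> adds are a commutator of the first dual operator with the
  multiplication by an elementary symmetric function, and the claim becomes a Lagrange interpolation identity.
  Finally the Toda equation of order \<open>n\<close> and homogeneity show that the integral itself vanishes for nondominant \<open>p\<close>,
  so that extending it by zero changes nothing.
\<close>

section \<open>The infinite q-Pochhammer symbol and means over circles\<close>

text \<open>Three obstacles shape the proof. The Toda Hamiltonians leave the dominant cone: raising
  only \<open>p (Suc i)\<close> where \<open>p i = p (Suc i)\<close> gives a nondominant argument,
  and the coefficient of that term need not vanish. The equations therefore do not close up inside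
  the cone; they are proved for the integral at all integers, and vanishing outside the cone is
  derived from them. All circles of a row have the same radius, so the coefficients of the dual
  operators, with denominators \<open>x (n, j) - x (n, i)\<close>, are singular on the torus. The
  zeros of the weight cancel these poles, hence weight times coefficient is holomorphic and contours
  can be moved; where rational identities are used pointwise, the radii within the row are taken
  distinct. The two systems are coupled. Passing from row \<open>n\<close> to row
  \<open>n + 1\<close>, the Toda coefficients acquire the power \<open>q powi p n\<close>, which is
  an eigenvalue of the first dual operator on row \<open>n\<close>. So the dual equations come first
  and feed the induction for the Toda equations.\<close>

definition q_poch :: "real \<Rightarrow> complex \<Rightarrow> complex" where
  "q_poch q x = (\<Prod>j. 1 - x * of_real q ^ j)"

context
  fixes q :: real
  assumes q: "0 < q" "q < 1"
begin

lemma summable_q_poch: "summable (\<lambda>j. norm (x * complex_of_real q ^ j))"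
  using q by (auto simp: norm_mult norm_power intro!: summable_mult summable_geometric)

lemma convergent_prod_q_poch: "convergent_prod (\<lambda>j. 1 - x * complex_of_real q ^ j)"
proof -
  have "summable (\<lambda>j. norm ((1 - x * complex_of_real q ^ j) - 1))"
    using summable_q_poch[of x] by simp
  then show ?thesis
    by (intro abs_convergent_prod_imp_convergent_prod summable_imp_abs_convergent_prod)
qed

text \<open>Valid at the poles too: a convergent product with a zero factor has value 0, and so has
  the product of the inverses under \<open>inverse 0 = 0\<close>. This matters for the weight, whose
  factors vanish where two entries of a row coincide.\<close>

lemma q_Gamma_eq: "q_Gamma q x = inverse (q_poch q x)"
  unfolding q_Gamma_def q_poch_def by (rule prodinf_inverse[OF convergent_prod_q_poch])

text \<open>The rational functions that q-shifts produce from the kernel and the weight all come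
  from this functional equation.\<close>

lemma q_poch_rec: "q_poch q x = (1 - x) * q_poch q (of_real q * x)"
proof -
  have "(\<lambda>j. 1 - x * complex_of_real q ^ j) has_prod
      ((\<Prod>k<1. 1 - x * complex_of_real q ^ k) * (\<Prod>k. 1 - x * complex_of_real q ^ (k + 1)))"
    by (rule has_prod_ignore_initial_segment'[OF convergent_prod_q_poch])
  then have "q_poch q x = (1 - x) * (\<Prod>k. 1 - x * complex_of_real q ^ (k + 1))"
    unfolding q_poch_def by (metis (no_types, lifting) has_prod_unique lessThan_Suc_atMost One_nat_def atMost_0 prod.insert finite.emptyI empty_iff prod.empty mult_1_right power_0)
  also have "(\<lambda>k. 1 - x * complex_of_real q ^ (k + 1)) = (\<lambda>k. 1 - of_real q * x * of_real q ^ k)"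
    by (simp add: algebra_simps)
  finally show ?thesis by (simp add: q_poch_def)
qed

lemma q_poch_nonzero:
  assumes "norm x < 1"
  shows "q_poch q x \<noteq> 0"
  unfolding q_poch_def
proof (rule prodinf_nonzero[OF convergent_prod_q_poch])
  fix j
  have "q ^ j \<le> 1" using q by (simp add: power_le_one)
  then have "norm (x * complex_of_real q ^ j) \<le> norm x"
    using q by (simp add: norm_mult norm_power mult_left_le)
  then have "norm (x * complex_of_real q ^ j) < 1"
    using assms by linarith
  then have "x * complex_of_real q ^ j \<noteq> 1"
    by (metis norm_one less_irrefl)
  then show "1 - x * complex_of_real q ^ j \<noteq> 0"
    by simp
qed

lemma q_poch_holomorphic: "q_poch q holomorphic_on A"
proof -
  have "q_poch q holomorphic_on ball 0 R" for R :: real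
  proof -
    have unif: "uniformly_convergent_on (cball 0 R)
        (\<lambda>N x. \<Prod>n<N. 1 - x * complex_of_real q ^ n)"
    proof (rule uniformly_convergent_on_prod')
      show "uniformly_convergent_on (cball 0 R)
          (\<lambda>N x. \<Sum>n<N. norm (1 - x * complex_of_real q ^ n - 1))"
      proof (rule Weierstrass_m_test'_ev)
        show "\<forall>\<^sub>F n in sequentially. \<forall>x\<in>cball 0 R.
            norm (norm (1 - x * complex_of_real q ^ n - 1)) \<le> \<bar>R\<bar> * q ^ n"
          using q by (intro always_eventually) (auto simp: norm_mult norm_power intro!: mult_right_mono)
        show "summable (\<lambda>n. \<bar>R\<bar> * q ^ n)"
          using q by (intro summable_mult summable_geometric) auto
      qed
    qed (auto intro!: continuous_intros)
    then obtain g where g: "uniform_limit (cball 0 R)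
        (\<lambda>N x. \<Prod>n<N. 1 - x * complex_of_real q ^ n) g sequentially"
      by (auto simp: uniformly_convergent_on_def)
    have holo: "g holomorphic_on ball 0 R"
    proof (rule holomorphic_uniform_limit[OF _ g])
      show "\<forall>\<^sub>F n in sequentially.
          continuous_on (cball 0 R) (\<lambda>x. \<Prod>n<n. 1 - x * complex_of_real q ^ n) \<and>
          (\<lambda>x. \<Prod>n<n. 1 - x * complex_of_real q ^ n) holomorphic_on ball 0 R"
        by (intro always_eventually allI conjI continuous_intros holomorphic_intros)
    qed auto
    have "g x = q_poch q x" if "x \<in> ball 0 R" for x
    proof -
      have "(\<lambda>N. \<Prod>n<N. 1 - x * complex_of_real q ^ n) \<longlonglongrightarrow> g x"
        by (rule tendsto_uniform_limitI[OF g]) (use that in auto)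
      moreover have "(\<lambda>N. \<Prod>n<N. 1 - x * complex_of_real q ^ n) \<longlonglongrightarrow> q_poch q x"
        unfolding q_poch_def
        using convergent_prod_LIMSEQ[OF convergent_prod_q_poch[of x]]
        by (subst LIMSEQ_lessThan_iff_atMost) simp
      ultimately show ?thesis by (rule LIMSEQ_unique)
    qed
    with holo show ?thesis by (metis holomorphic_transform)
  qed
  then have "q_poch q holomorphic_on (\<Union>R. ball 0 R)"
    by (intro holomorphic_on_UN_open) auto
  moreover have "(\<Union>R. ball 0 R) = (UNIV :: complex set)"
    by (auto intro: gt_ex)
  ultimately show ?thesis by (metis holomorphic_on_subset subset_UNIV)
qed

end

section \<open>Normalised means over circles: scaling, deformation, dependence on parameters\<close>

definition circle_mean :: "real \<Rightarrow> (complex \<Rightarrow> complex) \<Rightarrow> complex" where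
  "circle_mean r f = integral {0..1} (\<lambda>t. f (of_real r * exp (2 * of_real pi * \<i> * of_real t)))"

lemma circle_mean_eq_contour_integral:
  assumes "r \<noteq> 0"
  shows "contour_integral (circlepath 0 r) (\<lambda>w. f w / (2 * of_real pi * \<i> * w)) = circle_mean r f"
  unfolding circle_mean_def contour_integral_integral vector_derivative_circlepath
  using assms by (intro integral_cong) (simp add: circlepath field_simps)

lemma circle_point [simp]:
  "norm (of_real r * exp (2 * of_real pi * \<i> * of_real t)) = \<bar>r\<bar>"
  by (simp add: norm_mult)

lemma circle_mean_cong:
  assumes "0 \<le> r" and "\<And>w. norm w = r \<Longrightarrow> f w = g w"
  shows "circle_mean r f = circle_mean r g"
  unfolding circle_mean_def using assms by (intro integral_cong) (simp add: norm_mult)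

text \<open>The reason for integrating over the angle: dilating the variable is literally a change
  of radius, without any substitution in a contour integral.\<close>

lemma circle_mean_scale: "circle_mean (c * r) f = circle_mean r (\<lambda>w. f (of_real c * w))"
  unfolding circle_mean_def by (simp add: mult.assoc)

lemma circle_mean_cmult: "circle_mean r (\<lambda>w. c * f w) = c * circle_mean r f"
  unfolding circle_mean_def by simp

lemma circle_mean_sum:
  assumes "finite I" and "0 \<le> r" and "\<And>i. i \<in> I \<Longrightarrow> continuous_on (sphere 0 r) (f i)"
  shows "circle_mean r (\<lambda>w. \<Sum>i\<in>I. f i w) = (\<Sum>i\<in>I. circle_mean r (f i))"
  unfolding circle_mean_def
proof (rule integral_sum[OF assms(1)])
  fix i assume "i \<in> I"
  show "(\<lambda>t. f i (of_real r * exp (2 * of_real pi * \<i> * of_real t))) integrable_on {0..1}"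
    by (intro integrable_continuous_interval continuous_on_compose2[OF assms(3)[OF \<open>i \<in> I\<close>]]
        continuous_intros) (use assms(2) in auto)
qed

text \<open>Cauchy's theorem for concentric circles: segments between points of equal angle give a
  homotopy inside the closed annulus. The origin is removed from \<open>S\<close> because of the
  pole of the measure \<open>dw / w\<close>.\<close>

lemma circle_mean_deform:
  assumes "f holomorphic_on S" "open S" "0 < r" "0 < s"
    and "\<And>w. \<lbrakk>min r s \<le> norm w; norm w \<le> max r s\<rbrakk> \<Longrightarrow> w \<in> S"
  shows "circle_mean r f = circle_mean s f"
proof -
  have seg: "closed_segment (circlepath 0 r t) (circlepath 0 s t) \<subseteq> S - {0}" for t
  proof
    fix w assume "w \<in> closed_segment (circlepath 0 r t) (circlepath 0 s t)"
    then obtain u where u: "0 \<le> u" "u \<le> 1"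
      "w = (1 - u) *\<^sub>R circlepath 0 r t + u *\<^sub>R circlepath 0 s t"
      by (auto simp: closed_segment_def)
    then have "w = of_real ((1 - u) * r + u * s) * exp (2 * of_real pi * \<i> * of_real t)"
      by (simp add: circlepath scaleR_conv_of_real algebra_simps)
    then have "norm w = \<bar>(1 - u) * r + u * s\<bar>"
      by (simp only: circle_point)
    moreover have "min r s \<le> (1 - u) * r + u * s"
      using convex_bound_le[of "- r" "- min r s" "- s" "1 - u" u] u by simp
    moreover have "(1 - u) * r + u * s \<le> max r s"
      using convex_bound_le[of r "max r s" s "1 - u" u] u by simp
    ultimately have "min r s \<le> norm w" "norm w \<le> max r s" "norm w > 0"
      using assms(3,4) by auto
    then show "w \<in> S - {0}" using assms(5) by auto
  qed
  have "contour_integral (circlepath 0 r) (\<lambda>w. f w / (2 * of_real pi * \<i> * w)) =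
        contour_integral (circlepath 0 s) (\<lambda>w. f w / (2 * of_real pi * \<i> * w))"
  proof (rule Cauchy_theorem_homotopic_loops)
    show "homotopic_loops (S - {0}) (circlepath 0 r) (circlepath 0 s)"
      by (rule homotopic_loops_linear) (use seg in auto)
    show "(\<lambda>w. f w / (2 * of_real pi * \<i> * w)) holomorphic_on S - {0}"
      by (intro holomorphic_intros holomorphic_on_subset[OF assms(1)]) auto
  qed (use assms in \<open>auto simp: open_Diff\<close>)
  then show ?thesis using assms by (simp add: circle_mean_eq_contour_integral)
qed

text \<open>Morera's theorem: the integral over a triangle is exchanged with the integral over the
  circle, and then vanishes for each point of the circle by Cauchy's theorem.\<close>

lemma circle_mean_holomorphic:
  assumes cont: "continuous_on (S \<times> sphere 0 r) (\<lambda>(w, s). f w s)"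
    and holo: "\<And>s. norm s = r \<Longrightarrow> (\<lambda>w. f w s) holomorphic_on S"
    and S: "open S" and r: "0 < r"
  shows "(\<lambda>w. circle_mean r (f w)) holomorphic_on S"
proof -
  let ?g = "\<lambda>w s. f w s / (2 * of_real pi * \<i> * s)"
  have eq: "(\<lambda>w. circle_mean r (f w)) = (\<lambda>w. contour_integral (circlepath 0 r) (?g w))"
    using r by (simp add: circle_mean_eq_contour_integral)
  have contg: "continuous_on (S \<times> sphere 0 r) (\<lambda>(w, s). ?g w s)"
    unfolding case_prod_beta
    using cont r by (intro continuous_intros) (auto simp: case_prod_beta)
  have holog: "(\<lambda>w. ?g w s) holomorphic_on S" if "norm s = r" for s
    using that r by (intro holomorphic_intros holo) auto
  have swap: "contour_integral (linepath a b) (\<lambda>w. contour_integral (circlepath 0 r) (?g w)) =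
      contour_integral (circlepath 0 r) (\<lambda>s. contour_integral (linepath a b) (\<lambda>w. ?g w s))"
    if "closed_segment a b \<subseteq> S" for a b
  proof (rule contour_integral_swap)
    show "continuous_on (path_image (linepath a b) \<times> path_image (circlepath 0 r)) (\<lambda>(w, s). ?g w s)"
      by (rule continuous_on_subset[OF contg]) (use that r in auto)
    show "continuous_on {0..1} (\<lambda>t. vector_derivative (circlepath 0 r) (at t))"
      unfolding vector_derivative_circlepath by (intro continuous_intros)
  qed auto
  have cint: "(\<lambda>s. contour_integral (linepath a b) (\<lambda>w. ?g w s)) contour_integrable_on circlepath 0 r"
    if "closed_segment a b \<subseteq> S" for a b
  proof -
    have "continuous_on (sphere 0 r) (\<lambda>s. contour_integral (linepath a b) (\<lambda>w. ?g w s))"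
    proof -
      have "continuous_on (sphere 0 r \<times> cbox 0 1)
          (\<lambda>x. (\<lambda>(w, s). ?g w s) (linepath a b (snd x), fst x))"
      proof (rule continuous_on_compose2[OF contg])
        show "continuous_on (sphere 0 r \<times> cbox 0 1) (\<lambda>x. (linepath a b (snd x), fst x))"
          unfolding linepath_def by (intro continuous_intros)
        show "(\<lambda>x. (linepath a b (snd x), fst x)) ` (sphere 0 r \<times> cbox 0 1) \<subseteq> S \<times> sphere 0 r"
          using subsetD[OF that] linepath_in_path[of _ a b] by (auto simp: cbox_interval)
      qed
      then have "continuous_on (sphere 0 r \<times> cbox 0 1)
          (\<lambda>(s, t). ?g (linepath a b t) s * (b - a))"
        unfolding case_prod_beta fst_conv snd_conv by (rule continuous_on_mult) (rule continuous_on_const)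
      from integral_continuous_on_param[OF this] show ?thesis
        by (simp add: contour_integral_integral)
    qed
    then show ?thesis using r
      by (intro contour_integrable_continuous_circlepath) auto
  qed
  have conti: "continuous_on S (\<lambda>w. contour_integral (circlepath 0 r) (?g w))"
  proof -
    have "continuous_on (S \<times> cbox 0 1)
        (\<lambda>(w, t). f w (of_real r * exp (2 * of_real pi * \<i> * of_real t)))"
      unfolding case_prod_beta
      by (intro continuous_intros continuous_on_compose2[OF cont[unfolded case_prod_beta],
              of _ "\<lambda>y. (fst y, of_real r * exp (2 * of_real pi * \<i> * of_real (snd y)))", simplified])
        (use r in \<open>auto simp: norm_mult\<close>)
    from integral_continuous_on_param[OF this] show ?thesis
      unfolding eq[symmetric] by (simp add: circle_mean_def)
  qed
  have "(\<lambda>w. circle_mean r (f w)) analytic_on S"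
    unfolding eq
  proof (rule Morera_triangle[OF conti S], intro impI)
    fix a b c assume hull: "convex hull {a, b, c} \<subseteq> S"
    have sub: "closed_segment a b \<subseteq> S" "closed_segment b c \<subseteq> S" "closed_segment c a \<subseteq> S"
      using hull hull_mono[of _ "{a,b,c}" convex]
      by (metis segment_convex_hull insert_subset order_trans subset_insertI insertI1 insert_commute empty_subsetI)+
    let ?h = "\<lambda>a b. contour_integral (circlepath 0 r) (\<lambda>s. contour_integral (linepath a b) (\<lambda>w. ?g w s))"
    have "?h a b + ?h b c + ?h c a = contour_integral (circlepath 0 r) (\<lambda>s.
        contour_integral (linepath a b) (\<lambda>w. ?g w s) +
        contour_integral (linepath b c) (\<lambda>w. ?g w s) +
        contour_integral (linepath c a) (\<lambda>w. ?g w s))"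
      using cint sub by (simp add: contour_integral_add contour_integrable_add)
    also have "\<dots> = contour_integral (circlepath 0 r) (\<lambda>s. 0)"
    proof (rule contour_integral_cong)
      fix s assume "s \<in> path_image (circlepath 0 r)"
      then have "norm s = r" using r by auto
      have hs: "(\<lambda>w. ?g w s) holomorphic_on convex hull {a, b, c}"
        by (rule holomorphic_on_subset[OF holog[OF \<open>norm s = r\<close>] hull])
      have int: "(\<lambda>w. ?g w s) contour_integrable_on linepath u v" if "closed_segment u v \<subseteq> S" for u v
        by (intro contour_integrable_continuous_linepath holomorphic_on_imp_continuous_on
            holomorphic_on_subset[OF holog[OF \<open>norm s = r\<close>] that])
      from Cauchy_theorem_triangle[OF hs]
      have "contour_integral (linepath a b +++ linepath b c +++ linepath c a) (\<lambda>w. ?g w s) = 0"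
        by (rule contour_integral_unique)
      then show "contour_integral (linepath a b) (\<lambda>w. ?g w s) +
          contour_integral (linepath b c) (\<lambda>w. ?g w s) +
          contour_integral (linepath c a) (\<lambda>w. ?g w s) = 0"
        using int sub by (simp add: contour_integral_join valid_path_join contour_integrable_joinI add.assoc)
    qed simp
    finally show "contour_integral (linepath a b) (\<lambda>w. contour_integral (circlepath 0 r) (?g w)) +
        contour_integral (linepath b c) (\<lambda>w. contour_integral (circlepath 0 r) (?g w)) +
        contour_integral (linepath c a) (\<lambda>w. contour_integral (circlepath 0 r) (?g w)) = 0"
      by (simp add: swap sub)
  qed
  then show ?thesis by (rule analytic_imp_holomorphic)
qed

section \<open>Separately holomorphic functions and means over tori\<close>

text \<open>Osgood's form of holomorphy in several variables. Contours are moved in one variable at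
  a time, for which holomorphy in each variable is the right notion; joint continuity is what the
  remaining integrals need.\<close>

definition sep_holomorphic :: "('v \<Rightarrow> complex set) \<Rightarrow> (('v \<Rightarrow> complex) \<Rightarrow> complex) \<Rightarrow> bool" where
  "sep_holomorphic A F \<longleftrightarrow> continuous_on (Pi UNIV A) F \<and>
     (\<forall>x\<in>Pi UNIV A. \<forall>v. (\<lambda>w. F (x(v := w))) holomorphic_on A v)"

lemma sep_holomorphic_subset:
  assumes "sep_holomorphic A F" and "\<And>v. B v \<subseteq> A v"
  shows "sep_holomorphic B F"
proof -
  have "Pi UNIV B \<subseteq> Pi UNIV A" using assms(2) by auto
  then show ?thesis
    using assms unfolding sep_holomorphic_def
    by (meson continuous_on_subset holomorphic_on_subset subsetD)
qed

lemma fun_upd_in_Pi: "x \<in> Pi UNIV A \<Longrightarrow> w \<in> A v \<Longrightarrow> x(v := w) \<in> Pi UNIV A"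
  by (auto simp: Pi_iff)

lemma sep_holomorphic_cong:
  assumes "sep_holomorphic A F" and "\<And>x. x \<in> Pi UNIV A \<Longrightarrow> F x = G x"
  shows "sep_holomorphic A G"
  unfolding sep_holomorphic_def
proof (intro conjI ballI allI)
  show "continuous_on (Pi UNIV A) G"
    using assms continuous_on_cong[of "Pi UNIV A" "Pi UNIV A" F G]
    by (simp add: sep_holomorphic_def)
  fix x v assume "x \<in> Pi UNIV A"
  then show "(\<lambda>w. G (x(v := w))) holomorphic_on A v"
    using assms unfolding sep_holomorphic_def
    by (metis (no_types, lifting) fun_upd_in_Pi holomorphic_transform)
qed

lemma sep_holomorphic_const [simp]: "sep_holomorphic A (\<lambda>_. c)"
  by (simp add: sep_holomorphic_def)

lemma sep_holomorphic_coordinate: "sep_holomorphic A (\<lambda>x. x v)"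
  unfolding sep_holomorphic_def
proof (intro conjI ballI allI)
  show "continuous_on (Pi UNIV A) (\<lambda>x. x v)"
    by (rule continuous_on_subset[OF continuous_on_product_coordinates]) auto
  fix x u show "(\<lambda>w. (x(u := w)) v) holomorphic_on A u"
    by (cases "u = v") (auto intro: holomorphic_intros)
qed

lemma sep_holomorphic_mult:
  "sep_holomorphic A F \<Longrightarrow> sep_holomorphic A G \<Longrightarrow> sep_holomorphic A (\<lambda>x. F x * G x)"
  unfolding sep_holomorphic_def by (auto intro!: continuous_intros holomorphic_intros)

lemma sep_holomorphic_sum:
  "(\<And>i. i \<in> I \<Longrightarrow> sep_holomorphic A (F i)) \<Longrightarrow> sep_holomorphic A (\<lambda>x. \<Sum>i\<in>I. F i x)"
  unfolding sep_holomorphic_def by (auto intro!: continuous_intros holomorphic_intros)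

lemma sep_holomorphic_prod:
  "(\<And>i. i \<in> I \<Longrightarrow> sep_holomorphic A (F i)) \<Longrightarrow> sep_holomorphic A (\<lambda>x. \<Prod>i\<in>I. F i x)"
  unfolding sep_holomorphic_def by (auto intro!: continuous_intros holomorphic_intros)

lemma sep_holomorphic_compose:
  assumes "f holomorphic_on S" and "sep_holomorphic A F" and "\<And>x. x \<in> Pi UNIV A \<Longrightarrow> F x \<in> S"
  shows "sep_holomorphic A (\<lambda>x. f (F x))"
  unfolding sep_holomorphic_def
proof (intro conjI ballI allI)
  show "continuous_on (Pi UNIV A) (\<lambda>x. f (F x))"
    using assms by (intro continuous_on_compose2[OF holomorphic_on_imp_continuous_on[OF assms(1)]])
      (auto simp: sep_holomorphic_def)
  fix x v assume "x \<in> Pi UNIV A"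
  then show "(\<lambda>w. f (F (x(v := w)))) holomorphic_on A v"
    using assms(2) unfolding sep_holomorphic_def
    by (intro holomorphic_on_compose_gen[OF _ assms(1), unfolded o_def])
      (auto intro!: assms(3) fun_upd_in_Pi)
qed

lemma sep_holomorphic_inverse:
  assumes "sep_holomorphic A F" and "\<And>x. x \<in> Pi UNIV A \<Longrightarrow> F x \<noteq> 0"
  shows "sep_holomorphic A (\<lambda>x. inverse (F x))"
  by (rule sep_holomorphic_compose[of inverse "- {0}"]) (use assms in \<open>auto intro!: holomorphic_intros\<close>)

lemma sep_holomorphic_divide:
  assumes "sep_holomorphic A F" "sep_holomorphic A G" and "\<And>x. x \<in> Pi UNIV A \<Longrightarrow> G x \<noteq> 0"
  shows "sep_holomorphic A (\<lambda>x. F x / G x)"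
  unfolding divide_inverse using assms by (intro sep_holomorphic_mult sep_holomorphic_inverse)

lemma sep_holomorphic_power_int:
  assumes "sep_holomorphic A F" and "\<And>x. x \<in> Pi UNIV A \<Longrightarrow> F x \<noteq> 0"
  shows "sep_holomorphic A (\<lambda>x. F x powi n)"
  by (rule sep_holomorphic_compose[of "\<lambda>w. w powi n" "- {0}"]) (use assms in \<open>auto intro!: holomorphic_intros\<close>)

lemma sep_holomorphic_dilate:
  assumes "sep_holomorphic A F" and "\<And>v w. w \<in> B v \<Longrightarrow> c v * w \<in> A v"
  shows "sep_holomorphic B (\<lambda>x. F (\<lambda>v. c v * x v))"
  unfolding sep_holomorphic_def
proof (intro conjI ballI allI)
  have coord: "continuous_on (Pi UNIV B) (\<lambda>x. x v)" for v
    by (rule continuous_on_subset[OF continuous_on_product_coordinates]) auto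
  have "continuous_on (Pi UNIV B) (\<lambda>x v. c v * x v)"
    by (intro continuous_on_coordinatewise_then_product continuous_on_mult continuous_on_const coord)
  moreover have "(\<lambda>x v. c v * x v) ` Pi UNIV B \<subseteq> Pi UNIV A"
    using assms(2) by auto
  moreover have "continuous_on (Pi UNIV A) F"
    using assms(1) by (simp add: sep_holomorphic_def)
  ultimately show "continuous_on (Pi UNIV B) (\<lambda>x. F (\<lambda>v. c v * x v))"
    by (rule continuous_on_compose2[rotated 1])
  fix x u assume x: "x \<in> Pi UNIV B"
  have "(\<lambda>v. c v * x v) \<in> Pi UNIV A"
    using x assms(2) by auto
  then have holo: "(\<lambda>w. F ((\<lambda>v. c v * x v)(u := w))) holomorphic_on A u"
    using assms(1) by (simp add: sep_holomorphic_def)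
  have "(\<lambda>w. F ((\<lambda>v. c v * x v)(u := c u * w))) holomorphic_on B u"
  proof (rule holomorphic_on_compose_gen[OF _ holo, unfolded o_def])
    show "(\<lambda>w. c u * w) holomorphic_on B u" by (intro holomorphic_intros)
    show "(\<lambda>w. c u * w) ` B u \<subseteq> A u" using assms(2) by auto
  qed
  moreover have "(\<lambda>v. c v * x v)(u := c u * w) = (\<lambda>v. c v * (x(u := w)) v)" for w
    by auto
  ultimately show "(\<lambda>w. F (\<lambda>v. c v * (x(u := w)) v)) holomorphic_on B u"
    by simp
qed

text \<open>Closure under averaging over one coordinate is what allows the circles of a torus to be
  moved one after the other.\<close>

lemma sep_holomorphic_circle_mean:
  assumes F: "sep_holomorphic A F" and A: "\<And>v. open (A v)" and r: "0 < r" "sphere 0 r \<subseteq> A v"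
  shows "sep_holomorphic A (\<lambda>x. circle_mean r (\<lambda>w. F (x(v := w))))"
  unfolding sep_holomorphic_def
proof (intro conjI ballI allI)
  have cont: "continuous_on (Pi UNIV A) F" using F by (simp add: sep_holomorphic_def)
  let ?c = "\<lambda>t. of_real r * exp (2 * of_real pi * \<i> * of_real t)"
  have "continuous_on (Pi UNIV A \<times> cbox 0 1) (\<lambda>y. F ((fst y)(v := ?c (snd y))))"
  proof (rule continuous_on_compose2[OF cont])
    show "continuous_on (Pi UNIV A \<times> cbox 0 1) (\<lambda>y. (fst y)(v := ?c (snd y)))"
    proof (rule continuous_on_coordinatewise_then_product)
      fix u
      have "continuous_on (Pi UNIV A \<times> cbox 0 1) (\<lambda>y. fst y u)"
        by (rule continuous_on_compose2[OF continuous_on_product_coordinates])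
          (auto intro: continuous_intros)
      moreover have "continuous_on (Pi UNIV A \<times> cbox 0 1) (\<lambda>y. ?c (snd y))"
        by (intro continuous_intros)
      ultimately show "continuous_on (Pi UNIV A \<times> cbox 0 1) (\<lambda>y. ((fst y)(v := ?c (snd y))) u)"
        by (cases "u = v") (simp_all only: fun_upd_apply if_True if_False simp_thms)
    qed
    show "(\<lambda>y. (fst y)(v := ?c (snd y))) ` (Pi UNIV A \<times> cbox 0 1) \<subseteq> Pi UNIV A"
      using r by (auto intro!: fun_upd_in_Pi simp del: PiE PiE_iff simp: subset_iff)
  qed
  then have "continuous_on (Pi UNIV A \<times> cbox 0 1) (\<lambda>(x, t). F (x(v := ?c t)))"
    by (simp add: case_prod_beta)
  from integral_continuous_on_param[OF this]
  show "continuous_on (Pi UNIV A) (\<lambda>x. circle_mean r (\<lambda>w. F (x(v := w))))"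
    by (simp add: circle_mean_def)
next
  fix x u assume x: "x \<in> Pi UNIV A"
  show "(\<lambda>w. circle_mean r (\<lambda>s. F (x(u := w, v := s)))) holomorphic_on A u"
  \<comment> \<open>Averaging over coordinate \<open>v\<close> overwrites it, so the mean is
    constant in that coordinate.\<close>
  proof (cases "u = v")
    case True
    then show ?thesis by simp
  next
    case False
    show ?thesis
    proof (rule circle_mean_holomorphic[OF _ _ A r(1)])
      show "continuous_on (A u \<times> sphere 0 r) (\<lambda>(w, s). F (x(u := w, v := s)))"
        unfolding case_prod_beta
      proof (rule continuous_on_compose2[of "Pi UNIV A" F])
        show "continuous_on (Pi UNIV A) F" using F by (simp add: sep_holomorphic_def)
        show "continuous_on (A u \<times> sphere 0 r) (\<lambda>y. x(u := fst y, v := snd y))"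
        proof (rule continuous_on_coordinatewise_then_product)
          fix i
          show "continuous_on (A u \<times> sphere 0 r) (\<lambda>y. (x(u := fst y, v := snd y)) i)"
            by (cases "i = v"; cases "i = u") (auto intro: continuous_intros)
        qed
        show "(\<lambda>y. x(u := fst y, v := snd y)) ` (A u \<times> sphere 0 r) \<subseteq> Pi UNIV A"
          using r x by (auto intro!: fun_upd_in_Pi simp: subset_iff)
      qed
      fix s :: complex assume "norm s = r"
      then have "s \<in> A v" using r by auto
      then have "x(v := s) \<in> Pi UNIV A" using x by (rule fun_upd_in_Pi[rotated])
      then have "(\<lambda>w. F (x(v := s, u := w))) holomorphic_on A u"
        using F by (simp add: sep_holomorphic_def)
      then show "(\<lambda>w. F (x(u := w, v := s))) holomorphic_on A u"
        using False by (simp add: fun_upd_twist)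
    qed
  qed
qed

section \<open>Iterated means over tori\<close>

primrec torus_mean ::
    "('v \<Rightarrow> real) \<Rightarrow> 'v list \<Rightarrow> (('v \<Rightarrow> complex) \<Rightarrow> complex) \<Rightarrow> ('v \<Rightarrow> complex) \<Rightarrow> complex" where
  "torus_mean r [] F x = F x"
| "torus_mean r (v # vs) F x = circle_mean (r v) (\<lambda>w. torus_mean r vs F (x(v := w)))"

lemma torus_integral_eq_torus_mean:
  assumes "\<And>v. v \<in> set vs \<Longrightarrow> \<rho> (fst v) \<noteq> 0"
  shows "torus_integral \<rho> vs F x = torus_mean (\<lambda>v. \<rho> (fst v)) vs F x"
  using assms by (induction vs arbitrary: x) (simp_all add: circle_mean_eq_contour_integral)

lemma torus_mean_append:
  "torus_mean r (us @ vs) F x = torus_mean r us (torus_mean r vs F) x"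
  by (induction us arbitrary: x) simp_all

lemma torus_mean_cong:
  assumes "distinct vs" and "\<And>v. v \<in> set vs \<Longrightarrow> 0 \<le> r v"
    and "\<And>y y'. \<lbrakk>\<And>v. v \<in> set vs \<Longrightarrow> y' v = y v \<and> norm (y v) = r v;
        \<And>v. v \<notin> set vs \<Longrightarrow> y v = x v \<and> y' v = x' v\<rbrakk> \<Longrightarrow> F y = G y'"
  shows "torus_mean r vs F x = torus_mean r vs G x'"
  using assms
proof (induction vs arbitrary: x x')
  case Nil
  then show ?case by simp
next
  case (Cons v vs)
  have "torus_mean r vs F (x(v := w)) = torus_mean r vs G (x'(v := w))" if w: "norm w = r v" for w
  proof (rule Cons.IH)
    fix y y'
    assume y: "\<And>u. u \<in> set vs \<Longrightarrow> y' u = y u \<and> norm (y u) = r u"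
      "\<And>u. u \<notin> set vs \<Longrightarrow> y u = (x(v := w)) u \<and> y' u = (x'(v := w)) u"
    show "F y = G y'"
    proof (rule Cons.prems(3))
      fix u
      show "u \<in> set (v # vs) \<Longrightarrow> y' u = y u \<and> norm (y u) = r u"
        using y[of u] Cons.prems(1) w by (cases "u = v") auto
      show "u \<notin> set (v # vs) \<Longrightarrow> y u = x u \<and> y' u = x' u"
        using y[of u] by auto
    qed
  qed (use Cons.prems in auto)
  then show ?case using Cons.prems by (auto intro!: circle_mean_cong)
qed

lemma torus_mean_cmult: "torus_mean r vs (\<lambda>x. c * F x) x = c * torus_mean r vs F x"
  by (induction vs arbitrary: x) (simp_all add: circle_mean_cmult)

lemma sep_holomorphic_torus_mean:
  assumes "sep_holomorphic A F" and "\<And>v. open (A v)"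
    and "\<And>v. v \<in> set vs \<Longrightarrow> 0 < r v \<and> sphere 0 (r v) \<subseteq> A v"
  shows "sep_holomorphic A (torus_mean r vs F)"
  using assms
proof (induction vs)
  case Nil
  then show ?case by (simp add: sep_holomorphic_def)
next
  case (Cons v vs)
  then have "sep_holomorphic A (torus_mean r vs F)" by simp
  from sep_holomorphic_circle_mean[OF this, of "r v" v] Cons.prems show ?case
    by simp
qed

lemma sep_holomorphic_line:
  assumes "sep_holomorphic A F" "x \<in> Pi UNIV A"
  shows "(\<lambda>w. F (x(v := w))) holomorphic_on A v"
  using assms by (simp add: sep_holomorphic_def)

definition torus :: "('v \<Rightarrow> real) \<Rightarrow> 'v set \<Rightarrow> ('v \<Rightarrow> complex) \<Rightarrow> ('v \<Rightarrow> complex) set" where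
  "torus r V x = {y. (\<forall>v\<in>V. norm (y v) = r v) \<and> (\<forall>v. v \<notin> V \<longrightarrow> y v = x v)}"

text \<open>Generalised over \<open>V\<close>, since removing the first variable of the list turns
  it into a coordinate that stays on its circle. Only continuity on the torus itself is assumed, so
  that functions with poles off the torus, such as the coefficients of the dual operators, are
  covered.\<close>

lemma continuous_on_torus_mean:
  assumes "continuous_on (torus r (V \<union> set vs) x) F" and "\<And>v. v \<in> set vs \<Longrightarrow> 0 \<le> r v"
  shows "continuous_on (torus r V x) (torus_mean r vs F)"
  using assms
proof (induction vs arbitrary: V)
  case Nil
  then show ?case by simp
next
  case (Cons v vs)
  let ?c = "\<lambda>t. of_real (r v) * exp (2 * of_real pi * \<i> * of_real t)"
  have cont: "continuous_on (torus r (insert v V) x) (torus_mean r vs F)"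
    using Cons.prems by (intro Cons.IH) (auto simp: Un_commute insert_commute)
  have "continuous_on (torus r V x \<times> cbox 0 1) (\<lambda>y. torus_mean r vs F ((fst y)(v := ?c (snd y))))"
  proof (rule continuous_on_compose2[OF cont])
    show "continuous_on (torus r V x \<times> cbox 0 1) (\<lambda>y. (fst y)(v := ?c (snd y)))"
    proof (rule continuous_on_coordinatewise_then_product)
      fix u
      have "continuous_on (torus r V x \<times> cbox 0 1) (\<lambda>y. fst y u)"
        by (rule continuous_on_compose2[OF continuous_on_product_coordinates])
          (auto intro: continuous_intros)
      moreover have "continuous_on (torus r V x \<times> cbox 0 1) (\<lambda>y. ?c (snd y))"
        by (intro continuous_intros)
      ultimately show "continuous_on (torus r V x \<times> cbox 0 1) (\<lambda>y. ((fst y)(v := ?c (snd y))) u)"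
        by (cases "u = v") (simp_all only: fun_upd_apply if_True if_False simp_thms)
    qed
    show "(\<lambda>y. (fst y)(v := ?c (snd y))) ` (torus r V x \<times> cbox 0 1) \<subseteq> torus r (insert v V) x"
      using Cons.prems(2)[of v] by (auto simp: torus_def norm_mult)
  qed
  then have "continuous_on (torus r V x \<times> cbox 0 1) (\<lambda>(y, t). torus_mean r vs F (y(v := ?c t)))"
    by (simp add: case_prod_beta)
  from integral_continuous_on_param[OF this] show ?case
    by (simp add: circle_mean_def)
qed

lemma torus_mean_sum:
  assumes "finite I" and "distinct vs" and "\<And>v. v \<in> set vs \<Longrightarrow> 0 \<le> r v"
    and "\<And>i. i \<in> I \<Longrightarrow> continuous_on (torus r (set vs) x) (F i)"
  shows "torus_mean r vs (\<lambda>x. \<Sum>i\<in>I. F i x) x = (\<Sum>i\<in>I. torus_mean r vs (F i) x)"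
  using assms(2-)
proof (induction vs arbitrary: x)
  case Nil
  then show ?case by simp
next
  case (Cons v vs)
  have "torus_mean r (v # vs) (\<lambda>x. \<Sum>i\<in>I. F i x) x =
      circle_mean (r v) (\<lambda>w. \<Sum>i\<in>I. torus_mean r vs (F i) (x(v := w)))"
    unfolding torus_mean.simps
  proof (rule circle_mean_cong)
    fix w :: complex assume w: "norm w = r v"
    have "torus r (set vs) (x(v := w)) \<subseteq> torus r (set (v # vs)) x"
      using w Cons.prems(1) by (auto simp: torus_def)
    then have "continuous_on (torus r (set vs) (x(v := w))) (F i)" if "i \<in> I" for i
      using Cons.prems(3)[OF that] continuous_on_subset by blast
    then show "torus_mean r vs (\<lambda>x. \<Sum>i\<in>I. F i x) (x(v := w)) = (\<Sum>i\<in>I. torus_mean r vs (F i) (x(v := w)))"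
      using Cons.prems(1,2) by (intro Cons.IH) (assumption | simp)+
  qed (use Cons.prems(2)[of v] in auto)
  also have "\<dots> = (\<Sum>i\<in>I. circle_mean (r v) (\<lambda>w. torus_mean r vs (F i) (x(v := w))))"
  proof (rule circle_mean_sum[OF assms(1)])
    fix i assume "i \<in> I"
    have "continuous_on (torus r {v} x) (torus_mean r vs (F i))"
      using Cons.prems(2) Cons.prems(3)[OF \<open>i \<in> I\<close>] by (intro continuous_on_torus_mean) auto
    moreover have "continuous_on (sphere 0 (r v)) (\<lambda>w. x(v := w))"
    proof (rule continuous_on_coordinatewise_then_product)
      fix u
      show "continuous_on (sphere 0 (r v)) (\<lambda>w. (x(v := w)) u)"
        by (cases "u = v") (auto intro: continuous_intros)
    qed
    moreover have "(\<lambda>w. x(v := w)) ` sphere 0 (r v) \<subseteq> torus r {v} x"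
      by (auto simp: torus_def)
    ultimately show "continuous_on (sphere 0 (r v)) (\<lambda>w. torus_mean r vs (F i) (x(v := w)))"
      by (rule continuous_on_compose2)
  qed (use Cons.prems(2)[of v] in auto)
  finally show ?case by simp
qed

lemma torus_mean_deform:
  assumes "sep_holomorphic A F" and "\<And>v. open (A v)" and "x \<in> Pi UNIV A"
    and "\<And>v. v \<in> set vs \<Longrightarrow> 0 < r v \<and> 0 < s v \<and>
      {w. min (r v) (s v) \<le> norm w \<and> norm w \<le> max (r v) (s v)} \<subseteq> A v"
  shows "torus_mean r vs F x = torus_mean s vs F x"
  using assms(3,4)
proof (induction vs arbitrary: x)
  case Nil
  then show ?case by simp
next
  case (Cons v vs)
  have sphere: "sphere 0 (r u) \<subseteq> A u" if "u \<in> set (v # vs)" for u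
    using Cons.prems(2)[OF that] by auto
  \<comment> \<open>The outer circle is moved first, while the inner variables still run over the
    old radii; the inner circles follow by induction at each point of the new outer circle.\<close>
  have "torus_mean r (v # vs) F x = circle_mean (s v) (\<lambda>w. torus_mean r vs F (x(v := w)))"
    unfolding torus_mean.simps
  proof (rule circle_mean_deform)
    show "(\<lambda>w. torus_mean r vs F (x(v := w))) holomorphic_on A v"
      using Cons.prems sphere
      by (intro sep_holomorphic_line sep_holomorphic_torus_mean assms) auto
  qed (use Cons.prems(2)[of v] assms in auto)
  also have "\<dots> = circle_mean (s v) (\<lambda>w. torus_mean s vs F (x(v := w)))"
  proof (rule circle_mean_cong)
    fix w :: complex assume "norm w = s v"
    then have "x(v := w) \<in> Pi UNIV A"
      using Cons.prems(2)[of v] by (intro fun_upd_in_Pi Cons.prems) auto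
    then show "torus_mean r vs F (x(v := w)) = torus_mean s vs F (x(v := w))"
      using Cons.prems(2) by (intro Cons.IH) auto
  qed (use Cons.prems(2)[of v] in auto)
  finally show ?case by simp
qed

lemma torus_mean_dilate:
  assumes "distinct vs" and "\<And>v. v \<notin> set vs \<Longrightarrow> c v = 1"
  shows "torus_mean r vs (\<lambda>x. F (\<lambda>v. of_real (c v) * x v)) x = torus_mean (\<lambda>v. c v * r v) vs F x"
proof -
  \<comment> \<open>A variable already taken from the list has received its factor
    \<open>c v\<close>, so the inductive claim must dilate the entries outside the list as well; at
    the top level these have \<open>c v = 1\<close>.\<close>
  have "torus_mean r vs (\<lambda>x. F (\<lambda>v. of_real (c v) * x v)) x =
      torus_mean (\<lambda>v. c v * r v) vs F (\<lambda>v. if v \<in> set vs then x v else of_real (c v) * x v)"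
    if "distinct vs" for vs and F :: "('a \<Rightarrow> complex) \<Rightarrow> complex"
    using that
  proof (induction vs arbitrary: x)
    case Nil
    then show ?case by simp
  next
    case (Cons v vs)
    have "(\<lambda>u. if u \<in> set vs then (x(v := w)) u else of_real (c u) * (x(v := w)) u) =
        (\<lambda>u. if u \<in> set (v # vs) then x u else of_real (c u) * x u)(v := of_real (c v) * w)" for w
      using Cons.prems by auto
    with Cons show ?case by (simp add: circle_mean_scale)
  qed
  from this[OF assms(1), of F] have "torus_mean r vs (\<lambda>x. F (\<lambda>v. of_real (c v) * x v)) x =
      torus_mean (\<lambda>v. c v * r v) vs F (\<lambda>v. if v \<in> set vs then x v else of_real (c v) * x v)" .
  also have "(\<lambda>v. if v \<in> set vs then x v else of_real (c v) * x v) = x"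
    using assms(2) by auto
  finally show ?thesis .
qed

text \<open>Substituting the constants \<open>c v\<close> shows it. Applied to a mean, whose
  integration variables remain formal arguments on which its value does not depend.\<close>

lemma sep_holomorphic_ignore:
  assumes h: "sep_holomorphic A h" and c: "\<And>v. v \<in> S \<Longrightarrow> c v \<in> A v"
    and indep: "\<And>x. h x = h (\<lambda>v. if v \<in> S then c v else x v)"
  shows "sep_holomorphic (\<lambda>v. if v \<in> S then UNIV else A v) h"
proof -
  let ?B = "\<lambda>v. if v \<in> S then UNIV else A v"
  let ?o = "\<lambda>x v. if v \<in> S then c v else x v"
  have mem: "?o x \<in> Pi UNIV A" if "x \<in> Pi UNIV ?B" for x
  proof
    fix v show "?o x v \<in> A v" using that c[of v] by (cases "v \<in> S") (auto simp: Pi_iff split: if_splits)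
  qed
  have "continuous_on (Pi UNIV ?B) (\<lambda>x. h (?o x))"
  proof (rule continuous_on_compose2[of "Pi UNIV A" h _ ?o])
    show "continuous_on (Pi UNIV A) h" using h by (simp add: sep_holomorphic_def)
    show "continuous_on (Pi UNIV ?B) ?o"
    proof (rule continuous_on_coordinatewise_then_product)
      fix v
      show "continuous_on (Pi UNIV ?B) (\<lambda>x. ?o x v)"
        by (cases "v \<in> S") (auto intro: continuous_on_subset[OF continuous_on_product_coordinates])
    qed
    show "?o ` Pi UNIV ?B \<subseteq> Pi UNIV A" using mem by blast
  qed
  moreover have "(\<lambda>x. h (?o x)) = h"
    by (rule ext) (rule indep[symmetric])
  ultimately have "continuous_on (Pi UNIV ?B) h"
    by (simp only:)
  moreover have "(\<lambda>w. h (x(v := w))) holomorphic_on ?B v" if x: "x \<in> Pi UNIV ?B" for x v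
  proof (cases "v \<in> S")
    case True
    have "h (x(v := w)) = h (?o x)" for w
      unfolding indep[of "x(v := w)"] using True by (intro arg_cong[of _ _ h]) auto
    then show ?thesis by simp
  next
    case False
    have "h (x(v := w)) = h ((?o x)(v := w))" for w
      unfolding indep[of "x(v := w)"] using False by (intro arg_cong[of _ _ h]) auto
    then show ?thesis using False h mem[OF x] by (simp add: sep_holomorphic_def)
  qed
  ultimately show ?thesis
    by (simp add: sep_holomorphic_def)
qed

section \<open>Symmetric function identities\<close>

definition subsets_of_card :: "'a set \<Rightarrow> nat \<Rightarrow> 'a set set" where
  "subsets_of_card S r = {I. I \<subseteq> S \<and> card I = r}"

lemma finite_subsets_of_card [simp]: "finite S \<Longrightarrow> finite (subsets_of_card S r)"
  unfolding subsets_of_card_def by auto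

lemma subsets_of_card_0:
  assumes "finite S"
  shows "subsets_of_card S 0 = {{}}"
proof -
  have "card I = 0 \<longleftrightarrow> I = {}" if "I \<subseteq> S" for I
    using finite_subset[OF that assms] by simp
  then show ?thesis by (auto simp: subsets_of_card_def)
qed

lemma subsets_of_card_empty:
  assumes "card S < r" "finite S"
  shows "subsets_of_card S r = {}"
proof -
  have "card I \<noteq> r" if "I \<subseteq> S" for I
    using card_mono[OF assms(2) that] assms(1) by simp
  then show ?thesis by (auto simp: subsets_of_card_def)
qed

lemma subsets_of_card_full:
  assumes "finite S"
  shows "subsets_of_card S (card S) = {S}"
proof -
  have "card I = card S \<longleftrightarrow> I = S" if "I \<subseteq> S" for I
    using card_subset_eq[OF assms that] by auto
  then show ?thesis by (auto simp: subsets_of_card_def)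
qed

text \<open>The condition \<open>Suc (card I) = r\<close> makes the second sum empty for
  \<open>r = 0\<close>, where \<open>card I = r - 1\<close> would admit the empty set.\<close>

lemma sum_subsets_insert:
  assumes "finite S" "a \<notin> S"
  shows "(\<Sum>I\<in>subsets_of_card (insert a S) r. g I) =
    (\<Sum>I\<in>subsets_of_card S r. g I) + (\<Sum>I\<in>{I. I \<subseteq> S \<and> Suc (card I) = r}. g (insert a I))"
proof -
  have fin: "finite I" if "I \<subseteq> S" for I using that assms(1) by (rule finite_subset)
  have "subsets_of_card (insert a S) r =
      subsets_of_card S r \<union> insert a ` {I. I \<subseteq> S \<and> Suc (card I) = r}"
  proof (intro equalityI subsetI)
    fix I assume "I \<in> subsets_of_card (insert a S) r"
    then have I: "I \<subseteq> insert a S" "card I = r" by (auto simp: subsets_of_card_def)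
    show "I \<in> subsets_of_card S r \<union> insert a ` {I. I \<subseteq> S \<and> Suc (card I) = r}"
    proof (cases "a \<in> I")
      case True
      then have "I = insert a (I - {a})" "I - {a} \<subseteq> S" "Suc (card (I - {a})) = r"
        using I assms(1) finite_subset[OF I(1)] card_Suc_Diff1[of I a] by auto
      then show ?thesis by blast
    next
      case False
      then show ?thesis using I by (auto simp: subsets_of_card_def)
    qed
  next
    fix I assume "I \<in> subsets_of_card S r \<union> insert a ` {I. I \<subseteq> S \<and> Suc (card I) = r}"
    then show "I \<in> subsets_of_card (insert a S) r"
      using assms(2) fin by (auto simp: subsets_of_card_def card_insert_if)
  qed
  moreover have "subsets_of_card S r \<inter> insert a ` {I. I \<subseteq> S \<and> Suc (card I) = r} = {}"
    using assms(2) by (auto simp: subsets_of_card_def)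
  moreover have "inj_on (insert a) {I. I \<subseteq> S \<and> Suc (card I) = r}"
    using assms(2) by (auto simp: inj_on_def)
  ultimately show ?thesis
    using assms(1) by (simp add: sum.union_disjoint sum.reindex)
qed

section \<open>Elementary symmetric functions and the interpolation identity behind the Toda
  equation\<close>

definition elem_sym :: "'a set \<Rightarrow> nat \<Rightarrow> ('a \<Rightarrow> complex) \<Rightarrow> complex" where
  "elem_sym S r x = (\<Sum>I\<in>subsets_of_card S r. \<Prod>i\<in>I. x i)"

lemma elem_sym_0 [simp]: "finite S \<Longrightarrow> elem_sym S 0 x = 1"
  by (simp add: elem_sym_def subsets_of_card_0)

lemma elem_sym_insert:
  assumes "finite S" "a \<notin> S"
  shows "elem_sym (insert a S) (Suc r) x = elem_sym S (Suc r) x + x a * elem_sym S r x"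
proof -
  have "(\<Prod>i\<in>insert a I. x i) = x a * (\<Prod>i\<in>I. x i)" if "I \<subseteq> S" for I
    using that assms finite_subset[OF that assms(1)] by (subst prod.insert) auto
  then show ?thesis
    using assms unfolding elem_sym_def
    by (simp add: sum_subsets_insert sum_distrib_left) (simp add: subsets_of_card_def)
qed

definition elem_sym_poly :: "'a set \<Rightarrow> ('a \<Rightarrow> complex) \<Rightarrow> complex poly" where
  "elem_sym_poly S x = (\<Prod>i\<in>S. [:1, x i:])"

lemma coeff_elem_sym_poly: "finite S \<Longrightarrow> coeff (elem_sym_poly S x) r = elem_sym S r x"
proof (induction S arbitrary: r rule: finite_induct)
  case empty
  show ?case
    by (cases r) (simp_all add: elem_sym_poly_def elem_sym_def subsets_of_card_empty subsets_of_card_0)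
next
  case (insert a S)
  then show ?case
    by (cases r) (simp_all add: elem_sym_insert elem_sym_poly_def)
qed

lemma degree_elem_sym_poly: "finite S \<Longrightarrow> degree (elem_sym_poly S x) \<le> card S"
proof -
  assume "finite S"
  then have "degree (elem_sym_poly S x) \<le> (\<Sum>i\<in>S. degree [:1, x i:])"
    unfolding elem_sym_poly_def using degree_prod_sum_le[of S "\<lambda>i. [:1, x i:]"] by (simp add: o_def)
  also have "\<dots> \<le> (\<Sum>i\<in>S. 1)"
    by (intro sum_mono) simp
  finally show ?thesis by simp
qed

lemma elem_sym_full: "finite S \<Longrightarrow> elem_sym S (card S) x = (\<Prod>i\<in>S. x i)"
  by (simp add: elem_sym_def subsets_of_card_full)

text \<open>Comparison of generating polynomials in an auxiliary variable. Both have degree at most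
  \<open>Suc (card X)\<close> and the same coefficient in that degree, so agreement at the
  \<open>Suc (card X)\<close> points 0 and \<open>- 1 / x i\<close> suffices.\<close>

lemma elem_sym_kernel_identity:
  fixes x :: "'a \<Rightarrow> complex" and z :: "'b \<Rightarrow> complex"
  assumes fin: "finite X" "finite Z" and card: "card Z = Suc (card X)"
    and inj: "inj_on x X" and nz: "\<And>i. i \<in> X \<Longrightarrow> x i \<noteq> 0"
  shows "elem_sym X (Suc r) x + (\<Prod>m\<in>Z. z m) / (\<Prod>i\<in>X. x i) * elem_sym X r x
      - (\<Sum>i\<in>X. x i * elem_sym (X - {i}) r x * (\<Prod>j\<in>X - {i}. x i / (x i - x j)) * (\<Prod>m\<in>Z. 1 - z m / x i))
    = elem_sym Z (Suc r) z"
proof -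
  \<comment> \<open>\<open>c\<close> is forced by the top coefficient, which must be the product of
    all \<open>z m\<close>. At the node \<open>- 1 / x i\<close> only the summand with index
    \<open>i\<close> survives, and \<open>a i\<close> is the Lagrange weight that gives it the value
    of \<open>elem_sym_poly Z z\<close> there.\<close>
  define c where "c = (\<Prod>m\<in>Z. z m) / (\<Prod>i\<in>X. x i)"
  define a where "a = (\<lambda>i. x i * (\<Prod>j\<in>X - {i}. x i / (x i - x j)) * (\<Prod>m\<in>Z. 1 - z m / x i))"
  define P where "P = [:1, c:] * elem_sym_poly X x - (\<Sum>i\<in>X. [:0, a i:] * elem_sym_poly (X - {i}) x)"
  let ?N = "card X"
  have deg: "degree ([:0, a i:] * elem_sym_poly (X - {i}) x) \<le> ?N" if "i \<in> X" for i
  proof -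
    have "degree ([:0, a i:] * elem_sym_poly (X - {i}) x) \<le> 1 + card (X - {i})"
      using degree_elem_sym_poly[of "X - {i}" x] fin
      by (intro order_trans[OF degree_mult_le] add_mono) auto
    then show ?thesis using that fin card_gt_0_iff[of X] by (auto simp: card_Diff_singleton)
  qed
  have "P = elem_sym_poly Z z"
  proof (rule poly_eqI_degree_lead_coeff[where n = "Suc ?N" and A = "insert 0 ((\<lambda>i. - 1 / x i) ` X)"])
    have "coeff (\<Sum>i\<in>X. [:0, a i:] * elem_sym_poly (X - {i}) x) (Suc ?N) = 0"
      using deg by (simp only: coeff_sum) (intro sum.neutral ballI coeff_eq_0, force)
    moreover have "coeff ([:1, c:] * elem_sym_poly X x) (Suc ?N) = (\<Prod>m\<in>Z. z m)"
      using fin nz by (simp add: coeff_elem_sym_poly elem_sym_full c_def)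
        (simp add: elem_sym_def subsets_of_card_empty)
    ultimately show "coeff P (Suc ?N) = coeff (elem_sym_poly Z z) (Suc ?N)"
      using fin by (simp add: P_def coeff_elem_sym_poly elem_sym_full flip: card)
    show "Suc ?N \<le> card (insert 0 ((\<lambda>i. - 1 / x i) ` X))"
    proof -
      have "inj_on (\<lambda>i. - 1 / x i) X" using inj nz by (auto simp: inj_on_def field_simps)
      moreover have "0 \<notin> (\<lambda>i. - 1 / x i) ` X" using nz by auto
      ultimately show ?thesis using fin by (simp add: card_image)
    qed
    show "degree P \<le> Suc ?N"
      unfolding P_def
    proof (rule degree_diff_le)
      show "degree ([:1, c:] * elem_sym_poly X x) \<le> Suc ?N"
        using degree_elem_sym_poly[OF fin(1), of x]
        by (intro order_trans[OF degree_mult_le]) (auto intro: le_trans[OF degree_pCons_le])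
      show "degree (\<Sum>i\<in>X. [:0, a i:] * elem_sym_poly (X - {i}) x) \<le> Suc ?N"
        by (rule degree_sum_le[OF fin(1)]) (rule le_SucI[OF deg])
    qed
    show "degree (elem_sym_poly Z z) \<le> Suc ?N"
      using degree_elem_sym_poly[OF fin(2), of z] card by simp
  next
    fix w assume "w \<in> insert 0 ((\<lambda>i. - 1 / x i) ` X)"
    then consider "w = 0" | k where "k \<in> X" "w = - 1 / x k" by auto
    then show "poly P w = poly (elem_sym_poly Z z) w"
    proof cases
      case 1
      then show ?thesis
        by (simp add: P_def elem_sym_poly_def poly_prod poly_sum)
    next
      case 2
      have vanish: "poly (elem_sym_poly S x) w = 0" if "k \<in> S" "S \<subseteq> X" for S
        using that 2 nz fin finite_subset[OF that(2)] unfolding elem_sym_poly_def poly_prod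
        by (intro prod_zero) (auto intro!: bexI[of _ k])
      have "poly P w = - (\<Sum>i\<in>X. w * a i * poly (elem_sym_poly (X - {i}) x) w)"
        using vanish[of X] 2 by (simp add: P_def poly_sum algebra_simps)
      also have "(\<Sum>i\<in>X. w * a i * poly (elem_sym_poly (X - {i}) x) w) =
          (\<Sum>i\<in>{k}. w * a i * poly (elem_sym_poly (X - {i}) x) w)"
        using fin 2(1) by (intro sum.mono_neutral_right) (auto simp: vanish)
      also have "\<dots> = - (\<Prod>m\<in>Z. 1 - z m / x k) *
          ((\<Prod>j\<in>X - {k}. x k / (x k - x j)) * (\<Prod>j\<in>X - {k}. 1 - x j / x k))"
        using 2 nz[of k] by (simp add: a_def elem_sym_poly_def poly_prod)
      also have "(\<Prod>j\<in>X - {k}. x k / (x k - x j)) * (\<Prod>j\<in>X - {k}. 1 - x j / x k) = 1"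
        unfolding prod.distrib[symmetric] using 2 nz[of k] inj
        by (intro prod.neutral) (auto simp: field_simps inj_on_def)
      also have "- (- (\<Prod>m\<in>Z. 1 - z m / x k) * 1) = poly (elem_sym_poly Z z) w"
        using 2 by (simp add: elem_sym_poly_def poly_prod)
      finally show ?thesis .
    qed
  qed
  then have "coeff P (Suc r) = elem_sym Z (Suc r) z"
    using fin by (simp add: coeff_elem_sym_poly)
  moreover have "coeff P (Suc r) = elem_sym X (Suc r) x + c * elem_sym X r x
      - (\<Sum>i\<in>X. a i * elem_sym (X - {i}) r x)"
    using fin by (simp add: P_def coeff_elem_sym_poly coeff_sum)
  ultimately show ?thesis
    by (simp add: c_def a_def mult_ac)
qed

section \<open>Duality of rational sums in \<open>n + 1\<close> and \<open>n\<close>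
  variables\<close>

definition dual_coeff :: "'a set \<Rightarrow> ('a \<Rightarrow> complex) \<Rightarrow> 'a set \<Rightarrow> complex" where
  "dual_coeff A z I = (\<Prod>i\<in>I. \<Prod>j\<in>A - I. z j / (z j - z i))"

text \<open>The coefficient of the adjoint operator, in which the variables of \<open>I\<close> are
  divided by \<open>q\<close>; by \<open>adjoint_coeff_eq_dual_coeff\<close> it is the dual
  coefficient of the complement.\<close>

definition adjoint_coeff :: "'a set \<Rightarrow> ('a \<Rightarrow> complex) \<Rightarrow> 'a set \<Rightarrow> complex" where
  "adjoint_coeff A x I = (\<Prod>i\<in>I. \<Prod>j\<in>A - I. x i / (x i - x j))"

text \<open>The dual operator of order \<open>r\<close> in the variables \<open>z\<close>, applied
  to the kernel with factors \<open>Gamma_q (z m / x k)\<close> and divided by it: the shift of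
  \<open>z i\<close> multiplies the kernel by the factors \<open>1 - z i / x k\<close>. Likewise
  \<open>adjoint_sum\<close> comes from dividing variables \<open>x i\<close> by
  \<open>q\<close>.\<close>

definition dual_sum where
  "dual_sum A B z x r = (\<Sum>I\<in>subsets_of_card A r. dual_coeff A z I * (\<Prod>i\<in>I. \<Prod>k\<in>B. 1 - z i / x k))"

definition adjoint_sum where
  "adjoint_sum A B z x r = (\<Sum>J\<in>subsets_of_card B r. adjoint_coeff B x J * (\<Prod>i\<in>J. \<Prod>m\<in>A. 1 - z m / x i))"

lemma divide_diff_mult_diff:
  fixes u v :: complex
  assumes "u \<noteq> v"
  shows "u / (u - v) * (v - u) = - u"
  using assms by (simp add: nonzero_divide_eq_eq algebra_simps)

lemma dual_coeff_insert:
  assumes "finite A" "a \<notin> A" "I \<subseteq> A"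
  shows "dual_coeff (insert a A) z I = (\<Prod>i\<in>I. z a / (z a - z i)) * dual_coeff A z I"
    and "dual_coeff (insert a A) z (insert a I) = (\<Prod>j\<in>A - I. z j / (z j - z a)) * dual_coeff A z I"
proof -
  have fin: "finite I" using assms finite_subset by blast
  have "insert a A - I = insert a (A - I)" "insert a A - insert a I = A - I" "a \<notin> I"
    using assms by auto
  then show "dual_coeff (insert a A) z I = (\<Prod>i\<in>I. z a / (z a - z i)) * dual_coeff A z I"
    and "dual_coeff (insert a A) z (insert a I) = (\<Prod>j\<in>A - I. z j / (z j - z a)) * dual_coeff A z I"
    using assms fin by (simp_all add: dual_coeff_def prod.distrib del: times_divide_eq_left times_divide_eq_right)
qed

lemma adjoint_coeff_insert:
  assumes "finite A" "a \<notin> A" "I \<subseteq> A"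
  shows "adjoint_coeff (insert a A) z I = (\<Prod>i\<in>I. z i / (z i - z a)) * adjoint_coeff A z I"
proof -
  have "insert a A - I = insert a (A - I)" using assms by auto
  then show ?thesis using assms by (simp add: adjoint_coeff_def prod.distrib del: times_divide_eq_left times_divide_eq_right)
qed

lemma prod_subset_diff:
  fixes f g :: "'a \<Rightarrow> complex"
  assumes "finite A" "I \<subseteq> A"
  shows "prod f A = prod f I * prod f (A - I)"
  using prod.subset_diff[OF assms(2,1)] by (simp add: mult.commute)

text \<open>
  As a function of one variable \<open>z a\<close>, \<open>dual_sum\<close> is rational with possible poles at the other
  \<open>z c\<close>, which cancel. After clearing denominators it is the following polynomial.
\<close>

definition dual_poly where
  "dual_poly A B z x r =
    (\<Sum>I\<in>{I. I \<subseteq> A \<and> Suc (card I) = r}. Polynomial.smult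
        (dual_coeff A z I * (\<Prod>i\<in>I. \<Prod>k\<in>B. 1 - z i / x k) * (\<Prod>j\<in>A - I. z j))
        ((\<Prod>i\<in>I. [:z i, -1:]) * (\<Prod>k\<in>B. [:1, - 1 / x k:]))) +
    (\<Sum>I\<in>subsets_of_card A r. Polynomial.smult
        (dual_coeff A z I * (\<Prod>i\<in>I. \<Prod>k\<in>B. 1 - z i / x k))
        ((\<Prod>i\<in>I. [:0, -1:]) * (\<Prod>j\<in>A - I. [:z j, -1:])))"

lemma poly_dual_poly:
  assumes "finite A" "a \<notin> A" and "\<And>c. c \<in> A \<Longrightarrow> z c \<noteq> z a"
  shows "poly (dual_poly A B z x r) (z a) = dual_sum (insert a A) B z x r * (\<Prod>j\<in>A. z j - z a)"
proof -
  let ?G = "\<lambda>I. \<Prod>i\<in>I. \<Prod>k\<in>B. 1 - z i / x k"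
  have 1: "dual_coeff (insert a A) z (insert a I) * ?G (insert a I) * (\<Prod>j\<in>A. z j - z a) =
      dual_coeff A z I * ?G I * (\<Prod>j\<in>A - I. z j) * ((\<Prod>i\<in>I. z i - z a) * (\<Prod>k\<in>B. 1 - z a / x k))"
    if "I \<subseteq> A" for I
  proof -
    have "(\<Prod>j\<in>A - I. z j / (z j - z a)) * (\<Prod>j\<in>A - I. z j - z a) = (\<Prod>j\<in>A - I. z j)"
      unfolding prod.distrib[symmetric] using assms(3) by (intro prod.cong) auto
    moreover have "a \<notin> I" "finite I" using that assms finite_subset by auto
    ultimately show ?thesis
      using dual_coeff_insert(2)[OF assms(1,2) that, of z]
        prod_subset_diff[OF assms(1) that, of "\<lambda>j. z j - z a"]
      by simp
  qed
  have 2: "dual_coeff (insert a A) z I * ?G I * (\<Prod>j\<in>A. z j - z a) =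
      dual_coeff A z I * ?G I * ((\<Prod>i\<in>I. - z a) * (\<Prod>j\<in>A - I. z j - z a))"
    if "I \<subseteq> A" for I
  proof -
    have "(\<Prod>i\<in>I. - z a) = (\<Prod>i\<in>I. z a / (z a - z i)) * (\<Prod>i\<in>I. z i - z a)"
      unfolding prod.distrib[symmetric] using assms(3) that
      by (intro prod.cong divide_diff_mult_diff[symmetric] refl) (metis subsetD)
    then show ?thesis
      unfolding dual_coeff_insert(1)[OF assms(1,2) that, of z]
        prod_subset_diff[OF assms(1) that, of "\<lambda>j. z j - z a"]
      by (simp only: mult_ac)
  qed
  show ?thesis
    unfolding dual_poly_def dual_sum_def sum_subsets_insert[OF assms(1,2)] distrib_right sum_distrib_right
    by (simp add: poly_sum poly_prod 1 2 subsets_of_card_def add.commute)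
qed

text \<open>The residues cancel in pairs. With \<open>a\<close> the variable that has been singled
  out and \<open>I\<close> avoiding \<open>c\<close>, the terms of the sets
  \<open>insert a I\<close> and \<open>insert c I\<close> are opposite, and all other terms contain
  a vanishing factor.\<close>

lemma poly_dual_poly_pole:
  assumes "finite A" "c \<in> A" "inj_on z A"
  shows "poly (dual_poly A B z x r) (z c) = 0"
proof -
  define S where "S = A - {c}"
  have S: "finite S" "c \<notin> S" "A = insert c S" using assms by (auto simp: S_def)
  have ne: "z i \<noteq> z c" if "i \<in> S" for i
    using assms that S by (auto simp: inj_on_def)
  let ?G = "\<lambda>I. \<Prod>i\<in>I. \<Prod>k\<in>B. 1 - z i / x k"
  let ?t1 = "\<lambda>I. dual_coeff A z I * ?G I * (\<Prod>j\<in>A - I. z j) *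
      ((\<Prod>i\<in>I. z i - z c) * (\<Prod>k\<in>B. 1 - z c / x k))"
  let ?t2 = "\<lambda>I. dual_coeff A z I * ?G I * ((\<Prod>i\<in>I. - z c) * (\<Prod>j\<in>A - I. z j - z c))"
  have "poly (dual_poly A B z x r) (z c) =
      (\<Sum>I\<in>{I. I \<subseteq> A \<and> Suc (card I) = r}. ?t1 I) + (\<Sum>I\<in>subsets_of_card A r. ?t2 I)"
    by (simp add: dual_poly_def poly_sum poly_prod)
  also have "(\<Sum>I\<in>{I. I \<subseteq> A \<and> Suc (card I) = r}. ?t1 I) = (\<Sum>I\<in>{I. I \<subseteq> S \<and> Suc (card I) = r}. ?t1 I)"
  proof (rule sum.mono_neutral_right)
    show "finite {I. I \<subseteq> A \<and> Suc (card I) = r}" using assms(1) by simp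
    show "\<forall>I\<in>{I. I \<subseteq> A \<and> Suc (card I) = r} - {I. I \<subseteq> S \<and> Suc (card I) = r}. ?t1 I = 0"
    proof
      fix I assume "I \<in> {I. I \<subseteq> A \<and> Suc (card I) = r} - {I. I \<subseteq> S \<and> Suc (card I) = r}"
      then have "c \<in> I" "finite I" using S assms finite_subset by auto
      then have "(\<Prod>i\<in>I. z i - z c) = 0" by (intro prod_zero) auto
      then show "?t1 I = 0" by simp
    qed
  qed (use S in auto)
  also have "(\<Sum>I\<in>subsets_of_card A r. ?t2 I) = (\<Sum>I\<in>{I. I \<subseteq> S \<and> Suc (card I) = r}. ?t2 (insert c I))"
  proof -
    have "(\<Sum>I\<in>subsets_of_card S r. ?t2 I) = 0"
    proof (intro sum.neutral ballI)
      fix I assume "I \<in> subsets_of_card S r"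
      then have "c \<in> A - I" using S by (auto simp: subsets_of_card_def)
      then have "(\<Prod>j\<in>A - I. z j - z c) = 0" using assms(1) by (intro prod_zero) auto
      then show "?t2 I = 0" by simp
    qed
    then show ?thesis
      unfolding S(3) sum_subsets_insert[OF S(1,2)] by simp
  qed
  also have "(\<Sum>I\<in>{I. I \<subseteq> S \<and> Suc (card I) = r}. ?t1 I) +
      (\<Sum>I\<in>{I. I \<subseteq> S \<and> Suc (card I) = r}. ?t2 (insert c I)) = 0"
    unfolding sum.distrib[symmetric]
  proof (intro sum.neutral ballI)
    fix I assume "I \<in> {I. I \<subseteq> S \<and> Suc (card I) = r}"
    then have I: "I \<subseteq> S" by simp
    then have "c \<notin> I" "finite I" using S finite_subset by auto
    have diffs: "A - I = insert c (S - I)" "A - insert c I = S - I"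
      using S I by auto
    have "(\<Prod>i\<in>I. z c / (z c - z i)) * (\<Prod>i\<in>I. z i - z c) = (\<Prod>i\<in>I. - z c)"
      unfolding prod.distrib[symmetric] using ne I
      by (intro prod.cong divide_diff_mult_diff refl) (metis subsetD)
    then have "?t1 I = dual_coeff S z I * ?G I * (z c * (\<Prod>j\<in>S - I. z j)) *
        ((\<Prod>i\<in>I. - z c) * (\<Prod>k\<in>B. 1 - z c / x k))"
      using S(1,2) dual_coeff_insert(1)[OF S(1,2) I, of z] unfolding diffs unfolding S(3)
      by simp
    moreover have "(\<Prod>j\<in>S - I. z j / (z j - z c)) * (\<Prod>j\<in>S - I. z j - z c) = (\<Prod>j\<in>S - I. z j)"
      unfolding prod.distrib[symmetric] using ne by (intro prod.cong) auto
    then have "?t2 (insert c I) = - (dual_coeff S z I * ?G I * (z c * (\<Prod>j\<in>S - I. z j)) *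
        ((\<Prod>i\<in>I. - z c) * (\<Prod>k\<in>B. 1 - z c / x k)))"
      using \<open>c \<notin> I\<close> \<open>finite I\<close> dual_coeff_insert(2)[OF S(1,2) I, of z] unfolding diffs unfolding S(3)
      by (simp del: prod_constant)
    ultimately show "?t1 I + ?t2 (insert c I) = 0" by simp
  qed
  finally show ?thesis .
qed

definition adjoint_poly where
  "adjoint_poly A B z x r = (\<Sum>J\<in>subsets_of_card B r. Polynomial.smult
      (adjoint_coeff B x J * (\<Prod>i\<in>J. \<Prod>m\<in>A. 1 - z m / x i)) (\<Prod>i\<in>J. [:1, - 1 / x i:]))"

lemma poly_adjoint_poly:
  assumes "finite A" "a \<notin> A"
  shows "poly (adjoint_poly A B z x r) (z a) = adjoint_sum (insert a A) B z x r"
  using assms by (simp add: adjoint_poly_def adjoint_sum_def poly_sum poly_prod prod.distrib mult_ac)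

text \<open>Sets containing \<open>k\<close> drop out through the factor
  \<open>1 - z a / x k\<close>. In the others, \<open>1 - x k / x i\<close> cancels the part
  \<open>x i / (x i - x k)\<close> of the coefficient, so both the variable \<open>a\<close> and the
  index \<open>k\<close> disappear.\<close>

lemma adjoint_sum_specialize:
  assumes "finite A" "a \<notin> A" "finite B" "k \<in> B" "z a = x k"
    and "inj_on x B" and nz: "\<And>k. k \<in> B \<Longrightarrow> x k \<noteq> 0"
  shows "adjoint_sum (insert a A) B z x r = adjoint_sum A (B - {k}) z x r"
proof -
  define S where "S = B - {k}"
  have S: "finite S" "k \<notin> S" "B = insert k S" using assms by (auto simp: S_def)
  let ?t = "\<lambda>J. adjoint_coeff B x J * (\<Prod>i\<in>J. \<Prod>m\<in>insert a A. 1 - z m / x i)"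
  have "?t (insert k J) = 0" if "J \<subseteq> S" for J
  proof -
    have "finite J" using that S finite_subset by blast
    moreover have "(\<Prod>m\<in>insert a A. 1 - z m / x k) = 0"
      using assms(1,2,5) nz[OF assms(4)] by simp
    ultimately show ?thesis using that S by (subst prod.insert) auto
  qed
  then have "(\<Sum>J\<in>{J. J \<subseteq> S \<and> Suc (card J) = r}. ?t (insert k J)) = 0"
    by (intro sum.neutral) auto
  then have "adjoint_sum (insert a A) B z x r = (\<Sum>J\<in>subsets_of_card S r. ?t J)"
    unfolding adjoint_sum_def S(3) sum_subsets_insert[OF S(1,2)] by simp
  also have "\<dots> = adjoint_sum A S z x r"
    unfolding adjoint_sum_def
  proof (rule sum.cong[OF refl])
    fix J assume "J \<in> subsets_of_card S r"
    then have J: "J \<subseteq> S" by (simp add: subsets_of_card_def)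
    have "(\<Prod>i\<in>J. x i / (x i - x k)) * (\<Prod>i\<in>J. 1 - x k / x i) = 1"
      unfolding prod.distrib[symmetric]
    proof (intro prod.neutral ballI)
      fix i assume "i \<in> J"
      then have "i \<in> B" "i \<noteq> k" using J S by auto
      then have "x i \<noteq> x k" "x i \<noteq> 0" using assms nz by (auto simp: inj_on_def)
      then show "x i / (x i - x k) * (1 - x k / x i) = 1" by (simp add: field_simps)
    qed
    then show "?t J = adjoint_coeff S x J * (\<Prod>i\<in>J. \<Prod>m\<in>A. 1 - z m / x i)"
      using assms(1,2,5) adjoint_coeff_insert[OF S(1,2) J, of x] unfolding S(3)
      by (simp add: prod.distrib)
  qed
  finally show ?thesis by (simp add: S_def)
qed

text \<open>The same cancellation on the other side: sets containing \<open>a\<close> drop out, and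
  otherwise \<open>z a / (z a - z i)\<close> is cancelled by \<open>1 - z i / x k\<close>.\<close>

lemma dual_sum_specialize:
  assumes "finite A" "a \<notin> A" "finite B" "k \<in> B" "z a = x k"
    and nz: "x k \<noteq> 0" and ne: "\<And>c. c \<in> A \<Longrightarrow> z c \<noteq> x k"
  shows "dual_sum (insert a A) B z x r = dual_sum A (B - {k}) z x r"
proof -
  define S where "S = B - {k}"
  have S: "finite S" "k \<notin> S" "B = insert k S" using assms by (auto simp: S_def)
  let ?t = "\<lambda>I. dual_coeff (insert a A) z I * (\<Prod>i\<in>I. \<Prod>k\<in>B. 1 - z i / x k)"
  have "?t (insert a I) = 0" if "I \<subseteq> A" for I
  proof -
    have "finite I" using that assms(1) finite_subset by blast
    moreover have "(\<Prod>k\<in>B. 1 - z a / x k) = 0"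
      using assms by (intro prod_zero) auto
    ultimately show ?thesis using that assms(2) by (subst prod.insert) auto
  qed
  then have "(\<Sum>J\<in>{J. J \<subseteq> A \<and> Suc (card J) = r}. ?t (insert a J)) = 0"
    by (intro sum.neutral) auto
  then have "dual_sum (insert a A) B z x r = (\<Sum>I\<in>subsets_of_card A r. ?t I)"
    unfolding dual_sum_def sum_subsets_insert[OF assms(1,2)] by simp
  also have "\<dots> = dual_sum A S z x r"
    unfolding dual_sum_def
  proof (rule sum.cong[OF refl])
    fix I assume "I \<in> subsets_of_card A r"
    then have I: "I \<subseteq> A" by (simp add: subsets_of_card_def)
    have "(\<Prod>i\<in>I. z a / (z a - z i)) * (\<Prod>i\<in>I. 1 - z i / x k) = 1"
      unfolding prod.distrib[symmetric]
    proof (intro prod.neutral ballI)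
      fix i assume "i \<in> I"
      then have "z i \<noteq> x k" using I ne by auto
      then show "z a / (z a - z i) * (1 - z i / x k) = 1" using nz assms(5) by (simp add: field_simps)
    qed
    then show "?t I = dual_coeff A z I * (\<Prod>i\<in>I. \<Prod>k\<in>S. 1 - z i / x k)"
      using dual_coeff_insert(1)[OF assms(1,2) I, of z] S unfolding S(3)
      by (simp add: prod.distrib) 
  qed
  finally show ?thesis by (simp add: S_def)
qed

lemma degree_prod_linear_le:
  fixes f g :: "'a \<Rightarrow> complex"
  shows "degree (\<Prod>i\<in>I. [:f i, g i:]) \<le> card I"
proof (cases "finite I")
  case True
  then have "degree (\<Prod>i\<in>I. [:f i, g i:]) \<le> (\<Sum>i\<in>I. degree [:f i, g i:])"
    using degree_prod_sum_le[of I "\<lambda>i. [:f i, g i:]"] by (simp add: o_def)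
  also have "\<dots> \<le> (\<Sum>i\<in>I. 1)"
    by (intro sum_mono) simp
  finally show ?thesis by simp
qed simp

lemma degree_dual_poly:
  assumes "finite A" "card B = card A" "1 \<le> r" "r \<le> card A"
  shows "degree (dual_poly A B z x r) \<le> card A + r - 1"
  unfolding dual_poly_def
proof (intro degree_add_le degree_sum_le)
  fix I assume "I \<in> {I. I \<subseteq> A \<and> Suc (card I) = r}"
  then have I: "Suc (card I) = r" by simp
  show "degree (Polynomial.smult
        (dual_coeff A z I * (\<Prod>i\<in>I. \<Prod>k\<in>B. 1 - z i / x k) * (\<Prod>j\<in>A - I. z j))
        ((\<Prod>i\<in>I. [:z i, -1:]) * (\<Prod>k\<in>B. [:1, - 1 / x k:]))) \<le> card A + r - 1"
    using degree_prod_linear_le[where I = I and f = z and g = "\<lambda>_. -1"] degree_prod_linear_le[where I = B and f = "\<lambda>_. 1" and g = "\<lambda>k. - 1 / x k"] I assms(2)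
    by (intro order_trans[OF degree_smult_le] order_trans[OF degree_mult_le]) linarith
next
  fix I assume "I \<in> subsets_of_card A r"
  then have I: "card I = r" "I \<subseteq> A" "finite I"
    using assms finite_subset by (auto simp: subsets_of_card_def)
  have "card (A - I) + card I = card A"
    using I assms(1) card_mono[OF assms(1) I(2)] by (simp add: card_Diff_subset)
  then show "degree (Polynomial.smult
        (dual_coeff A z I * (\<Prod>i\<in>I. \<Prod>k\<in>B. 1 - z i / x k))
        ((\<Prod>i\<in>I. [:0, -1:]) * (\<Prod>j\<in>A - I. [:z j, -1:]))) \<le> card A + r - 1"
    using degree_prod_linear_le[where I = I and f = "\<lambda>_. 0" and g = "\<lambda>_. -1"] degree_prod_linear_le[where I = "A - I" and f = z and g = "\<lambda>_. -1"] I assms(3)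
    by (intro order_trans[OF degree_smult_le] order_trans[OF degree_mult_le]) linarith
qed (use assms in auto)

lemma degree_adjoint_poly:
  assumes "finite B"
  shows "degree (adjoint_poly A B z x r) \<le> r"
  unfolding adjoint_poly_def
proof (rule degree_sum_le)
  fix J assume "J \<in> subsets_of_card B r"
  then have J: "card J = r" by (simp add: subsets_of_card_def)
  show "degree (Polynomial.smult
      (adjoint_coeff B x J * (\<Prod>i\<in>J. \<Prod>m\<in>A. 1 - z m / x i)) (\<Prod>i\<in>J. [:1, - 1 / x i:])) \<le> r"
    using degree_prod_linear_le[where I = J and f = "\<lambda>_. 1" and g = "\<lambda>k. - 1 / x k"] J
    by (intro order_trans[OF degree_smult_le]) simp
qed (use assms in auto)

text \<open>Induction on the size. In one variable \<open>z a\<close>, both sides times the product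
  of all \<open>z j - z a\<close> are polynomials of degree at most \<open>card B + r\<close>. They
  agree at the \<open>card B\<close> former poles, where both vanish, and at the
  \<open>card B\<close> points \<open>x k\<close>, where both sums reduce to the smaller size. This
  suffices for \<open>r < card B\<close>; for \<open>r = card B\<close> each side is the full
  product, and for larger \<open>r\<close> both are empty.\<close>

lemma dual_sum_eq_adjoint_sum:
  assumes "finite A" "finite B" "card A = Suc (card B)" "inj_on z A" "inj_on x B"
    and "\<And>k. k \<in> B \<Longrightarrow> x k \<noteq> 0" and "\<And>m k. m \<in> A \<Longrightarrow> k \<in> B \<Longrightarrow> z m \<noteq> x k"
  shows "dual_sum A B z x (Suc r) = adjoint_sum A B z x r"
  using assms
proof (induction "card B" arbitrary: A B z r)
  case 0
  then obtain a where A: "A = {a}" by (auto simp: card_1_singleton_iff)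
  from 0 have B: "B = {}" by simp
  show ?case
  proof (cases r)
    case 0
    have "subsets_of_card {a} (Suc 0) = {{a}}" using subsets_of_card_full[of "{a}"] by simp
    then show ?thesis unfolding A B 0
      by (simp add: dual_sum_def adjoint_sum_def subsets_of_card_0 dual_coeff_def adjoint_coeff_def)
  next
    case (Suc r')
    then show ?thesis unfolding A B
      by (simp add: dual_sum_def adjoint_sum_def subsets_of_card_empty)
  qed
next
  case (Suc N)
  note nz = Suc.prems(6) and ne = Suc.prems(7)
  obtain a A' where A: "A = insert a A'" "a \<notin> A'"
    using Suc.prems(3) by (metis card_Suc_eq)
  have A': "finite A'" "card A' = card B" "inj_on z A'" and za: "\<And>c. c \<in> A' \<Longrightarrow> z c \<noteq> z a"
    using Suc.prems A by (auto simp: inj_on_def)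
  consider "r > card B" | "r = card B" | "r < card B" by linarith
  then show ?case
  proof cases
    case 1
    then show ?thesis
      using Suc.prems by (simp add: dual_sum_def adjoint_sum_def subsets_of_card_empty)
  next
    case 2
    have "(\<Prod>i\<in>A. \<Prod>k\<in>B. 1 - z i / x k) = (\<Prod>i\<in>B. \<Prod>m\<in>A. 1 - z m / x i)"
      by (rule prod.swap)
    then show ?thesis
      using Suc.prems 2 subsets_of_card_full[of A] subsets_of_card_full[of B]
      by (simp add: dual_sum_def adjoint_sum_def dual_coeff_def adjoint_coeff_def)
  next
    case 3
    define V where "V = (\<Prod>j\<in>A'. [:z j, -1:])"
    have V: "poly V w = (\<Prod>j\<in>A'. z j - w)" for w by (simp add: V_def poly_prod)
    have "dual_poly A' B z x (Suc r) = adjoint_poly A' B z x r * V"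
    proof (rule poly_eqI_degree[where A = "x ` B \<union> z ` A'"])
      have "card (x ` B \<union> z ` A') = card B + card A'"
        using Suc.prems A A'
        by (subst card_Un_disjoint) (auto simp: card_image, metis insertI2)
      then have card: "card (x ` B \<union> z ` A') = card A' + card A'" using A' by simp
      have "degree (dual_poly A' B z x (Suc r)) \<le> card A' + Suc r - 1"
        using degree_dual_poly[of A' B "Suc r" z x] A' 3 by simp
      then show "degree (dual_poly A' B z x (Suc r)) < card (x ` B \<union> z ` A')"
        using card A' 3 by linarith
      have "degree (adjoint_poly A' B z x r * V) \<le> r + card A'"
        using degree_adjoint_poly[OF Suc.prems(2), of A' z x r] degree_prod_linear_le[where I = A' and f = z and g = "\<lambda>_. -1"]
        unfolding V_def by (intro order_trans[OF degree_mult_le]) linarith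
      then show "degree (adjoint_poly A' B z x r * V) < card (x ` B \<union> z ` A')"
        using card A' 3 by linarith
    next
      fix w assume "w \<in> x ` B \<union> z ` A'"
      then consider k where "k \<in> B" "w = x k" | c where "c \<in> A'" "w = z c" by auto
      then show "poly (dual_poly A' B z x (Suc r)) w = poly (adjoint_poly A' B z x r * V) w"
      proof cases
        case 1
        \<comment> \<open>The two polynomials do not involve \<open>z a\<close>, so moving that
          entry to \<open>x k\<close> leaves them unchanged and turns their value at
          \<open>x k\<close> into a sum to which the specialisation lemmas apply.\<close>
        define y where "y = z(a := x k)"
        have y: "y a = x k" "\<And>c. c \<in> A' \<Longrightarrow> y c = z c" using A by (auto simp: y_def)
        have ne': "y c \<noteq> y a" if "c \<in> A'" for c
          using that y 1 ne[of c k] A by auto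
        have inj_y: "inj_on y A'" using A'(3) y by (auto simp: inj_on_def)
        have IH: "dual_sum A' (B - {k}) y x (Suc r) = adjoint_sum A' (B - {k}) y x r"
        proof (rule Suc.hyps)
          show "N = card (B - {k})" "card A' = Suc (card (B - {k}))"
            using Suc.hyps(2) 1 Suc.prems A' by (simp_all add: card_Diff_singleton)
          show "y m \<noteq> x i" if "m \<in> A'" "i \<in> B - {k}" for m i
            using that y ne[of m i] A by auto
          show "inj_on x (B - {k})" using Suc.prems(5) by (rule inj_on_diff)
        qed (use Suc.prems A' inj_y in auto)
        have dp: "dual_poly A' B y x (Suc r) = dual_poly A' B z x (Suc r)"
          "adjoint_poly A' B y x r = adjoint_poly A' B z x r"
          using y(2) by (auto simp: dual_poly_def adjoint_poly_def subsets_of_card_def dual_coeff_def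
              subset_iff cong: prod.cong intro!: arg_cong2[of _ _ _ _ plus] sum.cong arg_cong2[of _ _ _ _ smult] arg_cong2[of _ _ _ _ times] prod.cong)
        have "poly (dual_poly A' B z x (Suc r)) (x k) =
            dual_sum (insert a A') B y x (Suc r) * (\<Prod>j\<in>A'. y j - y a)"
          using poly_dual_poly[OF A'(1) A(2), of y B x "Suc r"] ne' dp y by simp
        also have "dual_sum (insert a A') B y x (Suc r) = adjoint_sum (insert a A') B y x r"
          using IH dual_sum_specialize[OF A'(1) A(2) Suc.prems(2) 1(1), of y x "Suc r"]
            adjoint_sum_specialize[OF A'(1) A(2) Suc.prems(2) 1(1), of y x r] y ne' nz 1 Suc.prems(5)
          by simp
        also have "\<dots> = poly (adjoint_poly A' B z x r) (x k)"
          using poly_adjoint_poly[OF A'(1) A(2), of B y x r] dp y by simp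
        also have "(\<Prod>j\<in>A'. y j - y a) = poly V (x k)"
          using y by (simp add: V)
        finally show ?thesis using 1 by simp
      next
        case 2
        then have "poly V w = 0" unfolding V using A' by (intro prod_zero) auto
        then show ?thesis using poly_dual_poly_pole[OF A'(1) 2(1) A'(3), of B x "Suc r"] 2 by simp
      qed
    qed
    then have "dual_sum (insert a A') B z x (Suc r) * (\<Prod>j\<in>A'. z j - z a) =
        adjoint_sum (insert a A') B z x r * (\<Prod>j\<in>A'. z j - z a)"
      using poly_dual_poly[OF A'(1) A(2), of z B x "Suc r"] poly_adjoint_poly[OF A'(1) A(2), of B z x r]
        V[of "z a"] za by (metis poly_mult)
    moreover have "(\<Prod>j\<in>A'. z j - z a) \<noteq> 0" using za A' by auto
    ultimately show ?thesis using A by simp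
  qed
qed

section \<open>The Mellin-Barnes kernel and the adjoint of the dual operators\<close>

definition row_indices :: "nat \<Rightarrow> (nat \<times> nat) list" where
  "row_indices n = map (Pair n) [1..<Suc n]"

lemma set_row_indices [simp]: "set (row_indices n) = {n} \<times> {1..n}"
  by (auto simp: row_indices_def)

lemma distinct_row_indices [simp]: "distinct (row_indices n)"
  by (simp add: row_indices_def distinct_map inj_on_def)

definition dilate :: "real \<Rightarrow> nat \<Rightarrow> nat set \<Rightarrow> (nat \<times> nat \<Rightarrow> complex) \<Rightarrow> nat \<times> nat \<Rightarrow> complex" where
  "dilate c n J x = (\<lambda>v. of_real (if v \<in> {n} \<times> J then c else 1) * x v)"

lemma dilate_apply [simp]:
  "dilate c n J x (m, k) = (if m = n \<and> k \<in> J then of_real c * x (m, k) else x (m, k))"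
  by (simp add: dilate_def)

lemma dilate_empty [simp]: "dilate c n {} x = x"
  by (simp add: dilate_def)

lemma dilate_inverse:
  assumes "q \<noteq> 0"
  shows "dilate q n J (dilate (1 / q) n J x) = x"
  using assms by (auto simp: dilate_def)

definition mb_kernel :: "real \<Rightarrow> nat \<Rightarrow> (nat \<times> nat \<Rightarrow> complex) \<Rightarrow> complex" where
  "mb_kernel q n x = (\<Prod>k=1..n. \<Prod>m=1..Suc n. inverse (q_poch q (x (Suc n, m) / x (n, k))))"

definition off_diagonal :: "nat \<Rightarrow> (nat \<times> nat) set" where
  "off_diagonal n = {(s, t). s \<in> {1..n} \<and> t \<in> {1..n} \<and> s \<noteq> t}"

text \<open>
  For \<open>J = {}\<close> this is the weight of the integral. For general \<open>J\<close> it is the entire continuation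
  of the weight times \<open>dual_coeff {1..n} (\<lambda>k. x (n, k)) J\<close> across \<open>x (n, s) = x (n, t)\<close>.
\<close>

definition q_weight :: "real \<Rightarrow> nat \<Rightarrow> nat set \<Rightarrow> (nat \<times> nat \<Rightarrow> complex) \<Rightarrow> complex" where
  "q_weight q n J x = (\<Prod>(s, t)\<in>off_diagonal n.
      q_poch q ((if s \<in> J \<and> t \<notin> J then of_real q else 1) * (x (n, s) / x (n, t))))"

lemma finite_off_diagonal [simp]: "finite (off_diagonal n)"
  by (rule finite_subset[of _ "{1..n} \<times> {1..n}"]) (auto simp: off_diagonal_def)

lemma prod_off_diagonal:
  fixes f :: "nat \<Rightarrow> nat \<Rightarrow> complex"
  assumes "J \<subseteq> {1..n}"
  shows "(\<Prod>i\<in>J. \<Prod>j\<in>{1..n} - J. f i j) =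
    (\<Prod>(s, t)\<in>off_diagonal n. if s \<in> J \<and> t \<notin> J then f s t else 1)"
proof -
  have "finite J" using assms finite_subset by blast
  then have "(\<Prod>i\<in>J. \<Prod>j\<in>{1..n} - J. f i j) = (\<Prod>(s, t)\<in>J \<times> ({1..n} - J). f s t)"
    by (simp add: prod.cartesian_product)
  also have "\<dots> = (\<Prod>(s, t)\<in>off_diagonal n. if s \<in> J \<and> t \<notin> J then f s t else 1)"
  proof (rule prod.mono_neutral_cong_left[OF finite_off_diagonal])
    show "J \<times> ({1..n} - J) \<subseteq> off_diagonal n"
      using assms by (auto simp: off_diagonal_def)
  qed (auto simp: off_diagonal_def split: if_splits)
  finally show ?thesis .
qed

lemma adjoint_coeff_eq_dual_coeff:
  assumes "J \<subseteq> A"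
  shows "adjoint_coeff A y J = dual_coeff A y (A - J)"
proof -
  have "A - (A - J) = J" using assms by auto
  then show ?thesis
    unfolding adjoint_coeff_def dual_coeff_def by (simp add: prod.swap[of _ "A - J"])
qed

text \<open>Domain of the integrand in rows \<open>n\<close> and \<open>Suc n\<close>: for
  \<open>0 \<le> M\<close> every quotient \<open>x (Suc n, m) / x (n, k)\<close> has norm below 1
  there, so the kernel has no poles while row \<open>n\<close> moves in its annulus.\<close>

definition annuli :: "nat \<Rightarrow> real \<Rightarrow> real \<Rightarrow> nat \<times> nat \<Rightarrow> complex set" where
  "annuli n M M' v = (if v \<in> {n} \<times> {1..n} then {w. M < norm w \<and> norm w < M'}
     else if v \<in> {Suc n} \<times> {1..Suc n} then ball 0 M else UNIV)"

definition punctured_balls :: "nat \<Rightarrow> real \<Rightarrow> nat \<times> nat \<Rightarrow> complex set" where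
  "punctured_balls n M v = (if v \<in> {n} \<times> {1..n} then {w. 0 < norm w \<and> norm w < M} else UNIV)"

lemma open_annuli: "open (annuli n M M' v)"
  unfolding annuli_def by (auto intro!: open_Collect_conj open_Collect_less continuous_intros)

text \<open>Bounded sets with arbitrary bound \<open>M\<close> are used because on each of them one
  fixed choice of radii encloses every point of the row.\<close>

definition row_holomorphic :: "nat \<Rightarrow> ((nat \<times> nat \<Rightarrow> complex) \<Rightarrow> complex) \<Rightarrow> bool" where
  "row_holomorphic n g \<longleftrightarrow> (\<forall>M. sep_holomorphic (punctured_balls n M) g)"

lemma annuli_mem:
  assumes "y \<in> Pi UNIV (annuli n M M')"
  shows "k \<in> {1..n} \<Longrightarrow> M < norm (y (n, k))" "k \<in> {1..n} \<Longrightarrow> norm (y (n, k)) < M'"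
    "m \<in> {1..Suc n} \<Longrightarrow> norm (y (Suc n, m)) < M"
  using Pi_mem[OF assms, of "(n, k)"] Pi_mem[OF assms, of "(Suc n, m)"]
  by (simp_all add: annuli_def)

text \<open>Each circle of row \<open>n\<close> has its own radius and needs only to surround all
  entries of the next row. Shrinking entries of row \<open>Suc n\<close>, in particular by
  \<open>q\<close>, preserves this condition.\<close>

definition encloses :: "nat \<Rightarrow> (nat \<times> nat \<Rightarrow> complex) \<Rightarrow> (nat \<times> nat \<Rightarrow> real) \<Rightarrow> bool" where
  "encloses n x r \<longleftrightarrow> (\<forall>k\<in>{1..n}. \<forall>m\<in>{1..Suc n}. norm (x (Suc n, m)) < r (n, k))"

lemma encloses_pos: "encloses n x r \<Longrightarrow> k \<in> {1..n} \<Longrightarrow> 0 < r (n, k)"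
  unfolding encloses_def by (rule le_less_trans[OF norm_ge_zero[of "x (Suc n, 1)"]]) auto

lemma encloses_separated:
  assumes "encloses n x r" "encloses n x s"
  obtains M M' where "0 < M" and "\<And>m. m \<in> {1..Suc n} \<Longrightarrow> norm (x (Suc n, m)) < M"
    and "\<And>k. k \<in> {1..n} \<Longrightarrow> M < r (n, k) \<and> r (n, k) < M' \<and> M < s (n, k) \<and> s (n, k) < M'"
proof -
  define X where "X = (\<lambda>m. norm (x (Suc n, m))) ` {1..Suc n}"
  define R where "R = (\<lambda>k. r (n, k)) ` {1..n} \<union> (\<lambda>k. s (n, k)) ` {1..n}"
  have X: "finite X" "X \<noteq> {}" and R: "finite R" by (auto simp: X_def R_def)
  have "a < b" if "a \<in> X" "b \<in> R" for a b
    using assms that by (auto simp: R_def X_def encloses_def)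
  then have "Max X < b" if "b \<in> R" for b
    using X that by simp
  \<comment> \<open>Inserting \<open>Max X + 1\<close> keeps the minimum meaningful for
    \<open>n = 0\<close>, when there are no radii.\<close>
  then have "Max X < Min (insert (Max X + 1) R)"
    using R by simp
  then obtain M where M: "Max X < M" "M < Min (insert (Max X + 1) R)" using dense by blast
  have "a < M" if "a \<in> X" for a using that M X by auto
  moreover have "M < b \<and> b < Max (insert 0 R) + 1" if "b \<in> R" for b
  proof
    show "M < b" using that M R by simp
    have "b \<le> Max (insert 0 R)" using that R by (intro Max_ge) auto
    then show "b < Max (insert 0 R) + 1" by linarith
  qed
  moreover have "0 < M"
    using \<open>\<And>a. a \<in> X \<Longrightarrow> a < M\<close>[of "norm (x (Suc n, 1))"] norm_ge_zero[of "x (Suc n, 1)"]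
    by (simp add: X_def del: norm_ge_zero)
  ultimately show ?thesis
    by (intro that[of M "Max (insert 0 R) + 1"]) (auto simp: X_def R_def)
qed

text \<open>\<open>h\<close> receives the whole array, hence may depend on the fixed row
  \<open>Suc n\<close> too; this admits the rational multipliers that mix both rows.\<close>

definition pairing ::
    "real \<Rightarrow> nat \<Rightarrow> (nat \<times> nat \<Rightarrow> real) \<Rightarrow> (nat \<times> nat \<Rightarrow> complex) \<Rightarrow> ((nat \<times> nat \<Rightarrow> complex) \<Rightarrow> complex) \<Rightarrow> complex" where
  "pairing q n r x h = torus_mean r (row_indices n) (\<lambda>y. mb_kernel q n y * q_weight q n {} y * h y) x"

lemma pairing_cong:
  assumes "encloses n x r" and "\<And>y. y \<in> torus r ({n} \<times> {1..n}) x \<Longrightarrow> f y = g y"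
  shows "pairing q n r x f = pairing q n r x g"
  unfolding pairing_def
proof (rule torus_mean_cong)
  fix y y' assume y: "\<And>v. v \<in> set (row_indices n) \<Longrightarrow> y' v = y v \<and> norm (y v) = r v"
      "\<And>v. v \<notin> set (row_indices n) \<Longrightarrow> y v = x v \<and> y' v = x v"
  then have "y' v = y v" for v by (cases "v \<in> set (row_indices n)") simp_all
  then have "y' = y" by (rule ext)
  moreover have "f y = g y"
    by (rule assms(2)) (use y in \<open>auto simp: torus_def\<close>)
  ultimately show "mb_kernel q n y * q_weight q n {} y * f y = mb_kernel q n y' * q_weight q n {} y' * g y'"
    by simp
next
  fix v assume "v \<in> set (row_indices n)"
  then show "0 \<le> r v" using encloses_pos[OF assms(1)] by (auto intro: less_imp_le)
qed simp

lemma pairing_cmult: "pairing q n r x (\<lambda>y. c * f y) = c * pairing q n r x f"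
  unfolding pairing_def by (subst torus_mean_cmult[symmetric]) (simp add: mult_ac)

lemma torus_subset_annuli:
  assumes "0 < M" "\<And>m. m \<in> {1..Suc n} \<Longrightarrow> norm (x (Suc n, m)) < M"
    and "\<And>k. k \<in> {1..n} \<Longrightarrow> M < r (n, k) \<and> r (n, k) < M'"
  shows "torus r ({n} \<times> {1..n}) x \<subseteq> Pi UNIV (annuli n M M')"
  using assms by (fastforce simp: torus_def annuli_def)

lemma row_holomorphic_continuous_on_torus:
  assumes "row_holomorphic n g" "encloses n x r"
  shows "continuous_on (torus r ({n} \<times> {1..n}) x) g"
proof -
  obtain M M' where M: "0 < M" "\<And>k. k \<in> {1..n} \<Longrightarrow> M < r (n, k) \<and> r (n, k) < M'"
    using encloses_separated[OF assms(2,2)] by metis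
  have "torus r ({n} \<times> {1..n}) x \<subseteq> Pi UNIV (punctured_balls n M')"
  proof (intro subsetI Pi_I)
    fix y v assume y: "y \<in> torus r ({n} \<times> {1..n}) x"
    show "y v \<in> punctured_balls n M' v"
    proof (cases "v \<in> {n} \<times> {1..n}")
      case True
      then obtain k where k: "v = (n, k)" "k \<in> {1..n}" by auto
      then have "norm (y v) = r v" using y by (simp add: torus_def)
      then show ?thesis using M(1) M(2)[OF k(2)] k by (auto simp: punctured_balls_def)
    qed (auto simp: punctured_balls_def)
  qed
  moreover have "continuous_on (Pi UNIV (punctured_balls n M')) g"
    using assms(1) by (simp add: row_holomorphic_def sep_holomorphic_def)
  ultimately show ?thesis
    by (rule continuous_on_subset[rotated])
qed

text \<open>Points on circles of different radii differ, and the next row lies strictly inside all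
  circles; so no denominator of the rational coefficients vanishes on the torus.\<close>

lemma torus_row_distinct:
  assumes "y \<in> torus r ({n} \<times> {1..n}) x" "encloses n x r" "inj_on (\<lambda>k. r (n, k)) {1..n}"
  shows "inj_on (\<lambda>k. y (n, k)) {1..n}" "k \<in> {1..n} \<Longrightarrow> y (n, k) \<noteq> 0"
    "k \<in> {1..n} \<Longrightarrow> m \<in> {1..Suc n} \<Longrightarrow> y (Suc n, m) \<noteq> y (n, k)"
    "y (Suc n, m) = x (Suc n, m)"
proof -
  have norm: "norm (y (n, k)) = r (n, k)" if "k \<in> {1..n}" for k
    using assms(1) that by (simp add: torus_def)
  show "inj_on (\<lambda>k. y (n, k)) {1..n}"
    using assms(3) norm by (metis (mono_tags, lifting) inj_on_def)
  show "y (n, k) \<noteq> 0" if "k \<in> {1..n}" for k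
    using norm[OF that] encloses_pos[OF assms(2) that] by auto
  show eq: "y (Suc n, m) = x (Suc n, m)" for m
    using assms(1) by (simp add: torus_def)
  show "y (Suc n, m) \<noteq> y (n, k)" if "k \<in> {1..n}" "m \<in> {1..Suc n}" for k m
    using norm[OF that(1)] assms(2) that unfolding encloses_def eq by (metis less_irrefl)
qed

section \<open>q-shifts of kernel and weight, independence of the radii, and the adjoint
  formula\<close>

context
  fixes q :: real
  assumes q: "0 < q" "q < 1"
begin

text \<open>With \<open>u = y (n, s) / y (n, t)\<close>, the coefficient factor is
  \<open>1 / (1 - u)\<close>, and its pole meets the zero of \<open>q_poch q u\<close> at
  \<open>u = 1\<close>; the functional equation leaves \<open>q_poch q (q * u)\<close>.\<close>

lemma q_weight_dual_coeff:
  assumes "J \<subseteq> {1..n}" "inj_on (\<lambda>k. y (n, k)) {1..n}" "\<And>k. k \<in> {1..n} \<Longrightarrow> y (n, k) \<noteq> 0"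
  shows "q_weight q n J y = q_weight q n {} y * dual_coeff {1..n} (\<lambda>k. y (n, k)) J"
  unfolding dual_coeff_def prod_off_diagonal[OF assms(1)] q_weight_def prod.distrib[symmetric]
proof (rule prod.cong[OF refl], clarify)
  fix s t assume "(s, t) \<in> off_diagonal n"
  then have st: "s \<in> {1..n}" "t \<in> {1..n}" "s \<noteq> t" by (auto simp: off_diagonal_def)
  define u where "u = y (n, s) / y (n, t)"
  have ne: "y (n, s) \<noteq> y (n, t)" "y (n, t) \<noteq> 0" using st assms by (auto dest: inj_onD)
  have "q_poch q (of_real q * u) = q_poch q u * (y (n, t) / (y (n, t) - y (n, s)))"
  proof -
    have "(1 - u) * (y (n, t) / (y (n, t) - y (n, s))) = 1"
      using ne by (simp add: u_def field_simps)
    moreover have "q_poch q u * (y (n, t) / (y (n, t) - y (n, s))) =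
        q_poch q (of_real q * u) * ((1 - u) * (y (n, t) / (y (n, t) - y (n, s))))"
      unfolding q_poch_rec[OF q, of u] by (simp only: mult_ac)
    ultimately show ?thesis by simp
  qed
  then show "q_poch q ((if s \<in> J \<and> t \<notin> J then of_real q else 1) * (y (n, s) / y (n, t))) =
      q_poch q ((if s \<in> {} \<and> t \<notin> {} then of_real q else 1) * (y (n, s) / y (n, t))) *
      (if s \<in> J \<and> t \<notin> J then y (n, t) / (y (n, t) - y (n, s)) else 1)"
    by (simp add: u_def)
qed

text \<open>Dividing the entries of \<open>J\<close> by \<open>q\<close> cancels the extra
  \<open>q\<close> in quotients from \<open>J\<close> to its complement and creates one in the
  quotients in the opposite direction.\<close>

lemma q_weight_dilate:
  assumes "J \<subseteq> {1..n}"
  shows "q_weight q n J (dilate (1 / q) n J y) = q_weight q n ({1..n} - J) y"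
  unfolding q_weight_def
proof (rule prod.cong[OF refl], clarify)
  fix s t assume "(s, t) \<in> off_diagonal n"
  then have st: "s \<in> {1..n}" "t \<in> {1..n}" by (auto simp: off_diagonal_def)
  have "(if s \<in> J \<and> t \<notin> J then of_real q else 1) *
      (dilate (1 / q) n J y (n, s) / dilate (1 / q) n J y (n, t)) =
      (if s \<in> {1..n} - J \<and> t \<notin> {1..n} - J then of_real q else 1) * (y (n, s) / y (n, t))"
    using st q by simp
  then show "q_poch q ((if s \<in> J \<and> t \<notin> J then of_real q else 1) *
      (dilate (1 / q) n J y (n, s) / dilate (1 / q) n J y (n, t))) =
      q_poch q ((if s \<in> {1..n} - J \<and> t \<notin> {1..n} - J then of_real q else 1) * (y (n, s) / y (n, t)))"
    by simp
qed

lemma inverse_q_poch_shift: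
  assumes "u \<noteq> 1"
  shows "inverse (q_poch q (of_real q * u)) = inverse (q_poch q u) * (1 - u)"
  using assms q_poch_rec[OF q, of u] by simp

lemma mb_kernel_dilate:
  assumes "J \<subseteq> {1..n}" and "\<And>i m. i \<in> J \<Longrightarrow> m \<in> {1..Suc n} \<Longrightarrow> y (Suc n, m) \<noteq> y (n, i)"
  shows "mb_kernel q n (dilate (1 / q) n J y) =
    mb_kernel q n y * (\<Prod>i\<in>J. \<Prod>m\<in>{1..Suc n}. 1 - y (Suc n, m) / y (n, i))"
proof -
  have "mb_kernel q n (dilate (1 / q) n J y) = (\<Prod>k=1..n. \<Prod>m=1..Suc n.
      inverse (q_poch q (y (Suc n, m) / y (n, k))) * (if k \<in> J then 1 - y (Suc n, m) / y (n, k) else 1))"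
    unfolding mb_kernel_def
  proof (intro prod.cong refl)
    fix k m assume km: "k \<in> {1..n}" "m \<in> {1..Suc n}"
    show "inverse (q_poch q (dilate (1 / q) n J y (Suc n, m) / dilate (1 / q) n J y (n, k))) =
      inverse (q_poch q (y (Suc n, m) / y (n, k))) * (if k \<in> J then 1 - y (Suc n, m) / y (n, k) else 1)"
    proof (cases "k \<in> J")
      case True
      then have "y (Suc n, m) / y (n, k) \<noteq> 1" using assms(2)[OF True km(2)] by auto
      from inverse_q_poch_shift[OF this] True show ?thesis by (simp add: mult.commute)
    qed simp
  qed
  also have "\<dots> = mb_kernel q n y *
      (\<Prod>k=1..n. \<Prod>m=1..Suc n. if k \<in> J then 1 - y (Suc n, m) / y (n, k) else 1)"
    by (simp only: mb_kernel_def prod.distrib)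
  also have "(\<Prod>k=1..n. \<Prod>m=1..Suc n. if k \<in> J then 1 - y (Suc n, m) / y (n, k) else 1) =
      (\<Prod>i\<in>J. \<Prod>m\<in>{1..Suc n}. 1 - y (Suc n, m) / y (n, i))"
    using assms(1) by (intro prod.mono_neutral_cong_right) auto
  finally show ?thesis .
qed

lemma mb_kernel_dilate_Suc:
  assumes "I \<subseteq> {1..Suc n}" and "\<And>i k. i \<in> I \<Longrightarrow> k \<in> {1..n} \<Longrightarrow> y (Suc n, i) \<noteq> y (n, k)"
  shows "mb_kernel q n (dilate q (Suc n) I y) =
    mb_kernel q n y * (\<Prod>i\<in>I. \<Prod>k\<in>{1..n}. 1 - y (Suc n, i) / y (n, k))"
proof -
  have "mb_kernel q n (dilate q (Suc n) I y) = (\<Prod>k=1..n. \<Prod>m=1..Suc n.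
      inverse (q_poch q (y (Suc n, m) / y (n, k))) * (if m \<in> I then 1 - y (Suc n, m) / y (n, k) else 1))"
    unfolding mb_kernel_def
  proof (intro prod.cong refl)
    fix k m assume km: "k \<in> {1..n}" "m \<in> {1..Suc n}"
    show "inverse (q_poch q (dilate q (Suc n) I y (Suc n, m) / dilate q (Suc n) I y (n, k))) =
      inverse (q_poch q (y (Suc n, m) / y (n, k))) * (if m \<in> I then 1 - y (Suc n, m) / y (n, k) else 1)"
    proof (cases "m \<in> I")
      case True
      then have "y (Suc n, m) / y (n, k) \<noteq> 1" using assms(2)[OF True km(1)] by auto
      from inverse_q_poch_shift[OF this] True show ?thesis by simp
    qed simp
  qed
  also have "\<dots> = mb_kernel q n y *
      (\<Prod>k=1..n. \<Prod>m=1..Suc n. if m \<in> I then 1 - y (Suc n, m) / y (n, k) else 1)"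
    by (simp only: mb_kernel_def prod.distrib)
  also have "(\<Prod>k=1..n. \<Prod>m=1..Suc n. if m \<in> I then 1 - y (Suc n, m) / y (n, k) else 1) =
      (\<Prod>m=1..Suc n. \<Prod>k=1..n. if m \<in> I then 1 - y (Suc n, m) / y (n, k) else 1)"
    by (rule prod.swap)
  also have "\<dots> = (\<Prod>i\<in>I. \<Prod>k\<in>{1..n}. 1 - y (Suc n, i) / y (n, k))"
    using assms(1) by (intro prod.mono_neutral_cong_right) auto
  finally show ?thesis .
qed

lemma sep_holomorphic_integrand:
  assumes "row_holomorphic n g" "0 \<le> M"
  shows "sep_holomorphic (annuli n M M') (\<lambda>y. mb_kernel q n y * q_weight q n J y * g y)"
proof (intro sep_holomorphic_mult)
  have nz: "y (n, k) \<noteq> 0" if "y \<in> Pi UNIV (annuli n M M')" "k \<in> {1..n}" for y k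
    using annuli_mem(1)[OF that] assms(2) by auto
  show "sep_holomorphic (annuli n M M') g"
    using assms unfolding row_holomorphic_def
    by (elim allE[of _ M'] sep_holomorphic_subset)
      (auto simp: annuli_def punctured_balls_def)
  show "sep_holomorphic (annuli n M M') (mb_kernel q n)"
    unfolding mb_kernel_def
  proof (intro sep_holomorphic_prod sep_holomorphic_inverse sep_holomorphic_compose[OF q_poch_holomorphic[OF q, of UNIV]]
      sep_holomorphic_divide sep_holomorphic_coordinate)
    fix k m y assume km: "k \<in> {1..n}" "m \<in> {1..Suc n}" and y: "y \<in> Pi UNIV (annuli n M M')"
    show "y (n, k) \<noteq> 0" using nz[OF y km(1)] .
    have "norm (y (Suc n, m)) < norm (y (n, k))"
      using annuli_mem[OF y] km by (metis less_trans)
    then show "q_poch q (y (Suc n, m) / y (n, k)) \<noteq> 0"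
      by (intro q_poch_nonzero[OF q]) (auto simp: norm_divide divide_less_eq)
  qed auto
  show "sep_holomorphic (annuli n M M') (q_weight q n J)"
    unfolding q_weight_def case_prod_beta
    by (intro sep_holomorphic_prod sep_holomorphic_compose[OF q_poch_holomorphic[OF q, of UNIV]]
        sep_holomorphic_mult sep_holomorphic_const sep_holomorphic_divide sep_holomorphic_coordinate)
      (auto simp: off_diagonal_def nz)
qed

lemma torus_mean_radius_independent:
  assumes g: "row_holomorphic n g" and "encloses n x r" "encloses n x s"
  shows "torus_mean r (row_indices n) (\<lambda>y. mb_kernel q n y * q_weight q n J y * g y) x =
    torus_mean s (row_indices n) (\<lambda>y. mb_kernel q n y * q_weight q n J y * g y) x"
proof -
  obtain M M' where M: "0 < M" "\<And>m. m \<in> {1..Suc n} \<Longrightarrow> norm (x (Suc n, m)) < M"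
    "\<And>k. k \<in> {1..n} \<Longrightarrow> M < r (n, k) \<and> r (n, k) < M' \<and> M < s (n, k) \<and> s (n, k) < M'"
    using encloses_separated[OF assms(2,3)] by metis
  \<comment> \<open>The row \<open>n\<close> entries of \<open>x\<close> are overwritten by the mean
    and may lie anywhere; moving them onto the contour puts the base point into the domain required
    for the deformation.\<close>
  define x' where "x' = (\<lambda>v. if v \<in> {n} \<times> {1..n} then of_real (r v) else x v)"
  have indep: "torus_mean t (row_indices n) F x = torus_mean t (row_indices n) F x'"
    if "\<And>k. k \<in> {1..n} \<Longrightarrow> 0 \<le> t (n, k)" for t and F :: "(nat \<times> nat \<Rightarrow> complex) \<Rightarrow> complex"
  proof (rule torus_mean_cong)
    fix y y' assume "\<And>v. v \<in> set (row_indices n) \<Longrightarrow> y' v = y v \<and> norm (y v) = t v"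
      "\<And>v. v \<notin> set (row_indices n) \<Longrightarrow> y v = x v \<and> y' v = x' v"
    then have "y v = y' v" for v by (cases "v \<in> set (row_indices n)") (simp_all add: x'_def)
    then have "y = y'" by (rule ext)
    then show "F y = F y'" by simp
  qed (use that in auto)
  have pos: "0 \<le> r (n, k)" "0 \<le> s (n, k)" if "k \<in> {1..n}" for k using M(1) M(3)[OF that] by auto
  have "torus_mean r (row_indices n) (\<lambda>y. mb_kernel q n y * q_weight q n J y * g y) x' =
    torus_mean s (row_indices n) (\<lambda>y. mb_kernel q n y * q_weight q n J y * g y) x'"
  proof (rule torus_mean_deform[OF sep_holomorphic_integrand[OF g, of M M'] open_annuli])
    show "x' \<in> Pi UNIV (annuli n M M')"
    proof
      fix v
      show "x' v \<in> annuli n M M' v"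
      proof (cases "v \<in> {n} \<times> {1..n}")
        case True
        then obtain k where "v = (n, k)" "k \<in> {1..n}" by auto
        then show ?thesis using M(1) M(3)[of k] by (simp add: annuli_def x'_def)
      next
        case False
        then show ?thesis using M(2) by (auto simp: annuli_def x'_def)
      qed
    qed
    fix v assume "v \<in> set (row_indices n)"
    then obtain k where k: "v = (n, k)" "k \<in> {1..n}" by auto
    show "0 < r v \<and> 0 < s v \<and> {w. min (r v) (s v) \<le> norm w \<and> norm w \<le> max (r v) (s v)} \<subseteq> annuli n M M' v"
      using M(1) M(3)[OF k(2)] k by (auto simp: annuli_def)
  qed (use M(1) in auto)
  then show ?thesis
    by (simp only: indep[of r, OF pos(1)] indep[of s, OF pos(2)])
qed

lemma continuous_on_torus_weight:
  assumes "encloses n x r"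
  shows "continuous_on (torus r ({n} \<times> {1..n}) x) (\<lambda>y. mb_kernel q n y * q_weight q n {} y)"
proof -
  obtain M M' where M: "0 < M" "\<And>m. m \<in> {1..Suc n} \<Longrightarrow> norm (x (Suc n, m)) < M"
    "\<And>k. k \<in> {1..n} \<Longrightarrow> M < r (n, k) \<and> r (n, k) < M'"
    using encloses_separated[OF assms assms] by metis
  have "row_holomorphic n (\<lambda>_. 1)" by (simp add: row_holomorphic_def)
  from sep_holomorphic_integrand[OF this, of M M' "{}"] M(1)
  have "continuous_on (Pi UNIV (annuli n M M')) (\<lambda>y. mb_kernel q n y * q_weight q n {} y)"
    by (simp add: sep_holomorphic_def)
  then show ?thesis by (rule continuous_on_subset) (rule torus_subset_annuli; rule M; assumption)
qed

lemma pairing_sum: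
  assumes "finite I" "encloses n x r"
    and "\<And>i. i \<in> I \<Longrightarrow> continuous_on (torus r ({n} \<times> {1..n}) x) (f i)"
  shows "pairing q n r x (\<lambda>y. \<Sum>i\<in>I. f i y) = (\<Sum>i\<in>I. pairing q n r x (f i))"
proof -
  have "torus_mean r (row_indices n) (\<lambda>y. \<Sum>i\<in>I. mb_kernel q n y * q_weight q n {} y * f i y) x =
      (\<Sum>i\<in>I. torus_mean r (row_indices n) (\<lambda>y. mb_kernel q n y * q_weight q n {} y * f i y) x)"
  proof (rule torus_mean_sum[OF assms(1)])
    fix i assume "i \<in> I"
    from assms(3)[OF this] continuous_on_torus_weight[OF assms(2)]
    show "continuous_on (torus r (set (row_indices n)) x) (\<lambda>y. mb_kernel q n y * q_weight q n {} y * f i y)"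
      by (simp add: continuous_on_mult)
  qed (use encloses_pos[OF assms(2)] in \<open>auto intro: less_imp_le\<close>)
  then show ?thesis unfolding pairing_def by (simp add: sum_distrib_left)
qed

lemma row_holomorphic_dilate:
  assumes "row_holomorphic n g"
  shows "row_holomorphic n (\<lambda>y. g (dilate q n J y))"
  unfolding row_holomorphic_def dilate_def
proof
  fix M
  show "sep_holomorphic (punctured_balls n M)
      (\<lambda>y. g (\<lambda>v. of_real (if v \<in> {n} \<times> J then q else 1) * y v))"
  proof (rule sep_holomorphic_dilate)
    show "sep_holomorphic (punctured_balls n M) g" using assms by (simp add: row_holomorphic_def)
    fix v w assume "w \<in> punctured_balls n M v"
    moreover have le: "q * norm w \<le> norm w" using q by (simp add: mult_left_le_one_le)
    ultimately show "of_real (if v \<in> {n} \<times> J then q else 1) * w \<in> punctured_balls n M v"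
      using q by (cases "v \<in> {n} \<times> {1..n}"; cases "v \<in> {n} \<times> J")
        (auto simp: punctured_balls_def norm_mult intro: le_less_trans[OF le])
  qed
qed

text \<open>
  Substituting \<open>y (n, k) / q\<close> for \<open>y (n, k)\<close>, \<open>k \<in> J\<close>, and moving the enlarged circles back, which
  crosses no poles, transfers the \<open>q\<close>-shift from \<open>g\<close> to the kernel.
\<close>

lemma pairing_adjoint:
  assumes g: "row_holomorphic n g" and r: "encloses n x r" "inj_on (\<lambda>k. r (n, k)) {1..n}"
    and J: "J \<subseteq> {1..n}"
  shows "pairing q n r x (\<lambda>y. dual_coeff {1..n} (\<lambda>k. y (n, k)) J * g (dilate q n J y)) =
    pairing q n r x (\<lambda>y. adjoint_coeff {1..n} (\<lambda>k. y (n, k)) J *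
      (\<Prod>i\<in>J. \<Prod>m\<in>{1..Suc n}. 1 - y (Suc n, m) / y (n, i)) * g y)"
proof -
  define F where "F = (\<lambda>y. mb_kernel q n y * q_weight q n J y * g (dilate q n J y))"
  define c where "c = (\<lambda>v. if v \<in> {n} \<times> J then 1 / q else 1)"
  have pos: "0 \<le> r v" if "v \<in> set (row_indices n)" for v
    using that encloses_pos[OF r(1)] by (auto intro: less_imp_le)
  have torus: "y \<in> torus r ({n} \<times> {1..n}) x \<and> y' = y"
    if "\<And>v. v \<in> set (row_indices n) \<Longrightarrow> y' v = y v \<and> norm (y v) = r v"
      "\<And>v. v \<notin> set (row_indices n) \<Longrightarrow> y v = x v \<and> y' v = x v" for y y'
  proof
    show "y \<in> torus r ({n} \<times> {1..n}) x" using that by (simp add: torus_def)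
    have "y' v = y v" for v using that by (cases "v \<in> set (row_indices n)") simp_all
    then show "y' = y" by (rule ext)
  qed
  \<comment> \<open>Since \<open>q < 1\<close>, division by \<open>q\<close> only enlarges circles,
    so they still surround row \<open>Suc n\<close>.\<close>
  have "encloses n x (\<lambda>v. c v * r v)"
    unfolding encloses_def
  proof (intro ballI)
    fix k m assume km: "k \<in> {1..n}" "m \<in> {1..Suc n}"
    have "r (n, k) \<le> c (n, k) * r (n, k)"
      using encloses_pos[OF r(1) km(1)] q by (auto simp: c_def)
    moreover have "norm (x (Suc n, m)) < r (n, k)"
      using r(1) km unfolding encloses_def by blast
    ultimately show "norm (x (Suc n, m)) < c (n, k) * r (n, k)"
      by (rule less_le_trans[rotated])
  qed
  then have deform: "torus_mean (\<lambda>v. c v * r v) (row_indices n) F x = torus_mean r (row_indices n) F x"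
    unfolding F_def by (intro torus_mean_radius_independent row_holomorphic_dilate g r(1))
  have "pairing q n r x (\<lambda>y. dual_coeff {1..n} (\<lambda>k. y (n, k)) J * g (dilate q n J y)) =
      torus_mean r (row_indices n) F x"
    unfolding pairing_def
  proof (rule torus_mean_cong[OF distinct_row_indices pos])
    fix y y' assume "\<And>v. v \<in> set (row_indices n) \<Longrightarrow> y' v = y v \<and> norm (y v) = r v"
      "\<And>v. v \<notin> set (row_indices n) \<Longrightarrow> y v = x v \<and> y' v = x v"
    then have y: "y \<in> torus r ({n} \<times> {1..n}) x" "y' = y" using torus by auto
    show "mb_kernel q n y * q_weight q n {} y *
        (dual_coeff {1..n} (\<lambda>k. y (n, k)) J * g (dilate q n J y)) = F y'"
      using q_weight_dual_coeff[OF J torus_row_distinct(1,2)[OF y(1) r]]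
      by (simp add: F_def y(2) mult_ac)
  qed
  also have "\<dots> = torus_mean r (row_indices n) (\<lambda>y. F (\<lambda>v. of_real (c v) * y v)) x"
    unfolding deform[symmetric] using J by (intro torus_mean_dilate[symmetric]) (auto simp: c_def)
  also have "\<dots> = pairing q n r x (\<lambda>y. adjoint_coeff {1..n} (\<lambda>k. y (n, k)) J *
      (\<Prod>i\<in>J. \<Prod>m\<in>{1..Suc n}. 1 - y (Suc n, m) / y (n, i)) * g y)"
    unfolding pairing_def
  proof (rule torus_mean_cong[OF distinct_row_indices pos])
    fix y y' assume "\<And>v. v \<in> set (row_indices n) \<Longrightarrow> y' v = y v \<and> norm (y v) = r v"
      "\<And>v. v \<notin> set (row_indices n) \<Longrightarrow> y v = x v \<and> y' v = x v"
    then have y: "y \<in> torus r ({n} \<times> {1..n}) x" "y' = y" using torus by auto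
    have scaled: "(\<lambda>v. of_real (c v) * y v) = dilate (1 / q) n J y"
      by (simp add: c_def dilate_def)
    have kernel: "mb_kernel q n (dilate (1 / q) n J y) =
        mb_kernel q n y * (\<Prod>i\<in>J. \<Prod>m\<in>{1..Suc n}. 1 - y (Suc n, m) / y (n, i))"
      using torus_row_distinct(3)[OF y(1) r] J by (intro mb_kernel_dilate) auto
    have weight: "q_weight q n J (dilate (1 / q) n J y) =
        q_weight q n {} y * adjoint_coeff {1..n} (\<lambda>k. y (n, k)) J"
      unfolding q_weight_dilate[OF J] adjoint_coeff_eq_dual_coeff[OF J]
      by (intro q_weight_dual_coeff torus_row_distinct[OF y(1) r]) auto
    show "F (\<lambda>v. of_real (c v) * y v) = mb_kernel q n y' * q_weight q n {} y' *
        (adjoint_coeff {1..n} (\<lambda>k. y' (n, k)) J *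
          (\<Prod>i\<in>J. \<Prod>m\<in>{1..Suc n}. 1 - y' (Suc n, m) / y' (n, i)) * g y')"
      unfolding scaled F_def kernel weight y(2) using q by (simp only: dilate_inverse mult_ac)
  qed
  finally show ?thesis .
qed

end

section \<open>The integral as a recursion over rows\<close>

definition row_prod :: "nat \<Rightarrow> (nat \<times> nat \<Rightarrow> complex) \<Rightarrow> complex" where
  "row_prod n x = (\<Prod>k=1..n. x (n, k))"

text \<open>
  The radii within a row are made distinct, so that no two entries of the row coincide on the torus.
\<close>

definition std_radius :: "nat \<Rightarrow> (nat \<times> nat \<Rightarrow> complex) \<Rightarrow> nat \<times> nat \<Rightarrow> real" where
  "std_radius n x v = 1 + (\<Sum>m=1..Suc n. norm (x (Suc n, m))) + real (snd v)"

text \<open>The integral without the factors \<open>1 / fact n\<close> and the constant, for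
  arbitrary integers \<open>p\<close>. The radii are computed from \<open>x\<close> and so need not
  be carried along; by \<open>mb_psi_Suc\<close> any enclosing radii give the same value.\<close>

primrec mb_psi :: "real \<Rightarrow> (nat \<Rightarrow> int) \<Rightarrow> nat \<Rightarrow> (nat \<times> nat \<Rightarrow> complex) \<Rightarrow> complex" where
  "mb_psi q p 0 = (\<lambda>x. 1)"
| "mb_psi q p (Suc n) = (\<lambda>x. row_prod (Suc n) x powi p (Suc n) *
     pairing q n (std_radius n x) x (\<lambda>y. row_prod n y powi (- p (Suc n)) * mb_psi q p n y))"

lemma encloses_std_radius: "encloses n x (std_radius n x)"
  unfolding encloses_def
proof (intro ballI)
  fix k m assume "m \<in> {1..Suc n}"
  then have "norm (x (Suc n, m)) \<le> (\<Sum>m=1..Suc n. norm (x (Suc n, m)))"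
    by (intro member_le_sum) auto
  then show "norm (x (Suc n, m)) < std_radius n x (n, k)"
    unfolding std_radius_def by simp
qed

lemma inj_std_radius: "inj_on (\<lambda>k. std_radius n x (n, k)) A"
  by (auto simp: std_radius_def inj_on_def)

lemma q_weight_agree:
  assumes "\<And>k. k \<in> {1..n} \<Longrightarrow> y (n, k) = y' (n, k)"
  shows "q_weight q n J y = q_weight q n J y'"
  unfolding q_weight_def
  by (rule prod.cong[OF refl]) (auto simp: off_diagonal_def assms)

lemma row_prod_agree:
  assumes "\<And>k. k \<in> {1..n} \<Longrightarrow> y (n, k) = y' (n, k)"
  shows "row_prod n y = row_prod n y'"
  unfolding row_prod_def by (rule prod.cong[OF refl]) (rule assms)

lemma row_prod_dilate:
  assumes "J \<subseteq> {1..n}"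
  shows "row_prod n (dilate c n J y) = of_real c ^ card J * row_prod n y"
proof -
  have "row_prod n (dilate c n J y) = (\<Prod>k=1..n. (if k \<in> J then of_real c else 1) * y (n, k))"
    unfolding row_prod_def by (rule prod.cong) auto
  also have "\<dots> = (\<Prod>k=1..n. if k \<in> J then of_real c else 1) * row_prod n y"
    unfolding row_prod_def by (rule prod.distrib)
  also have "(\<Prod>k=1..n. if k \<in> J then complex_of_real c else 1) = (\<Prod>k\<in>J. of_real c)"
    using assms by (intro prod.mono_neutral_cong_right) auto
  finally show ?thesis by simp
qed

lemma row_prod_nonzero: "(\<And>k. k \<in> {1..n} \<Longrightarrow> y (n, k) \<noteq> 0) \<Longrightarrow> row_prod n y \<noteq> 0"
  by (simp add: row_prod_def)

text \<open>Compares pairings whose fixed rows \<open>Suc n\<close> may differ. A change of the top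
  row, by a shift or a permutation, is felt by the kernel only and can be moved into the paired
  function.\<close>

lemma pairing_transfer:
  assumes "encloses n x r"
    and "\<And>y y'. \<lbrakk>y \<in> torus r ({n} \<times> {1..n}) x; y' \<in> torus r ({n} \<times> {1..n}) x';
      \<And>k. k \<in> {1..n} \<Longrightarrow> y' (n, k) = y (n, k)\<rbrakk> \<Longrightarrow> mb_kernel q n y * f y = mb_kernel q n y' * g y'"
  shows "pairing q n r x f = pairing q n r x' g"
  unfolding pairing_def
proof (rule torus_mean_cong)
  fix y y' assume y: "\<And>v. v \<in> set (row_indices n) \<Longrightarrow> y' v = y v \<and> norm (y v) = r v"
      "\<And>v. v \<notin> set (row_indices n) \<Longrightarrow> y v = x v \<and> y' v = x' v"
  have eq: "y' (n, k) = y (n, k)" if "k \<in> {1..n}" for k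
    using y(1)[of "(n, k)"] that by simp
  have "mb_kernel q n y * f y = mb_kernel q n y' * g y'"
    by (rule assms(2)) (use y eq in \<open>simp_all add: torus_def\<close>)
  moreover have "q_weight q n {} y = q_weight q n {} y'"
    by (rule q_weight_agree) (simp add: eq)
  ultimately show "mb_kernel q n y * q_weight q n {} y * f y = mb_kernel q n y' * q_weight q n {} y' * g y'"
    by (simp add: mult_ac)
next
  fix v assume "v \<in> set (row_indices n)"
  then show "0 \<le> r v" using encloses_pos[OF assms(1)] by (auto intro: less_imp_le)
qed simp

lemma torus_row_Suc: "y \<in> torus r ({n} \<times> {1..n}) x \<Longrightarrow> y (Suc n, m) = x (Suc n, m)"
  by (simp add: torus_def)

lemma mb_kernel_agree:
  assumes "\<And>k. k \<in> {1..n} \<Longrightarrow> y (n, k) = y' (n, k)"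
    and "\<And>m. m \<in> {1..Suc n} \<Longrightarrow> y (Suc n, m) = y' (Suc n, m)"
  shows "mb_kernel q n y = mb_kernel q n y'"
  unfolding mb_kernel_def by (intro prod.cong refl) (simp add: assms)

lemma mb_psi_agree:
  assumes "\<And>k. k \<in> {1..n} \<Longrightarrow> x (n, k) = x' (n, k)"
  shows "mb_psi q p n x = mb_psi q p n x'"
  using assms
proof (induction n arbitrary: x x')
  case 0
  show ?case by simp
next
  case (Suc n)
  have radius: "std_radius n x = std_radius n x'"
    using Suc.prems by (auto simp: std_radius_def)
  have "pairing q n (std_radius n x) x (\<lambda>y. row_prod n y powi (- p (Suc n)) * mb_psi q p n y) =
      pairing q n (std_radius n x) x' (\<lambda>y. row_prod n y powi (- p (Suc n)) * mb_psi q p n y)"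
  proof (rule pairing_transfer[OF encloses_std_radius])
    fix y y' assume y: "y \<in> torus (std_radius n x) ({n} \<times> {1..n}) x"
      "y' \<in> torus (std_radius n x) ({n} \<times> {1..n}) x'" "\<And>k. k \<in> {1..n} \<Longrightarrow> y' (n, k) = y (n, k)"
    have "mb_psi q p n y = mb_psi q p n y'" by (rule Suc.IH) (simp add: y(3))
    moreover have "row_prod n y = row_prod n y'" by (rule row_prod_agree) (simp add: y(3))
    moreover have "mb_kernel q n y = mb_kernel q n y'"
      by (rule mb_kernel_agree) (simp_all add: y(3) torus_row_Suc[OF y(1)] torus_row_Suc[OF y(2)] Suc.prems)
    ultimately show "mb_kernel q n y * (row_prod n y powi (- p (Suc n)) * mb_psi q p n y) =
        mb_kernel q n y' * (row_prod n y' powi (- p (Suc n)) * mb_psi q p n y')"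
      by simp
  qed
  moreover have "row_prod (Suc n) x = row_prod (Suc n) x'"
    by (rule row_prod_agree) (rule Suc.prems)
  ultimately show ?case by (simp add: radius)
qed

lemma mb_psi_cong:
  assumes "\<And>i. i \<in> {1..n} \<Longrightarrow> p i = p' i"
  shows "mb_psi q p n = mb_psi q p' n"
  using assms by (induction n) simp_all

lemma row_holomorphic_mult:
  "row_holomorphic n f \<Longrightarrow> row_holomorphic n g \<Longrightarrow> row_holomorphic n (\<lambda>y. f y * g y)"
  unfolding row_holomorphic_def by (blast intro: sep_holomorphic_mult)

lemma row_holomorphic_coordinate: "row_holomorphic n (\<lambda>y. y v)"
  unfolding row_holomorphic_def by (blast intro: sep_holomorphic_coordinate)

lemma row_holomorphic_elem_sym: "row_holomorphic n (\<lambda>y. elem_sym A r (\<lambda>k. y (n, k)))"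
  unfolding row_holomorphic_def elem_sym_def
  by (intro allI sep_holomorphic_sum sep_holomorphic_prod sep_holomorphic_coordinate)

lemma punctured_balls_nonzero:
  "y \<in> Pi UNIV (punctured_balls n M) \<Longrightarrow> k \<in> {1..n} \<Longrightarrow> y (n, k) \<noteq> 0"
  using Pi_mem[of y UNIV "punctured_balls n M" "(n, k)"] by (simp add: punctured_balls_def)

lemma row_holomorphic_row_prod: "row_holomorphic n (\<lambda>y. row_prod n y powi a)"
  unfolding row_holomorphic_def
proof (intro allI sep_holomorphic_power_int)
  fix M
  show "sep_holomorphic (punctured_balls n M) (row_prod n)"
    unfolding row_prod_def by (intro sep_holomorphic_prod sep_holomorphic_coordinate)
  show "row_prod n y \<noteq> 0" if "y \<in> Pi UNIV (punctured_balls n M)" for y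
    using punctured_balls_nonzero[OF that] by (rule row_prod_nonzero)
qed

lemma continuous_on_torus_coordinate: "continuous_on (torus r V x) (\<lambda>y. y v)"
  by (rule continuous_on_subset[OF continuous_on_product_coordinates]) auto

section \<open>Holomorphy of the row functions and the dual eigenvalue equations\<close>

context
  fixes q :: real
  assumes q: "0 < q" "q < 1"
begin

lemma pairing_radius_independent:
  assumes "row_holomorphic n g" and "encloses n x r" "encloses n x s"
  shows "pairing q n r x g = pairing q n s x g"
  unfolding pairing_def by (rule torus_mean_radius_independent[OF q assms])

text \<open>The radii are kept fixed while row \<open>Suc n\<close> ranges over a disc inside all
  the circles; the integrated entries of row \<open>n\<close> are then freed by
  \<open>sep_holomorphic_ignore\<close>.\<close>

lemma sep_holomorphic_pairing:
  assumes g: "row_holomorphic n g" and M: "0 < M"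
    and r: "\<And>k. k \<in> {1..n} \<Longrightarrow> M < r (n, k) \<and> r (n, k) < M'"
  shows "sep_holomorphic (\<lambda>v. if v \<in> {Suc n} \<times> {1..Suc n} then ball 0 M else UNIV) (\<lambda>x. pairing q n r x g)"
proof -
  let ?F = "\<lambda>y. mb_kernel q n y * q_weight q n {} y * g y"
  have pos: "0 < r v" if "v \<in> set (row_indices n)" for v using that r M by force
  have "sep_holomorphic (annuli n M M') (torus_mean r (row_indices n) ?F)"
  proof (rule sep_holomorphic_torus_mean[OF sep_holomorphic_integrand[OF q g] open_annuli])
    fix v assume v: "v \<in> set (row_indices n)"
    then obtain k where "v = (n, k)" "k \<in> {1..n}" by auto
    then show "0 < r v \<and> sphere 0 (r v) \<subseteq> annuli n M M' v"
      using pos[OF v] r[of k] by (auto simp: annuli_def)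
  qed (use M in simp)
  then have "sep_holomorphic (\<lambda>v. if v \<in> {n} \<times> {1..n} then UNIV else annuli n M M' v) (torus_mean r (row_indices n) ?F)"
  proof (rule sep_holomorphic_ignore[where c = "\<lambda>v. of_real (r v)"])
    fix v :: "nat \<times> nat" assume v: "v \<in> {n} \<times> {1..n}"
    then obtain k where "v = (n, k)" "k \<in> {1..n}" by auto
    then show "complex_of_real (r v) \<in> annuli n M M' v"
      using pos[of v] v r[of k] by (auto simp: annuli_def)
  next
    fix x
    show "torus_mean r (row_indices n) ?F x = torus_mean r (row_indices n) ?F (\<lambda>v. if v \<in> {n} \<times> {1..n} then of_real (r v) else x v)"
      (is "_ = torus_mean r (row_indices n) ?F ?x")
    proof (rule torus_mean_cong)
      fix y y' assume y: "\<And>v. v \<in> set (row_indices n) \<Longrightarrow> y' v = y v \<and> norm (y v) = r v"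
        "\<And>v. v \<notin> set (row_indices n) \<Longrightarrow> y v = x v \<and> y' v = ?x v"
      have "y v = y' v" for v using y by (cases "v \<in> set (row_indices n)") simp_all
      then have "y = y'" by (rule ext)
      then show "?F y = ?F y'" by simp
    qed (use pos in \<open>auto intro: less_imp_le\<close>)
  qed
  then show ?thesis
    unfolding pairing_def by (rule sep_holomorphic_subset) (auto simp: annuli_def)
qed

text \<open>The radii in \<open>mb_psi\<close> vary with \<open>x\<close>, which hides the
  holomorphy. On entries of norm below \<open>M\<close> they can be replaced by the constant
  \<open>M + 1\<close> without changing the value.\<close>

lemma row_holomorphic_mb_psi: "row_holomorphic n (mb_psi q p n)"
proof (induction n)
  case 0
  show ?case by (simp add: row_holomorphic_def)
next
  case (Suc n)
  let ?g = "\<lambda>y. row_prod n y powi (- p (Suc n)) * mb_psi q p n y"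
  have g: "row_holomorphic n ?g"
    by (intro row_holomorphic_mult row_holomorphic_row_prod Suc)
  have "sep_holomorphic (punctured_balls (Suc n) M) (mb_psi q p (Suc n))" if M: "0 < M" for M
  proof -
    let ?r = "\<lambda>v. M + 1"
    have "sep_holomorphic (punctured_balls (Suc n) M)
        (\<lambda>x. row_prod (Suc n) x powi p (Suc n) * pairing q n ?r x ?g)"
    proof (rule sep_holomorphic_mult)
      show "sep_holomorphic (punctured_balls (Suc n) M) (\<lambda>x. row_prod (Suc n) x powi p (Suc n))"
        using row_holomorphic_row_prod[of "Suc n" "p (Suc n)"] by (simp add: row_holomorphic_def)
      show "sep_holomorphic (punctured_balls (Suc n) M) (\<lambda>x. pairing q n ?r x ?g)"
        by (rule sep_holomorphic_subset[OF sep_holomorphic_pairing[OF g M, of _ "M + 2"]])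
          (auto simp: punctured_balls_def)
    qed
    then show ?thesis
    proof (rule sep_holomorphic_cong)
      fix x assume x: "x \<in> Pi UNIV (punctured_balls (Suc n) M)"
      have "encloses n x ?r"
        unfolding encloses_def
      proof (intro ballI)
        fix m assume "m \<in> {1..Suc n}"
        then show "norm (x (Suc n, m)) < M + 1"
          using Pi_mem[OF x, of "(Suc n, m)"] by (auto simp: punctured_balls_def)
      qed
      from pairing_radius_independent[OF g this encloses_std_radius]
      show "row_prod (Suc n) x powi p (Suc n) * pairing q n ?r x ?g = mb_psi q p (Suc n) x"
        by simp
    qed
  qed
  then have "sep_holomorphic (punctured_balls (Suc n) (max M 1)) (mb_psi q p (Suc n))" for M
    by simp
  then have "sep_holomorphic (punctured_balls (Suc n) M) (mb_psi q p (Suc n))" for M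
    by (rule sep_holomorphic_subset[of "punctured_balls (Suc n) (max M 1)"])
      (auto simp: punctured_balls_def)
  then show ?case by (simp add: row_holomorphic_def)
qed

lemma row_holomorphic_twisted_psi:
  "row_holomorphic n (\<lambda>y. row_prod n y powi a * mb_psi q p n y)"
  by (intro row_holomorphic_mult row_holomorphic_row_prod row_holomorphic_mb_psi)

lemma mb_psi_Suc:
  assumes "encloses n x r"
  shows "mb_psi q p (Suc n) x = row_prod (Suc n) x powi p (Suc n) *
     pairing q n r x (\<lambda>y. row_prod n y powi (- p (Suc n)) * mb_psi q p n y)"
  using pairing_radius_independent[OF row_holomorphic_twisted_psi assms encloses_std_radius] by simp

lemma continuous_on_torus_coeffs:
  assumes r: "encloses n x r" "inj_on (\<lambda>k. r (n, k)) {1..n}" and J: "J \<subseteq> {1..n}"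
  shows "continuous_on (torus r ({n} \<times> {1..n}) x) (\<lambda>y. dual_coeff {1..n} (\<lambda>k. y (n, k)) J)"
    and "continuous_on (torus r ({n} \<times> {1..n}) x) (\<lambda>y. adjoint_coeff {1..n} (\<lambda>k. y (n, k)) J)"
proof -
  have ne: "y (n, i) - y (n, j) \<noteq> 0"
    if "y \<in> torus r ({n} \<times> {1..n}) x" "i \<in> {1..n}" "j \<in> {1..n}" "i \<noteq> j" for y i j
    using inj_onD[OF torus_row_distinct(1)[OF that(1) r], of i j] that by auto
  show "continuous_on (torus r ({n} \<times> {1..n}) x) (\<lambda>y. dual_coeff {1..n} (\<lambda>k. y (n, k)) J)"
    unfolding dual_coeff_def
  proof (intro continuous_on_prod continuous_on_divide continuous_on_diff continuous_on_torus_coordinate ballI)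
    fix i j y assume "i \<in> J" "j \<in> {1..n} - J" "y \<in> torus r ({n} \<times> {1..n}) x"
    then show "y (n, j) - y (n, i) \<noteq> 0" using J by (intro ne) auto
  qed
  show "continuous_on (torus r ({n} \<times> {1..n}) x) (\<lambda>y. adjoint_coeff {1..n} (\<lambda>k. y (n, k)) J)"
    unfolding adjoint_coeff_def
  proof (intro continuous_on_prod continuous_on_divide continuous_on_diff continuous_on_torus_coordinate ballI)
    fix i j y assume "i \<in> J" "j \<in> {1..n} - J" "y \<in> torus r ({n} \<times> {1..n}) x"
    then show "y (n, i) - y (n, j) \<noteq> 0" using J by (intro ne) auto
  qed
qed

lemma continuous_on_torus_factors:
  assumes r: "encloses n x r" and J: "J \<subseteq> {1..n}"
    and f: "\<And>m. continuous_on (torus r ({n} \<times> {1..n}) x) (\<lambda>y. f y m)"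
  shows "continuous_on (torus r ({n} \<times> {1..n}) x) (\<lambda>y. \<Prod>i\<in>J. \<Prod>m\<in>A. 1 - f y m / y (n, i))"
proof (intro continuous_on_prod continuous_on_divide continuous_on_diff continuous_on_const
    continuous_on_torus_coordinate f ballI)
  fix i y assume "i \<in> J" and y: "y \<in> torus r ({n} \<times> {1..n}) x"
  then have "i \<in> {1..n}" using J by auto
  then have "norm (y (n, i)) = r (n, i)" "0 < r (n, i)"
    using y encloses_pos[OF r] by (auto simp: torus_def)
  then show "y (n, i) \<noteq> 0" by auto
qed

lemma pairing_add:
  assumes "encloses n x r"
    and "continuous_on (torus r ({n} \<times> {1..n}) x) f" "continuous_on (torus r ({n} \<times> {1..n}) x) g"
  shows "pairing q n r x (\<lambda>y. f y + g y) = pairing q n r x f + pairing q n r x g"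
proof -
  have "continuous_on (torus r ({n} \<times> {1..n}) x) (if b then f else g)" for b
    using assms by simp
  then show ?thesis
    using pairing_sum[OF q, of UNIV n x r "\<lambda>b. if b then f else g"] assms(1)
    by (simp add: UNIV_bool add.commute)
qed

lemma dilate_encloses:
  assumes "encloses n x r" "0 \<le> c" "c \<le> 1"
  shows "encloses n (dilate c (Suc n) I x) r"
  unfolding encloses_def
proof (intro ballI)
  fix k m assume km: "k \<in> {1..n}" "m \<in> {1..Suc n}"
  have "norm (dilate c (Suc n) I x (Suc n, m)) \<le> norm (x (Suc n, m))"
    using assms by (simp add: norm_mult mult_left_le_one_le)
  also have "\<dots> < r (n, k)" using assms(1) km unfolding encloses_def by blast
  finally show "norm (dilate c (Suc n) I x (Suc n, m)) < r (n, k)" .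
qed

text \<open>
  The \<open>q\<close>-shifts of the top row act on the kernel alone, and \<open>dual_sum_eq_adjoint_sum\<close> together with
  \<open>pairing_adjoint\<close> turns them into the shifts of one order less acting on the function one row below.
\<close>

lemma dual_eigenvalue:
  assumes "inj_on (\<lambda>k. x (n, k)) {1..n}" "\<And>k. k \<in> {1..n} \<Longrightarrow> x (n, k) \<noteq> 0" "r \<le> n"
  shows "(\<Sum>I\<in>subsets_of_card {1..n} r. dual_coeff {1..n} (\<lambda>k. x (n, k)) I * mb_psi q p n (dilate q n I x)) =
    (\<Prod>i=Suc n - r..n. of_real q powi p i) * mb_psi q p n x"
  using assms
proof (induction n arbitrary: r x)
  case 0
  then show ?case by (simp add: subsets_of_card_0 dual_coeff_def)
next
  case (Suc n)
  show ?case
  proof (cases r)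
    case 0
    then show ?thesis by (simp add: subsets_of_card_0 dual_coeff_def)
  next
    case (Suc s)
    define \<rho> where "\<rho> = std_radius n x"
    have \<rho>: "encloses n x \<rho>" "inj_on (\<lambda>k. \<rho> (n, k)) {1..n}"
      unfolding \<rho>_def by (rule encloses_std_radius inj_std_radius)+
    define T where "T = torus \<rho> ({n} \<times> {1..n}) x"
    let ?A = "{1..Suc n}" and ?B = "{1..n}" and ?Q = "complex_of_real q"
    define a where "a = p (Suc n)"
    define P where "P = row_prod (Suc n) x"
    define g where "g = (\<lambda>y. row_prod n y powi (- a) * mb_psi q p n y)"
    define c where "c = (\<lambda>I. dual_coeff ?A (\<lambda>k. x (Suc n, k)) I)"
    define e where "e = (\<Prod>i=Suc n - s..n. ?Q powi p i)"
    have s: "s \<le> n" using Suc.prems(3) Suc by simp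
    have Q: "?Q \<noteq> 0" using q by simp
    have g: "row_holomorphic n g" unfolding g_def by (rule row_holomorphic_twisted_psi)
    have gT: "continuous_on T g"
      unfolding T_def by (rule row_holomorphic_continuous_on_torus[OF g \<rho>(1)])
    note distinct = torus_row_distinct[OF _ \<rho>, folded T_def]
    have shift: "mb_psi q p (Suc n) (dilate q (Suc n) I x) = (?Q ^ r * P) powi a *
        pairing q n \<rho> x (\<lambda>y. (\<Prod>i\<in>I. \<Prod>k\<in>?B. 1 - x (Suc n, i) / y (n, k)) * g y)"
      if I: "I \<in> subsets_of_card ?A r" for I
    proof -
      have I': "I \<subseteq> ?A" "card I = r" using I by (auto simp: subsets_of_card_def)
      have "pairing q n \<rho> x (\<lambda>y. (\<Prod>i\<in>I. \<Prod>k\<in>?B. 1 - x (Suc n, i) / y (n, k)) * g y) =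
          pairing q n \<rho> (dilate q (Suc n) I x) g"
      proof (rule pairing_transfer[OF \<rho>(1)])
        fix y y' assume y: "y \<in> torus \<rho> ({n} \<times> {1..n}) x"
          "y' \<in> torus \<rho> ({n} \<times> {1..n}) (dilate q (Suc n) I x)" "\<And>k. k \<in> {1..n} \<Longrightarrow> y' (n, k) = y (n, k)"
        have "mb_kernel q n y' = mb_kernel q n (dilate q (Suc n) I y)"
          using torus_row_Suc[OF y(1)] torus_row_Suc[OF y(2)]
          by (intro mb_kernel_agree) (simp_all add: y(3))
        also have "\<dots> = mb_kernel q n y * (\<Prod>i\<in>I. \<Prod>k\<in>?B. 1 - y (Suc n, i) / y (n, k))"
          using distinct(3)[of y] y(1) I' by (intro mb_kernel_dilate_Suc[OF q]) (auto simp: T_def)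
        also have "\<dots> = mb_kernel q n y * (\<Prod>i\<in>I. \<Prod>k\<in>?B. 1 - x (Suc n, i) / y (n, k))"
          by (simp add: torus_row_Suc[OF y(1)])
        finally have "mb_kernel q n y' = mb_kernel q n y * (\<Prod>i\<in>I. \<Prod>k\<in>?B. 1 - x (Suc n, i) / y (n, k))" .
        moreover have "g y' = g y"
          using mb_psi_agree[of n y' y q p] row_prod_agree[of n y' y] y(3) by (simp add: g_def)
        ultimately show "mb_kernel q n y * ((\<Prod>i\<in>I. \<Prod>k\<in>?B. 1 - x (Suc n, i) / y (n, k)) * g y) =
            mb_kernel q n y' * g y'" by (simp add: mult_ac)
      qed
      moreover have "encloses n (dilate q (Suc n) I x) \<rho>"
        using dilate_encloses[OF \<rho>(1)] q by simp
      ultimately show ?thesis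
        using mb_psi_Suc[of n "dilate q (Suc n) I x" \<rho> p] row_prod_dilate[OF I'(1), of q x]
        by (simp add: g_def a_def P_def I')
    qed
    have "(\<Sum>I\<in>subsets_of_card ?A r. c I * mb_psi q p (Suc n) (dilate q (Suc n) I x)) =
        (?Q ^ r * P) powi a * (\<Sum>I\<in>subsets_of_card ?A r. pairing q n \<rho> x
          (\<lambda>y. c I * ((\<Prod>i\<in>I. \<Prod>k\<in>?B. 1 - x (Suc n, i) / y (n, k)) * g y)))"
      unfolding sum_distrib_left pairing_cmult by (rule sum.cong[OF refl]) (simp add: shift mult_ac del: mb_psi.simps)
    also have "(\<Sum>I\<in>subsets_of_card ?A r. pairing q n \<rho> x
          (\<lambda>y. c I * ((\<Prod>i\<in>I. \<Prod>k\<in>?B. 1 - x (Suc n, i) / y (n, k)) * g y))) =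
        pairing q n \<rho> x (\<lambda>y. \<Sum>I\<in>subsets_of_card ?A r.
          c I * ((\<Prod>i\<in>I. \<Prod>k\<in>?B. 1 - x (Suc n, i) / y (n, k)) * g y))"
    proof (rule pairing_sum[symmetric, OF q _ \<rho>(1)], simp, fold T_def)
      fix I
      have "continuous_on T (\<lambda>y. \<Prod>i\<in>I. \<Prod>k\<in>?B. 1 - x (Suc n, i) / y (n, k))"
      proof (intro continuous_on_prod continuous_on_divide continuous_on_diff continuous_on_const ballI)
        fix k y assume "k \<in> ?B" "y \<in> T"
        then show "y (n, k) \<noteq> 0" by (intro distinct(2))
      qed (unfold T_def, rule continuous_on_torus_coordinate)
      with gT show "continuous_on T (\<lambda>y. c I * ((\<Prod>i\<in>I. \<Prod>k\<in>?B. 1 - x (Suc n, i) / y (n, k)) * g y))"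
        by (intro continuous_on_mult continuous_on_const)
    qed
    also have "\<dots> = pairing q n \<rho> x (\<lambda>y. \<Sum>J\<in>subsets_of_card ?B s.
        adjoint_coeff ?B (\<lambda>k. y (n, k)) J * (\<Prod>i\<in>J. \<Prod>m\<in>?A. 1 - y (Suc n, m) / y (n, i)) * g y)"
    proof (rule pairing_cong[OF \<rho>(1)], fold T_def)
      fix y assume y: "y \<in> T"
      have "dual_sum ?A ?B (\<lambda>k. x (Suc n, k)) (\<lambda>k. y (n, k)) (Suc s) =
          adjoint_sum ?A ?B (\<lambda>k. x (Suc n, k)) (\<lambda>k. y (n, k)) s"
      proof (rule dual_sum_eq_adjoint_sum)
        show "y (n, k) \<noteq> 0" if "k \<in> ?B" for k using distinct(2)[OF y that] .
        show "x (Suc n, m) \<noteq> y (n, k)" if "m \<in> ?A" "k \<in> ?B" for m k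
          using distinct(3)[OF y that(2,1)] distinct(4)[OF y] by simp
      qed (use Suc.prems(1) distinct(1)[OF y] in simp_all)
      then show "(\<Sum>I\<in>subsets_of_card ?A r. c I * ((\<Prod>i\<in>I. \<Prod>k\<in>?B. 1 - x (Suc n, i) / y (n, k)) * g y)) =
          (\<Sum>J\<in>subsets_of_card ?B s. adjoint_coeff ?B (\<lambda>k. y (n, k)) J *
            (\<Prod>i\<in>J. \<Prod>m\<in>?A. 1 - y (Suc n, m) / y (n, i)) * g y)"
        using distinct(4)[OF y]
        by (simp add: dual_sum_def adjoint_sum_def c_def Suc mult.assoc[symmetric] sum_distrib_right[symmetric])
    qed
    also have "\<dots> = (\<Sum>J\<in>subsets_of_card ?B s. pairing q n \<rho> x (\<lambda>y.
        adjoint_coeff ?B (\<lambda>k. y (n, k)) J * (\<Prod>i\<in>J. \<Prod>m\<in>?A. 1 - y (Suc n, m) / y (n, i)) * g y))"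
    proof (rule pairing_sum[OF q _ \<rho>(1)], simp, fold T_def)
      fix J assume "J \<in> subsets_of_card ?B s"
      then have J: "J \<subseteq> ?B" by (simp add: subsets_of_card_def)
      show "continuous_on T (\<lambda>y. adjoint_coeff ?B (\<lambda>k. y (n, k)) J *
          (\<Prod>i\<in>J. \<Prod>m\<in>?A. 1 - y (Suc n, m) / y (n, i)) * g y)"
        using gT unfolding T_def
        by (intro continuous_on_mult continuous_on_torus_coeffs[OF \<rho> J] continuous_on_torus_factors[OF \<rho>(1) J]
            continuous_on_torus_coordinate)
    qed
    also have "\<dots> = (\<Sum>J\<in>subsets_of_card ?B s. pairing q n \<rho> x (\<lambda>y.
        dual_coeff ?B (\<lambda>k. y (n, k)) J * g (dilate q n J y)))"
      by (rule sum.cong[OF refl], rule pairing_adjoint[OF q g \<rho>, symmetric]) (simp add: subsets_of_card_def)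
    also have "\<dots> = pairing q n \<rho> x (\<lambda>y. \<Sum>J\<in>subsets_of_card ?B s.
        dual_coeff ?B (\<lambda>k. y (n, k)) J * g (dilate q n J y))"
    proof (rule pairing_sum[symmetric, OF q _ \<rho>(1)], simp, fold T_def)
      fix J assume "J \<in> subsets_of_card ?B s"
      then have J: "J \<subseteq> ?B" by (simp add: subsets_of_card_def)
      show "continuous_on T (\<lambda>y. dual_coeff ?B (\<lambda>k. y (n, k)) J * g (dilate q n J y))"
        unfolding T_def
        by (intro continuous_on_mult continuous_on_torus_coeffs[OF \<rho> J]
            row_holomorphic_continuous_on_torus[OF _ \<rho>(1)] row_holomorphic_dilate[OF q g])
    qed
    \<comment> \<open>The twist by \<open>row_prod n y powi (- a)\<close> contributes
      \<open>q\<close> to the power \<open>- a * s\<close>, as \<open>card J = s\<close>. Against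
      \<open>q\<close> to the power \<open>a * r\<close> from the top row, with
      \<open>r = Suc s\<close>, exactly \<open>q powi a\<close> will remain: the new factor of the
      eigenvalue.\<close>
    also have "\<dots> = pairing q n \<rho> x (\<lambda>y. (?Q ^ s) powi (- a) * e * g y)"
    proof (rule pairing_cong[OF \<rho>(1)], fold T_def)
      fix y assume y: "y \<in> T"
      have "dual_coeff ?B (\<lambda>k. y (n, k)) J * g (dilate q n J y) =
          (?Q ^ s) powi (- a) * row_prod n y powi (- a) *
          (dual_coeff ?B (\<lambda>k. y (n, k)) J * mb_psi q p n (dilate q n J y))"
        if "J \<in> subsets_of_card ?B s" for J
        using that row_prod_dilate[of J n q y]
        by (simp add: g_def subsets_of_card_def power_int_mult_distrib)
      then have "(\<Sum>J\<in>subsets_of_card ?B s. dual_coeff ?B (\<lambda>k. y (n, k)) J * g (dilate q n J y)) =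
          (?Q ^ s) powi (- a) * row_prod n y powi (- a) *
          (\<Sum>J\<in>subsets_of_card ?B s. dual_coeff ?B (\<lambda>k. y (n, k)) J * mb_psi q p n (dilate q n J y))"
        unfolding sum_distrib_left by (rule sum.cong[OF refl])
      also have "(\<Sum>J\<in>subsets_of_card ?B s. dual_coeff ?B (\<lambda>k. y (n, k)) J * mb_psi q p n (dilate q n J y)) =
          e * mb_psi q p n y"
        unfolding e_def using distinct(1)[OF y] distinct(2)[OF y] s by (rule Suc.IH)
      finally show "(\<Sum>J\<in>subsets_of_card ?B s. dual_coeff ?B (\<lambda>k. y (n, k)) J * g (dilate q n J y)) =
          (?Q ^ s) powi (- a) * e * g y"
        by (simp add: g_def)
    qed
    also have "\<dots> = (?Q ^ s) powi (- a) * e * pairing q n \<rho> x g"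
      by (rule pairing_cmult)
    also have "(?Q ^ r * P) powi a * ((?Q ^ s) powi (- a) * e * pairing q n \<rho> x g) =
        (?Q powi a * e) * (P powi a * pairing q n \<rho> x g)"
      using Q by (simp add: Suc power_int_mult_distrib power_int_minus field_simps)
    also have "?Q powi a * e = (\<Prod>i=Suc (Suc n) - r..Suc n. ?Q powi p i)"
    proof -
      have "{Suc n - s..Suc n} = insert (Suc n) {Suc n - s..n}" by auto
      then show ?thesis by (simp add: e_def a_def Suc)
    qed
    also have "P powi a * pairing q n \<rho> x g = mb_psi q p (Suc n) x"
      unfolding P_def a_def g_def by (rule mb_psi_Suc[OF \<rho>(1), symmetric])
    finally show ?thesis by (simp only: c_def)
  qed
qed

end

section \<open>The Toda eigenvalue equation\<close>

text \<open>The exponent with the Kronecker delta, read off the set: the factor of \<open>i\<close>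
  is absent precisely when its successor is raised as well. The last index always has factor
  1.\<close>

definition toda_coeff :: "real \<Rightarrow> nat \<Rightarrow> (nat \<Rightarrow> int) \<Rightarrow> nat set \<Rightarrow> complex" where
  "toda_coeff q n p I =
    (\<Prod>i\<in>I. if i = n \<or> Suc i \<in> I then 1 else 1 - of_real q powi (p i - p (Suc i) + 1))"

definition raise :: "nat set \<Rightarrow> (nat \<Rightarrow> int) \<Rightarrow> nat \<Rightarrow> int" where
  "raise I p = (\<lambda>i. if i \<in> I then p i + 1 else p i)"

lemma raise_empty [simp]: "raise {} p = p"
  by (simp add: raise_def)

text \<open>Lengthening the chain ends the exemption of \<open>n\<close> as last index; if
  \<open>Suc n\<close> is raised too, \<open>n\<close> becomes exempt again as its
  neighbour.\<close>

lemma toda_coeff_Suc: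
  assumes "I \<subseteq> {1..n}"
  shows "toda_coeff q (Suc n) p I =
      (if n \<in> I then 1 - of_real q powi (p n - p (Suc n) + 1) else 1) * toda_coeff q n p I"
    and "toda_coeff q (Suc n) p (insert (Suc n) I) = toda_coeff q n p I"
proof -
  have fin: "finite I" using assms finite_subset by blast
  have notin: "Suc n \<notin> I" using assms by auto
  let ?f = "\<lambda>i. if i = n \<or> Suc i \<in> I then 1 else 1 - complex_of_real q powi (p i - p (Suc i) + 1)"
  let ?c = "1 - complex_of_real q powi (p n - p (Suc n) + 1)"
  have "toda_coeff q (Suc n) p I = (\<Prod>i\<in>I. (if i = n then ?c else 1) * ?f i)"
    unfolding toda_coeff_def using notin by (intro prod.cong) auto
  also have "\<dots> = (\<Prod>i\<in>I. if i = n then ?c else 1) * toda_coeff q n p I"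
    unfolding toda_coeff_def by (rule prod.distrib)
  also have "(\<Prod>i\<in>I. if i = n then ?c else 1) = (if n \<in> I then ?c else 1)"
    using fin by (simp add: prod.delta)
  finally show "toda_coeff q (Suc n) p I = (if n \<in> I then ?c else 1) * toda_coeff q n p I" .
  have "toda_coeff q (Suc n) p (insert (Suc n) I) =
      (\<Prod>i\<in>I. if i = Suc n \<or> Suc i \<in> insert (Suc n) I then 1 else 1 - of_real q powi (p i - p (Suc i) + 1))"
    unfolding toda_coeff_def using fin notin by (subst prod.insert) auto
  also have "\<dots> = toda_coeff q n p I"
    unfolding toda_coeff_def using notin by (intro prod.cong) auto
  finally show "toda_coeff q (Suc n) p (insert (Suc n) I) = toda_coeff q n p I" .
qed

lemma elem_sym_cong:
  assumes "\<And>i. i \<in> A \<Longrightarrow> x i = y i"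
  shows "elem_sym A r x = elem_sym A r y"
  unfolding elem_sym_def
  by (intro sum.cong prod.cong refl) (auto simp: subsets_of_card_def intro: assms)

lemma elem_sym_dilate:
  assumes "i \<in> {1..n}"
  shows "elem_sym {1..n} (Suc r) (\<lambda>k. dilate c n {i} y (n, k)) = elem_sym {1..n} (Suc r) (\<lambda>k. y (n, k)) +
    (of_real c - 1) * y (n, i) * elem_sym ({1..n} - {i}) r (\<lambda>k. y (n, k))"
proof -
  have split: "{1..n} = insert i ({1..n} - {i})" using assms by auto
  have "elem_sym ({1..n} - {i}) r' (\<lambda>k. dilate c n {i} y (n, k)) = elem_sym ({1..n} - {i}) r' (\<lambda>k. y (n, k))" for r'
    by (rule elem_sym_cong) auto
  moreover have "elem_sym {1..n} (Suc r) f = elem_sym ({1..n} - {i}) (Suc r) f + f i * elem_sym ({1..n} - {i}) r f" for f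
    by (subst split, subst elem_sym_insert) auto
  ultimately show ?thesis by (simp add: algebra_simps)
qed

lemma subsets_of_card_1: "subsets_of_card A (Suc 0) = (\<lambda>i. {i}) ` A"
  by (auto simp: subsets_of_card_def card_1_singleton_iff)

context
  fixes q :: real
  assumes q: "0 < q" "q < 1"
begin

lemma dual_eigenvalue_1:
  assumes "inj_on (\<lambda>k. y (n, k)) {1..n}" "\<And>k. k \<in> {1..n} \<Longrightarrow> y (n, k) \<noteq> 0" "1 \<le> n"
  shows "(\<Sum>i\<in>{1..n}. dual_coeff {1..n} (\<lambda>k. y (n, k)) {i} * mb_psi q p n (dilate q n {i} y)) =
    of_real q powi p n * mb_psi q p n y"
proof -
  have "(\<Sum>i\<in>{1..n}. dual_coeff {1..n} (\<lambda>k. y (n, k)) {i} * mb_psi q p n (dilate q n {i} y)) =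
      (\<Sum>I\<in>subsets_of_card {1..n} 1. dual_coeff {1..n} (\<lambda>k. y (n, k)) I * mb_psi q p n (dilate q n I y))"
    by (simp add: subsets_of_card_1 sum.reindex)
  also have "\<dots> = (\<Prod>i=Suc n - 1..n. of_real q powi p i) * mb_psi q p n y"
    by (rule dual_eigenvalue[OF q assms])
  finally show ?thesis by simp
qed

text \<open>
  The terms of the Toda equation that raise \<open>p n\<close> are isolated by commuting the first dual operator,
  with eigenvalue \<open>q powi p n\<close>, past the multiplication by \<open>elem_sym\<close>.
\<close>

lemma toda_terms_raising_last:
  assumes toda: "\<And>x. (\<And>k. k \<in> {1..n} \<Longrightarrow> x (n, k) \<noteq> 0) \<Longrightarrow>
      (\<Sum>I\<in>subsets_of_card {1..n} (Suc s). toda_coeff q n p I * mb_psi q (raise I p) n x) =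
      elem_sym {1..n} (Suc s) (\<lambda>k. x (n, k)) * mb_psi q p n x"
    and y: "inj_on (\<lambda>k. y (n, k)) {1..n}" "\<And>k. k \<in> {1..n} \<Longrightarrow> y (n, k) \<noteq> 0"
  shows "of_real q powi p n * (\<Sum>I\<in>subsets_of_card {1..n} (Suc s). if n \<in> I then toda_coeff q n p I * mb_psi q (raise I p) n y else 0) =
    (\<Sum>i\<in>{1..n}. dual_coeff {1..n} (\<lambda>k. y (n, k)) {i} *
      (y (n, i) * elem_sym ({1..n} - {i}) s (\<lambda>k. y (n, k)) * mb_psi q p n (dilate q n {i} y)))"
    (is "?Q powi p n * ?B = ?R")
proof (cases "n = 0")
  case True
  then show ?thesis by (simp add: subsets_of_card_empty)
next
  case False
  let ?N = "{1..n}" and ?S = "subsets_of_card {1..n} (Suc s)"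
  let ?d = "\<lambda>i. dual_coeff ?N (\<lambda>k. y (n, k)) {i}"
  let ?e = "\<lambda>x. elem_sym ?N (Suc s) (\<lambda>k. x (n, k))"
  have n: "1 \<le> n" using False by simp
  have D: "(\<Sum>i\<in>?N. ?d i * mb_psi q p' n (dilate q n {i} y)) = ?Q powi p' n * mb_psi q p' n y" for p'
    by (rule dual_eigenvalue_1[OF y(1) _ n]) (rule y(2))
  have toda_y: "(\<Sum>I\<in>?S. toda_coeff q n p I * mb_psi q (raise I p) n y) = ?e y * mb_psi q p n y"
    by (rule toda) (rule y(2))
  have Qne: "?Q \<noteq> 0" "?Q - 1 \<noteq> 0" using q by auto
  have "(\<Sum>i\<in>?N. ?d i * (?e (dilate q n {i} y) * mb_psi q p n (dilate q n {i} y))) =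
      (\<Sum>i\<in>?N. \<Sum>I\<in>?S. toda_coeff q n p I * (?d i * mb_psi q (raise I p) n (dilate q n {i} y)))"
  proof (rule sum.cong[OF refl])
    fix i assume i: "i \<in> ?N"
    have "?e (dilate q n {i} y) * mb_psi q p n (dilate q n {i} y) =
        (\<Sum>I\<in>?S. toda_coeff q n p I * mb_psi q (raise I p) n (dilate q n {i} y))"
      by (rule toda[symmetric]) (use y Qne in auto)
    then show "?d i * (?e (dilate q n {i} y) * mb_psi q p n (dilate q n {i} y)) =
        (\<Sum>I\<in>?S. toda_coeff q n p I * (?d i * mb_psi q (raise I p) n (dilate q n {i} y)))"
      by (simp only: sum_distrib_left mult_ac)
  qed
  \<comment> \<open>First evaluation: the dual operator is applied to each term of the Toda
    equation. Its eigenvalue gains a factor \<open>q\<close> exactly when \<open>n\<close> is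
    raised, so those terms are marked by a surplus \<open>(q - 1) * q powi p n\<close>.\<close>
  also have "\<dots> = (\<Sum>I\<in>?S. toda_coeff q n p I * (?Q powi raise I p n * mb_psi q (raise I p) n y))"
    by (subst sum.swap) (simp only: sum_distrib_left[symmetric] D)
  also have "\<dots> = (\<Sum>I\<in>?S. ?Q powi p n * (toda_coeff q n p I * mb_psi q (raise I p) n y) +
      (?Q - 1) * ?Q powi p n * (if n \<in> I then toda_coeff q n p I * mb_psi q (raise I p) n y else 0))"
    by (rule sum.cong[OF refl]) (use Qne in \<open>auto simp: raise_def power_int_add algebra_simps\<close>)
  also have "\<dots> = ?Q powi p n * (?e y * mb_psi q p n y) + (?Q - 1) * ?Q powi p n * ?B"
    unfolding sum.distrib sum_distrib_left[symmetric] toda_y by simp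
  finally have 1: "(\<Sum>i\<in>?N. ?d i * (?e (dilate q n {i} y) * mb_psi q p n (dilate q n {i} y))) =
      ?Q powi p n * (?e y * mb_psi q p n y) + (?Q - 1) * ?Q powi p n * ?B" .
  \<comment> \<open>Second evaluation of the same sum: scaling one variable changes
    \<open>elem_sym\<close> by \<open>q - 1\<close> times the part containing that variable.
    Comparison of the surpluses and division by \<open>q - 1\<close> give the claim.\<close>
  have "(\<Sum>i\<in>?N. ?d i * (?e (dilate q n {i} y) * mb_psi q p n (dilate q n {i} y))) =
      (\<Sum>i\<in>?N. ?e y * (?d i * mb_psi q p n (dilate q n {i} y)) + (?Q - 1) *
        (?d i * (y (n, i) * elem_sym (?N - {i}) s (\<lambda>k. y (n, k)) * mb_psi q p n (dilate q n {i} y))))"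
    by (rule sum.cong[OF refl], subst elem_sym_dilate) (simp_all add: algebra_simps)
  also have "\<dots> = ?e y * (?Q powi p n * mb_psi q p n y) + (?Q - 1) * ?R"
    unfolding sum.distrib sum_distrib_left[symmetric] D by simp
  finally have "(?Q - 1) * (?Q powi p n * ?B) = (?Q - 1) * ?R"
    unfolding 1 by algebra
  then show ?thesis using Qne(2) by simp
qed

text \<open>Sets without \<open>Suc n\<close> yield the order \<open>r\<close> equation one row
  below plus a correction, which the adjoint formula turns into a multiplier of the kernel; sets
  with \<open>Suc n\<close> yield the order \<open>r - 1\<close> equation. The three multipliers add
  up to the eigenvalue by \<open>elem_sym_kernel_identity\<close>.\<close>

lemma toda_eigenvalue:
  assumes "\<And>k. k \<in> {1..n} \<Longrightarrow> x (n, k) \<noteq> 0"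
  shows "(\<Sum>I\<in>subsets_of_card {1..n} r. toda_coeff q n p I * mb_psi q (raise I p) n x) =
    elem_sym {1..n} r (\<lambda>k. x (n, k)) * mb_psi q p n x"
  using assms
proof (induction n arbitrary: r p x)
  case 0
  show ?case
    by (cases r) (simp_all add: subsets_of_card_0 subsets_of_card_empty elem_sym_def toda_coeff_def)
next
  case (Suc n)
  show ?case
  proof (cases r)
    case 0
    then show ?thesis by (simp add: subsets_of_card_0 toda_coeff_def)
  next
    case (Suc s)
    define \<rho> where "\<rho> = std_radius n x"
    have \<rho>: "encloses n x \<rho>" "inj_on (\<lambda>k. \<rho> (n, k)) {1..n}"
      unfolding \<rho>_def by (rule encloses_std_radius inj_std_radius)+
    define T where "T = torus \<rho> ({n} \<times> {1..n}) x"
    let ?A = "{1..Suc n}" and ?B = "{1..n}" and ?Q = "complex_of_real q"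
    let ?S = "subsets_of_card {1..n} (Suc s)" and ?S' = "subsets_of_card {1..n} s"
    define a where "a = p (Suc n)"
    define P where "P = row_prod (Suc n) x"
    define g where "g = (\<lambda>y. row_prod n y powi (- a) * mb_psi q p n y)"
    define e where "e = (\<lambda>r y. elem_sym ?B r (\<lambda>k. y (n, k)))"
    define e' where "e' = (\<lambda>i y. y (n, i) * elem_sym (?B - {i}) s (\<lambda>k. y (n, k)))"
    define d where "d = (\<lambda>i y. dual_coeff ?B (\<lambda>k. y (n, k)) {i})"
    define d' where "d' = (\<lambda>i y. adjoint_coeff ?B (\<lambda>k. y (n, k)) {i} *
        (\<Prod>j\<in>{i}. \<Prod>m\<in>?A. 1 - y (Suc n, m) / y (n, j)))"
    have P: "P \<noteq> 0" unfolding P_def by (rule row_prod_nonzero) (rule Suc.prems)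
    have Q: "?Q \<noteq> 0" using q by simp
    have g: "row_holomorphic n g" unfolding g_def by (rule row_holomorphic_twisted_psi[OF q])
    have e: "row_holomorphic n (e r)" for r
      unfolding e_def by (rule row_holomorphic_elem_sym)
    have e'g: "row_holomorphic n (\<lambda>y. e' i y * g y)" for i
      unfolding e'_def by (intro row_holomorphic_mult g row_holomorphic_elem_sym row_holomorphic_coordinate)
    note contT = row_holomorphic_continuous_on_torus[OF _ \<rho>(1), folded T_def]
    note distinct = torus_row_distinct[OF _ \<rho>, folded T_def]
    have psi: "mb_psi q p' (Suc n) x = P powi p' (Suc n) *
        pairing q n \<rho> x (\<lambda>y. row_prod n y powi (- p' (Suc n)) * mb_psi q p' n y)" for p'
      unfolding P_def by (rule mb_psi_Suc[OF q \<rho>(1)])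
    have cont_psi: "continuous_on T (\<lambda>y. row_prod n y powi b * mb_psi q p' n y)" for b p'
      by (intro contT row_holomorphic_twisted_psi[OF q])
    have sum1: "(\<Sum>I\<in>?S. toda_coeff q (Suc n) p I * mb_psi q (raise I p) (Suc n) x) =
        P powi a * (pairing q n \<rho> x (\<lambda>y. e (Suc s) y * g y) -
          (\<Sum>i\<in>?B. pairing q n \<rho> x (\<lambda>y. d' i y * (e' i y * g y))))"
    proof -
      have "(\<Sum>I\<in>?S. toda_coeff q (Suc n) p I * mb_psi q (raise I p) (Suc n) x) =
          P powi a * (\<Sum>I\<in>?S. pairing q n \<rho> x (\<lambda>y. toda_coeff q (Suc n) p I *
            (row_prod n y powi (- a) * mb_psi q (raise I p) n y)))"
        unfolding sum_distrib_left pairing_cmult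
      proof (rule sum.cong[OF refl])
        fix I assume "I \<in> ?S"
        then have "Suc n \<notin> I" by (auto simp: subsets_of_card_def)
        then have "raise I p (Suc n) = a" by (simp add: raise_def a_def)
        then show "toda_coeff q (Suc n) p I * mb_psi q (raise I p) (Suc n) x =
            P powi a * (toda_coeff q (Suc n) p I *
              pairing q n \<rho> x (\<lambda>y. row_prod n y powi (- a) * mb_psi q (raise I p) n y))"
          unfolding psi by simp
      qed
      also have "(\<Sum>I\<in>?S. pairing q n \<rho> x (\<lambda>y. toda_coeff q (Suc n) p I *
            (row_prod n y powi (- a) * mb_psi q (raise I p) n y))) =
          pairing q n \<rho> x (\<lambda>y. \<Sum>I\<in>?S. toda_coeff q (Suc n) p I *
            (row_prod n y powi (- a) * mb_psi q (raise I p) n y))"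
        by (rule pairing_sum[symmetric, OF q _ \<rho>(1)], simp, fold T_def)
          (intro continuous_on_mult continuous_on_const cont_psi)
      also have "\<dots> = pairing q n \<rho> x (\<lambda>y. e (Suc s) y * g y +
          (\<Sum>i\<in>?B. -1 * (d i y * (e' i (dilate q n {i} y) * g (dilate q n {i} y)))))"
      proof (rule pairing_cong[OF \<rho>(1)], fold T_def)
        fix y assume y: "y \<in> T"
        have IH: "(\<Sum>I\<in>?S. toda_coeff q n p I * mb_psi q (raise I p) n y) = e (Suc s) y * mb_psi q p n y"
          unfolding e_def by (rule Suc.IH) (rule distinct(2)[OF y])
        let ?c = "?Q powi (p n - a + 1)" and ?R = "row_prod n y powi (- a)"
        have coeff: "toda_coeff q (Suc n) p I * (?R * mb_psi q (raise I p) n y) =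
            ?R * (toda_coeff q n p I * mb_psi q (raise I p) n y) -
            ?R * ?c * (if n \<in> I then toda_coeff q n p I * mb_psi q (raise I p) n y else 0)"
          if "I \<in> ?S" for I
          using that toda_coeff_Suc(1)[of I n q p]
          by (simp add: subsets_of_card_def a_def algebra_simps)
        have "(\<Sum>I\<in>?S. toda_coeff q (Suc n) p I * (?R * mb_psi q (raise I p) n y)) =
            (\<Sum>I\<in>?S. ?R * (toda_coeff q n p I * mb_psi q (raise I p) n y) -
            ?R * ?c * (if n \<in> I then toda_coeff q n p I * mb_psi q (raise I p) n y else 0))"
          by (rule sum.cong[OF refl coeff])
        also have "\<dots> = ?R * (e (Suc s) y * mb_psi q p n y) -
            ?R * ?Q powi (1 - a) * (?Q powi p n *
              (\<Sum>I\<in>?S. if n \<in> I then toda_coeff q n p I * mb_psi q (raise I p) n y else 0))"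
        proof -
          have "?c = ?Q powi (1 - a) * ?Q powi p n"
            using Q by (simp flip: power_int_add add: algebra_simps)
          then show ?thesis
            unfolding sum_subtractf sum_distrib_left[symmetric] IH by (simp only: mult_ac)
        qed
        also have "?Q powi p n *
              (\<Sum>I\<in>?S. if n \<in> I then toda_coeff q n p I * mb_psi q (raise I p) n y else 0) =
            (\<Sum>i\<in>?B. d i y * (e' i y * mb_psi q p n (dilate q n {i} y)))"
          unfolding d_def e'_def
          by (rule toda_terms_raising_last[OF Suc.IH distinct(1,2)[OF y]])
        \<comment> \<open>The remaining \<open>?Q powi (1 - a)\<close> is absorbed by the dilation:
          \<open>q\<close> from the linear factor of \<open>e' i\<close>, and
          \<open>?Q powi (- a)\<close> from the twist in \<open>g\<close>. Thus the correction is a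
          sum of dual shifts of \<open>e' i * g\<close>, ready for
          \<open>pairing_adjoint\<close>.\<close>
        also have "?R * ?Q powi (1 - a) * (\<Sum>i\<in>?B. d i y * (e' i y * mb_psi q p n (dilate q n {i} y))) =
            (\<Sum>i\<in>?B. d i y * (e' i (dilate q n {i} y) * g (dilate q n {i} y)))"
          unfolding sum_distrib_left
        proof (rule sum.cong[OF refl])
          fix i assume i: "i \<in> ?B"
          have "elem_sym (?B - {i}) s (\<lambda>k. dilate q n {i} y (n, k)) = elem_sym (?B - {i}) s (\<lambda>k. y (n, k))"
            by (rule elem_sym_cong) auto
          then have "e' i (dilate q n {i} y) = ?Q * e' i y"
            by (simp add: e'_def)
          moreover have "row_prod n (dilate q n {i} y) = ?Q * row_prod n y"
            using row_prod_dilate[of "{i}" n q y] i by simp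
          moreover have "?Q powi (1 - a) = ?Q * ?Q powi (- a)"
            using Q by (simp add: power_int_diff power_int_minus field_simps)
          ultimately show "?R * ?Q powi (1 - a) * (d i y * (e' i y * mb_psi q p n (dilate q n {i} y))) =
              d i y * (e' i (dilate q n {i} y) * g (dilate q n {i} y))"
            by (simp add: g_def power_int_mult_distrib)
        qed
        finally show "(\<Sum>I\<in>?S. toda_coeff q (Suc n) p I * (?R * mb_psi q (raise I p) n y)) =
            e (Suc s) y * g y + (\<Sum>i\<in>?B. -1 * (d i y * (e' i (dilate q n {i} y) * g (dilate q n {i} y))))"
          by (simp add: g_def sum_negf mult_ac)
      qed
      also have "\<dots> = pairing q n \<rho> x (\<lambda>y. e (Suc s) y * g y) +
          pairing q n \<rho> x (\<lambda>y. \<Sum>i\<in>?B. -1 * (d i y * (e' i (dilate q n {i} y) * g (dilate q n {i} y))))"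
      proof (rule pairing_add[OF q \<rho>(1)], fold T_def)
        show "continuous_on T (\<lambda>y. e (Suc s) y * g y)"
          by (intro contT row_holomorphic_mult e g)
        show "continuous_on T (\<lambda>y. \<Sum>i\<in>?B. -1 * (d i y * (e' i (dilate q n {i} y) * g (dilate q n {i} y))))"
          unfolding d_def using continuous_on_torus_coeffs(1)[OF q \<rho>, folded T_def]
          by (intro continuous_on_sum continuous_on_mult continuous_on_const
              contT[OF row_holomorphic_dilate[OF q e'g]]) auto
      qed
      also have "pairing q n \<rho> x (\<lambda>y. \<Sum>i\<in>?B. -1 * (d i y * (e' i (dilate q n {i} y) * g (dilate q n {i} y)))) =
          (\<Sum>i\<in>?B. -1 * pairing q n \<rho> x (\<lambda>y. d i y * (e' i (dilate q n {i} y) * g (dilate q n {i} y))))"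
        unfolding pairing_cmult[symmetric]
      proof (rule pairing_sum[OF q _ \<rho>(1)], simp, fold T_def)
        fix i assume "i \<in> ?B"
        then show "continuous_on T (\<lambda>y. -1 * (d i y * (e' i (dilate q n {i} y) * g (dilate q n {i} y))))"
          unfolding d_def using continuous_on_torus_coeffs(1)[OF q \<rho>, folded T_def]
          by (intro continuous_on_mult continuous_on_const
              contT[OF row_holomorphic_dilate[OF q e'g]]) auto
      qed
      also have "\<dots> = (\<Sum>i\<in>?B. -1 * pairing q n \<rho> x (\<lambda>y. d' i y * (e' i y * g y)))"
      proof (rule sum.cong[OF refl])
        fix i assume "i \<in> ?B"
        then show "-1 * pairing q n \<rho> x (\<lambda>y. d i y * (e' i (dilate q n {i} y) * g (dilate q n {i} y))) =
            -1 * pairing q n \<rho> x (\<lambda>y. d' i y * (e' i y * g y))"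
          using pairing_adjoint[OF q e'g \<rho>, of "{i}" i] unfolding d_def d'_def by simp
      qed
      finally show ?thesis by (simp add: sum_negf)
    qed
    \<comment> \<open>Raising \<open>p (Suc n)\<close> replaces \<open>P powi a\<close> by
      \<open>P powi (a + 1)\<close> and the twist exponent \<open>- a\<close> by
      \<open>- (a + 1)\<close>, which produces the quotient of the row products.\<close>
    have sum2: "(\<Sum>I\<in>{I. I \<subseteq> ?B \<and> Suc (card I) = Suc s}.
          toda_coeff q (Suc n) p (insert (Suc n) I) * mb_psi q (raise (insert (Suc n) I) p) (Suc n) x) =
        P powi a * pairing q n \<rho> x (\<lambda>y. P / row_prod n y * e s y * g y)"
    proof -
      have "(\<Sum>I\<in>{I. I \<subseteq> ?B \<and> Suc (card I) = Suc s}.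
          toda_coeff q (Suc n) p (insert (Suc n) I) * mb_psi q (raise (insert (Suc n) I) p) (Suc n) x) =
          P powi a * (\<Sum>I\<in>?S'. pairing q n \<rho> x (\<lambda>y. (P * toda_coeff q n p I) *
            (row_prod n y powi (- (a + 1)) * mb_psi q (raise I p) n y)))"
        unfolding sum_distrib_left pairing_cmult
      proof (rule sum.cong)
        show "{I. I \<subseteq> ?B \<and> Suc (card I) = Suc s} = ?S'" by (simp add: subsets_of_card_def)
        fix I assume "I \<in> ?S'"
        then have I: "I \<subseteq> ?B" by (simp add: subsets_of_card_def)
        have "raise (insert (Suc n) I) p (Suc n) = a + 1" by (simp add: raise_def a_def)
        moreover have "mb_psi q (raise (insert (Suc n) I) p) n = mb_psi q (raise I p) n"
          by (rule mb_psi_cong) (auto simp: raise_def)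
        moreover have "P powi (a + 1) = P powi a * P" using P by (simp add: power_int_add)
        ultimately show "toda_coeff q (Suc n) p (insert (Suc n) I) * mb_psi q (raise (insert (Suc n) I) p) (Suc n) x =
            P powi a * (P * toda_coeff q n p I *
              pairing q n \<rho> x (\<lambda>y. row_prod n y powi (- (a + 1)) * mb_psi q (raise I p) n y))"
          unfolding psi toda_coeff_Suc(2)[OF I] by simp
      qed
      also have "(\<Sum>I\<in>?S'. pairing q n \<rho> x (\<lambda>y. (P * toda_coeff q n p I) *
            (row_prod n y powi (- (a + 1)) * mb_psi q (raise I p) n y))) =
          pairing q n \<rho> x (\<lambda>y. \<Sum>I\<in>?S'. (P * toda_coeff q n p I) *
            (row_prod n y powi (- (a + 1)) * mb_psi q (raise I p) n y))"
        by (rule pairing_sum[symmetric, OF q _ \<rho>(1)], simp, fold T_def)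
          (intro continuous_on_mult continuous_on_const cont_psi)
      also have "\<dots> = pairing q n \<rho> x (\<lambda>y. P / row_prod n y * e s y * g y)"
      proof (rule pairing_cong[OF \<rho>(1)], fold T_def)
        fix y assume y: "y \<in> T"
        have R: "row_prod n y \<noteq> 0" by (rule row_prod_nonzero) (rule distinct(2)[OF y])
        have "(\<Sum>I\<in>?S'. (P * toda_coeff q n p I) *
            (row_prod n y powi (- (a + 1)) * mb_psi q (raise I p) n y)) =
            P * row_prod n y powi (- (a + 1)) * (\<Sum>I\<in>?S'. toda_coeff q n p I * mb_psi q (raise I p) n y)"
          by (simp only: sum_distrib_left mult_ac)
        also have "(\<Sum>I\<in>?S'. toda_coeff q n p I * mb_psi q (raise I p) n y) = e s y * mb_psi q p n y"
          unfolding e_def by (rule Suc.IH) (rule distinct(2)[OF y])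
        also have "P * row_prod n y powi (- (a + 1)) * (e s y * mb_psi q p n y) =
            P / row_prod n y * e s y * g y"
          using R power_int_diff[of "row_prod n y" "- a" 1] by (simp add: g_def)
        finally show "(\<Sum>I\<in>?S'. (P * toda_coeff q n p I) *
            (row_prod n y powi (- (a + 1)) * mb_psi q (raise I p) n y)) =
            P / row_prod n y * e s y * g y" .
      qed
      finally show ?thesis .
    qed
    have cont1: "continuous_on T (\<lambda>y. e (Suc s) y * g y)"
      by (intro contT row_holomorphic_mult e g)
    have cont2: "continuous_on T (\<lambda>y. P / row_prod n y * e s y * g y)"
    proof -
      have "continuous_on T (row_prod n)"
        unfolding row_prod_def T_def by (intro continuous_on_prod continuous_on_torus_coordinate)
      moreover have "row_prod n y \<noteq> 0" if "y \<in> T" for y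
        by (rule row_prod_nonzero) (rule distinct(2)[OF that])
      ultimately show ?thesis
        by (intro continuous_on_mult continuous_on_divide continuous_on_const contT[OF e] contT[OF g] ballI)
    qed
    have cont3: "continuous_on T (\<lambda>y. -1 * (d' i y * (e' i y * g y)))" if "i \<in> ?B" for i
      unfolding d'_def T_def using that
      by (intro continuous_on_mult continuous_on_const contT[OF e'g, unfolded T_def]
          continuous_on_torus_coeffs(2)[OF q \<rho>] continuous_on_torus_factors[OF q \<rho>(1)]
          continuous_on_torus_coordinate) auto
    have "(\<Sum>I\<in>subsets_of_card ?A r. toda_coeff q (Suc n) p I * mb_psi q (raise I p) (Suc n) x) =
        P powi a * (pairing q n \<rho> x (\<lambda>y. e (Suc s) y * g y) +
          pairing q n \<rho> x (\<lambda>y. P / row_prod n y * e s y * g y) +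
          (\<Sum>i\<in>?B. pairing q n \<rho> x (\<lambda>y. -1 * (d' i y * (e' i y * g y)))))"
    proof -
      have "?A = insert (Suc n) ?B" by auto
      then show ?thesis
        using sum_subsets_insert[of ?B "Suc n" "\<lambda>I. toda_coeff q (Suc n) p I * mb_psi q (raise I p) (Suc n) x" "Suc s"]
        unfolding Suc pairing_cmult
        by (simp only: sum1 sum2 finite_atLeastAtMost) (simp add: sum_negf algebra_simps del: mb_psi.simps)
    qed
    also have "(\<Sum>i\<in>?B. pairing q n \<rho> x (\<lambda>y. -1 * (d' i y * (e' i y * g y)))) =
        pairing q n \<rho> x (\<lambda>y. \<Sum>i\<in>?B. -1 * (d' i y * (e' i y * g y)))"
      by (rule pairing_sum[symmetric, OF q _ \<rho>(1)], simp, fold T_def) (rule cont3)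
    also have "pairing q n \<rho> x (\<lambda>y. e (Suc s) y * g y) +
          pairing q n \<rho> x (\<lambda>y. P / row_prod n y * e s y * g y) +
          pairing q n \<rho> x (\<lambda>y. \<Sum>i\<in>?B. -1 * (d' i y * (e' i y * g y))) =
        pairing q n \<rho> x (\<lambda>y. e (Suc s) y * g y + P / row_prod n y * e s y * g y +
          (\<Sum>i\<in>?B. -1 * (d' i y * (e' i y * g y))))"
      using cont1 cont2 cont3 unfolding T_def
      by (simp only: pairing_add[OF q \<rho>(1)] continuous_on_add continuous_on_sum)
    also have "\<dots> = pairing q n \<rho> x (\<lambda>y. elem_sym ?A (Suc s) (\<lambda>k. x (Suc n, k)) * g y)"
    proof (rule pairing_cong[OF \<rho>(1)], fold T_def)
      fix y assume y: "y \<in> T"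
      \<comment> \<open>The interpolation nodes are the row \<open>n\<close> entries, distinct and
        nonzero on this torus; row \<open>Suc n\<close> supplies the second set of
        variables.\<close>
      have identity: "e (Suc s) y + P / row_prod n y * e s y - (\<Sum>i\<in>?B. e' i y * d' i y) =
          elem_sym ?A (Suc s) (\<lambda>k. x (Suc n, k))"
        using elem_sym_kernel_identity[of ?B ?A "\<lambda>k. y (n, k)" s "\<lambda>k. x (Suc n, k)"] distinct[OF y]
        by (simp add: e_def e'_def d'_def P_def row_prod_def adjoint_coeff_def mult_ac)
      have "(\<Sum>i\<in>?B. -1 * (d' i y * (e' i y * g y))) = - (\<Sum>i\<in>?B. e' i y * d' i y) * g y"
        by (simp add: sum_negf sum_distrib_left sum_distrib_right mult_ac)
      then show "e (Suc s) y * g y + P / row_prod n y * e s y * g y +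
          (\<Sum>i\<in>?B. -1 * (d' i y * (e' i y * g y))) = elem_sym ?A (Suc s) (\<lambda>k. x (Suc n, k)) * g y"
        unfolding identity[symmetric] by algebra
    qed
    also have "\<dots> = elem_sym ?A (Suc s) (\<lambda>k. x (Suc n, k)) * pairing q n \<rho> x g"
      by (rule pairing_cmult)
    finally show ?thesis
      unfolding Suc psi[of p] by (simp add: g_def a_def mult_ac)
  qed
qed

end

section \<open>Vanishing outside the dominant cone and symmetry\<close>

context
  fixes q :: real
  assumes q: "0 < q" "q < 1"
begin

text \<open>Kernel and weight depend only on quotients, so scaling both rows leaves them fixed and
  only \<open>g\<close> contributes. As \<open>c \<le> 1\<close>, the old circles still surround the
  scaled top row and may be exchanged for the scaled ones.\<close>

lemma pairing_dilate:
  assumes g: "row_holomorphic n g" and r: "encloses n x r" and c: "0 < c" "c \<le> 1"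
    and hom: "\<And>y. g (dilate c n {1..n} y) = C * g y"
    and agree: "\<And>y y'. (\<And>k. k \<in> {1..n} \<Longrightarrow> y (n, k) = y' (n, k)) \<Longrightarrow> g y = g y'"
  shows "pairing q n r (dilate c (Suc n) {1..Suc n} x) g = C * pairing q n r x g"
proof -
  let ?z = "dilate c (Suc n) {1..Suc n} x"
  define s where "s = (\<lambda>v. (if v \<in> {n} \<times> {1..n} then c else 1) * r v)"
  have "encloses n ?z r" using c by (intro dilate_encloses[OF q r]) auto
  moreover have "encloses n ?z s"
    unfolding encloses_def
  proof (intro ballI)
    fix k m assume km: "k \<in> {1..n}" "m \<in> {1..Suc n}"
    then have "norm (x (Suc n, m)) < r (n, k)" using r unfolding encloses_def by blast
    then show "norm (?z (Suc n, m)) < s (n, k)"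
      using c km by (simp add: s_def norm_mult)
  qed
  ultimately have "pairing q n r ?z g = pairing q n s ?z g"
    by (rule pairing_radius_independent[OF q g])
  also have "\<dots> = torus_mean r (row_indices n) (\<lambda>y. mb_kernel q n (dilate c n {1..n} y) *
      q_weight q n {} (dilate c n {1..n} y) * g (dilate c n {1..n} y)) ?z"
    unfolding pairing_def s_def dilate_def[of c n]
    by (rule torus_mean_dilate[symmetric]) auto
  also have "\<dots> = pairing q n r x (\<lambda>y. C * g y)"
    unfolding pairing_def
  proof (rule torus_mean_cong)
    fix y y' assume y: "\<And>v. v \<in> set (row_indices n) \<Longrightarrow> y' v = y v \<and> norm (y v) = r v"
      "\<And>v. v \<notin> set (row_indices n) \<Longrightarrow> y v = ?z v \<and> y' v = x v"
    have row: "y' (n, k) = y (n, k)" if "k \<in> {1..n}" for k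
      using y(1)[of "(n, k)"] that by simp
    have top: "y (Suc n, m) = of_real c * y' (Suc n, m)" if "m \<in> {1..Suc n}" for m
      using y(2)[of "(Suc n, m)"] that by simp
    have "mb_kernel q n (dilate c n {1..n} y) = mb_kernel q n y'"
      unfolding mb_kernel_def
      by (intro prod.cong refl) (use c in \<open>simp add: row top\<close>)
    moreover have "q_weight q n {} (dilate c n {1..n} y) = q_weight q n {} y'"
      unfolding q_weight_def
      by (intro prod.cong refl) (use c in \<open>auto simp: row off_diagonal_def\<close>)
    moreover have "g y = g y'" by (rule agree) (simp add: row)
    ultimately show "mb_kernel q n (dilate c n {1..n} y) * q_weight q n {} (dilate c n {1..n} y) *
        g (dilate c n {1..n} y) = mb_kernel q n y' * q_weight q n {} y' * (C * g y')"
      unfolding hom by simp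
  next
    fix v assume "v \<in> set (row_indices n)"
    then show "0 \<le> r v" using encloses_pos[OF r] by (auto intro: less_imp_le)
  qed simp
  also have "\<dots> = C * pairing q n r x g" by (rule pairing_cmult)
  finally show ?thesis .
qed

lemma twisted_psi_dilate:
  assumes "0 < c" and hom: "mb_psi q p n (dilate c n {1..n} y) = of_real c powi (\<Sum>i=1..n. p i) * mb_psi q p n y"
  shows "row_prod n (dilate c n {1..n} y) powi (- a) * mb_psi q p n (dilate c n {1..n} y) =
    of_real c powi ((\<Sum>i=1..n. p i) - int n * a) * (row_prod n y powi (- a) * mb_psi q p n y)"
proof -
  have c: "complex_of_real c \<noteq> 0" using assms by simp
  have "row_prod n (dilate c n {1..n} y) powi (- a) = (of_real c ^ n) powi (- a) * row_prod n y powi (- a)"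
    by (simp add: row_prod_dilate power_int_mult_distrib)
  also have "(complex_of_real c ^ n) powi (- a) = of_real c powi (- (int n * a))"
    by (simp only: power_int_mult power_int_of_nat flip: mult_minus_right)
  finally show ?thesis
    unfolding hom using c by (simp add: power_int_diff power_int_minus field_simps)
qed

lemma mb_psi_homogeneous:
  assumes c: "0 < c" "c \<le> 1"
  shows "mb_psi q p n (dilate c n {1..n} x) = of_real c powi (\<Sum>i=1..n. p i) * mb_psi q p n x"
proof (induction n arbitrary: x)
  case 0
  show ?case by simp
next
  case (Suc n)
  let ?z = "dilate c (Suc n) {1..Suc n} x" and ?r = "std_radius n x" and ?a = "p (Suc n)"
  let ?g = "\<lambda>y. row_prod n y powi (- ?a) * mb_psi q p n y"
  have c0: "complex_of_real c \<noteq> 0" using c by simp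
  have "encloses n ?z ?r"
    using c by (intro dilate_encloses[OF q encloses_std_radius]) auto
  then have "mb_psi q p (Suc n) ?z = row_prod (Suc n) ?z powi ?a * pairing q n ?r ?z ?g"
    by (rule mb_psi_Suc[OF q])
  also have "pairing q n ?r ?z ?g = of_real c powi ((\<Sum>i=1..n. p i) - int n * ?a) * pairing q n ?r x ?g"
  proof (rule pairing_dilate[OF row_holomorphic_twisted_psi[OF q] encloses_std_radius c])
    show "?g (dilate c n {1..n} y) = of_real c powi ((\<Sum>i=1..n. p i) - int n * ?a) * ?g y" for y
      by (rule twisted_psi_dilate[OF c(1) Suc.IH])
    show "?g y = ?g y'" if "\<And>k. k \<in> {1..n} \<Longrightarrow> y (n, k) = y' (n, k)" for y y'
      using mb_psi_agree[of n y y' q p] row_prod_agree[of n y y'] that by simp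
  qed
  also have "row_prod (Suc n) ?z powi ?a = of_real c powi (int (Suc n) * ?a) * row_prod (Suc n) x powi ?a"
    by (simp add: row_prod_dilate power_int_mult_distrib power_int_mult flip: power_int_of_nat)
  also have "of_real c powi (int (Suc n) * ?a) * row_prod (Suc n) x powi ?a *
      (of_real c powi ((\<Sum>i=1..n. p i) - int n * ?a) * pairing q n ?r x ?g) =
      (of_real c powi (int (Suc n) * ?a) * of_real c powi ((\<Sum>i=1..n. p i) - int n * ?a)) *
      (row_prod (Suc n) x powi ?a * pairing q n ?r x ?g)"
    by (simp only: mult_ac)
  also have "of_real c powi (int (Suc n) * ?a) * of_real c powi ((\<Sum>i=1..n. p i) - int n * ?a) =
      complex_of_real c powi (\<Sum>i=1..Suc n. p i)"
    using c0 by (simp flip: power_int_add add: algebra_simps)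
  finally show ?case by simp
qed

text \<open>
  A function that is homogeneous of negative degree and continuous at the origin vanishes.
\<close>

lemma mb_psi_zero_of_degree:
  assumes neg: "(\<Sum>i=1..n. p i) < int n * p (Suc n)"
  shows "mb_psi q p (Suc n) x = 0"
proof -
  let ?r = "std_radius n x" and ?a = "p (Suc n)"
  let ?g = "\<lambda>y. row_prod n y powi (- ?a) * mb_psi q p n y"
  define d where "d = nat (int n * ?a - (\<Sum>i=1..n. p i))"
  have d: "0 < d" "(\<Sum>i=1..n. p i) - int n * ?a = - int d" using neg by (auto simp: d_def)
  \<comment> \<open>The pairing without the prefactor
    \<open>row_prod (Suc n) x powi p (Suc n)\<close>: it has degree \<open>- d\<close> and stays
    continuous at \<open>c = 0\<close>, where the whole top row sits at the origin inside every
    circle.\<close>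
  define h where "h = (\<lambda>c. pairing q n ?r (dilate c (Suc n) {1..Suc n} x) ?g)"
  have h1: "h 1 = of_real c ^ d * h c" if c: "0 < c" "c \<le> 1" for c
  proof -
    have "h c = of_real c powi (- int d) * pairing q n ?r x ?g"
      unfolding h_def
    proof (rule pairing_dilate[OF row_holomorphic_twisted_psi[OF q] encloses_std_radius c])
      show "?g (dilate c n {1..n} y) = of_real c powi (- int d) * ?g y" for y
        unfolding d(2)[symmetric] by (rule twisted_psi_dilate[OF c(1) mb_psi_homogeneous[OF c]])
      show "?g y = ?g y'" if "\<And>k. k \<in> {1..n} \<Longrightarrow> y (n, k) = y' (n, k)" for y y'
        using mb_psi_agree[of n y y' q p] row_prod_agree[of n y y'] that by simp
    qed
    moreover have "dilate 1 (Suc n) {1..Suc n} x = x"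
      by (auto simp: dilate_def)
    ultimately show ?thesis
      using c by (simp add: h_def power_int_minus field_simps)
  qed
  have "continuous_on {0..1} h"
  proof -
    define M where "M = 1 + (\<Sum>m=1..Suc n. norm (x (Suc n, m)))"
    have M: "norm (x (Suc n, m)) < M" if "m \<in> {1..Suc n}" for m
    proof -
      have "norm (x (Suc n, m)) \<le> (\<Sum>m=1..Suc n. norm (x (Suc n, m)))"
        using that by (intro member_le_sum) auto
      then show ?thesis by (simp add: M_def)
    qed
    have "0 < M" by (rule le_less_trans[OF norm_ge_zero M[of 1]]) simp
    let ?U = "\<lambda>v. if v \<in> {Suc n} \<times> {1..Suc n} then ball 0 M else UNIV"
    have "sep_holomorphic ?U (\<lambda>x'. pairing q n ?r x' ?g)"
      by (rule sep_holomorphic_pairing[OF q row_holomorphic_twisted_psi[OF q] \<open>0 < M\<close>, where M' = "M + n + 1"])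
        (simp add: std_radius_def M_def)
    then have cont: "continuous_on (Pi UNIV ?U) (\<lambda>x'. pairing q n ?r x' ?g)"
      by (simp add: sep_holomorphic_def)
    show ?thesis
      unfolding h_def
    proof (rule continuous_on_compose2[OF cont])
      show "continuous_on {0..1} (\<lambda>c. dilate c (Suc n) {1..Suc n} x)"
      proof (rule continuous_on_coordinatewise_then_product)
        fix v show "continuous_on {0..1} (\<lambda>c. dilate c (Suc n) {1..Suc n} x v)"
          by (cases "v \<in> {Suc n} \<times> {1..Suc n}")
            (simp_all only: dilate_def if_True if_False, (intro continuous_intros)+)
      qed
      show "(\<lambda>c. dilate c (Suc n) {1..Suc n} x) ` {0..1} \<subseteq> Pi UNIV ?U"
      proof (intro image_subsetI Pi_I)
        fix c :: real and v assume c: "c \<in> {0..1}"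
        show "dilate c (Suc n) {1..Suc n} x v \<in> ?U v"
        proof (cases "v \<in> {Suc n} \<times> {1..Suc n}")
          case True
          then obtain m where m: "v = (Suc n, m)" "m \<in> {1..Suc n}" by auto
          have "c * norm (x (Suc n, m)) \<le> norm (x (Suc n, m))"
            using c by (simp add: mult_left_le_one_le)
          then have "c * norm (x (Suc n, m)) < M" using M[OF m(2)] by linarith
          then show ?thesis using m c by (simp add: norm_mult)
        qed simp
      qed
    qed
  qed
  then have "(\<lambda>k. h ((1 / 2) ^ k)) \<longlonglongrightarrow> h 0"
    by (rule continuous_on_tendsto_compose)
      (auto intro!: LIMSEQ_realpow_zero always_eventually power_le_one)
  moreover have "(\<lambda>k. complex_of_real ((1 / 2) ^ k) ^ d) \<longlonglongrightarrow> of_real 0 ^ d"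
    by (intro tendsto_power tendsto_of_real LIMSEQ_realpow_zero) auto
  ultimately have "(\<lambda>k. complex_of_real ((1 / 2) ^ k) ^ d * h ((1 / 2) ^ k)) \<longlonglongrightarrow> of_real 0 ^ d * h 0"
    by (intro tendsto_mult)
  moreover have "complex_of_real ((1 / 2) ^ k) ^ d * h ((1 / 2) ^ k) = h 1" for k
    by (rule h1[symmetric]) (simp_all add: power_le_one)
  ultimately have "(\<lambda>k :: nat. h 1) \<longlonglongrightarrow> 0"
    using d(1) by (simp only: of_real_0 zero_power mult_zero_left)
  then have "h 1 = 0" by (simp add: LIMSEQ_const_iff)
  moreover have "dilate 1 (Suc n) {1..Suc n} x = x"
    by (auto simp: dilate_def)
  ultimately show ?thesis by (simp add: h_def)
qed

text \<open>
  The Toda equation of order \<open>n\<close> expresses \<open>mb_psi\<close> at \<open>p\<close> with \<open>p n < p (Suc n)\<close>, multiplied by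
  the nonzero factor \<open>1 - q powi (p n - p (Suc n))\<close>, through values of smaller degree.
\<close>

lemma mb_psi_zero_last:
  assumes "1 \<le> n" "p n < p (Suc n)" and x: "\<And>k. k \<in> {1..Suc n} \<Longrightarrow> x (Suc n, k) \<noteq> 0"
  shows "mb_psi q p (Suc n) x = 0"
  using assms(2)
\<comment> \<open>The summand 1 lets the induction step from degree 0 to negative degrees, which
  \<open>nat\<close> alone would identify.\<close>
proof (induction "nat ((\<Sum>i=1..n. p i) - int n * p (Suc n) + 1)" arbitrary: p rule: less_induct)
  case less
  let ?deg = "\<lambda>p :: nat \<Rightarrow> int. (\<Sum>i=1..n. p i) - int n * p (Suc n)"
  show ?case
  proof (cases "?deg p < 0")
    case True
    then show ?thesis by (intro mb_psi_zero_of_degree) simp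
  next
    case False
    have smaller: "mb_psi q p' (Suc n) x = 0" if "?deg p' < ?deg p" "p' n < p' (Suc n)" for p'
      using that False by (intro less.hyps) auto
    \<comment> \<open>Lowering the first \<open>n\<close> coordinates makes \<open>p\<close> the
      argument raised along \<open>{1..n}\<close>. All other sets of size \<open>n\<close> contain
      \<open>Suc n\<close> and lead to smaller degree with the same violated inequality, as does
      \<open>p'\<close> itself; hence only the term at \<open>p\<close> survives.\<close>
    define p' where "p' = (\<lambda>i. if i \<in> {1..n} then p i - 1 else p i)"
    have raise_full: "raise {1..n} p' = p" by (auto simp: raise_def p'_def)
    have sum_p': "(\<Sum>i=1..n. p' i) = (\<Sum>i=1..n. p i) - int n"
      by (simp add: p'_def sum_subtractf)
    let ?f = "\<lambda>I. toda_coeff q (Suc n) p' I * mb_psi q (raise I p') (Suc n) x"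
    have "(\<Sum>I\<in>subsets_of_card {1..Suc n} n. ?f I) = elem_sym {1..Suc n} n (\<lambda>k. x (Suc n, k)) * mb_psi q p' (Suc n) x"
      by (rule toda_eigenvalue[OF q]) (rule x)
    also have "mb_psi q p' (Suc n) x = 0"
    proof (rule smaller)
      show "?deg p' < ?deg p" using sum_p' assms(1) by (simp add: p'_def)
      show "p' n < p' (Suc n)" using less.prems assms(1) by (simp add: p'_def)
    qed
    also have "(\<Sum>I\<in>subsets_of_card {1..Suc n} n. ?f I) =
        ?f {1..n} + (\<Sum>I\<in>{I. I \<subseteq> {1..n} \<and> Suc (card I) = n}. ?f (insert (Suc n) I))"
    proof -
      have "{1..Suc n} = insert (Suc n) {1..n}" by auto
      then show ?thesis
        using sum_subsets_insert[of "{1..n}" "Suc n" ?f n] subsets_of_card_full[of "{1..n}"]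
        by (simp del: mb_psi.simps)
    qed
    also have "(\<Sum>I\<in>{I. I \<subseteq> {1..n} \<and> Suc (card I) = n}. ?f (insert (Suc n) I)) = 0"
    proof (intro sum.neutral ballI)
      fix I assume "I \<in> {I. I \<subseteq> {1..n} \<and> Suc (card I) = n}"
      then have I: "I \<subseteq> {1..n}" "Suc (card I) = n" by auto
      have "(\<Sum>i=1..n. raise (insert (Suc n) I) p' i) = (\<Sum>i=1..n. p' i + (if i \<in> I then 1 else 0))"
        by (rule sum.cong) (auto simp: raise_def)
      also have "\<dots> = (\<Sum>i=1..n. p' i) + int (card I)"
        using I(1) by (simp add: sum.distrib sum.If_cases Int_absorb1)
      finally have "(\<Sum>i=1..n. raise (insert (Suc n) I) p' i) = (\<Sum>i=1..n. p i) - 1"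
        using sum_p' I(2) by simp
      moreover have "raise (insert (Suc n) I) p' (Suc n) = p (Suc n) + 1"
        by (simp add: raise_def p'_def)
      ultimately have "mb_psi q (raise (insert (Suc n) I) p') (Suc n) x = 0"
        using less.prems assms(1)
        by (intro smaller) (simp_all add: algebra_simps, simp add: raise_def p'_def)
      then show "?f (insert (Suc n) I) = 0" by (simp del: mb_psi.simps)
    qed
    also have "toda_coeff q (Suc n) p' {1..n} = 1 - of_real q powi (p n - p (Suc n))"
    proof -
      have "toda_coeff q (Suc n) p' {1..n} = (\<Prod>i\<in>{1..n}. if i = n then 1 - of_real q powi (p n - p (Suc n)) else 1)"
        unfolding toda_coeff_def using assms(1) by (intro prod.cong) (auto simp: p'_def)
      then show ?thesis using assms(1) by (simp add: prod.delta)
    qed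
    finally have "(1 - complex_of_real q powi (p n - p (Suc n))) * mb_psi q p (Suc n) x = 0"
      by (simp only: raise_full add_0_right mult_zero_right)
    moreover have "complex_of_real q powi (p n - p (Suc n)) \<noteq> 1"
    proof -
      define m where "m = nat (p (Suc n) - p n)"
      have m: "0 < m" "p n - p (Suc n) = - int m" using less.prems by (auto simp: m_def)
      have "q ^ m < 1" using q m by (simp add: power_less_one_iff)
      then have "complex_of_real (q ^ m) \<noteq> 1" by (metis less_irrefl of_real_eq_1_iff)
      then show ?thesis unfolding m(2) by (simp add: power_int_minus)
    qed
    ultimately show ?thesis by simp
  qed
qed

text \<open>A violation at the last index is \<open>mb_psi_zero_last\<close>; an earlier one makes
  the integrand vanish on the torus, by induction.\<close>

lemma mb_psi_zero:
  assumes "\<And>k. k \<in> {1..n} \<Longrightarrow> x (n, k) \<noteq> 0" "i \<in> {1..<n}" "p i < p (Suc i)"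
  shows "mb_psi q p n x = 0"
  using assms(1,2)
proof (induction n arbitrary: x)
  case 0
  then show ?case by simp
next
  case (Suc n)
  show ?case
  proof (cases "i = n")
    case True
    then show ?thesis using Suc.prems assms(3) by (intro mb_psi_zero_last) auto
  next
    case False
    let ?r = "std_radius n x"
    have "pairing q n ?r x (\<lambda>y. row_prod n y powi (- p (Suc n)) * mb_psi q p n y) = pairing q n ?r x (\<lambda>y. 0 * 1)"
    proof (rule pairing_cong[OF encloses_std_radius])
      fix y assume y: "y \<in> torus ?r ({n} \<times> {1..n}) x"
      have "mb_psi q p n y = 0"
        by (rule Suc.IH) (use torus_row_distinct(2)[OF y encloses_std_radius inj_std_radius] Suc.prems False in auto)
      then show "row_prod n y powi (- p (Suc n)) * mb_psi q p n y = 0 * 1" by simp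
    qed
    then show ?thesis by (simp add: pairing_cmult[of q n ?r x 0, simplified])
  qed
qed

text \<open>The top row enters only through its product and through symmetric products in the
  kernel, while one set of radii serves both orderings.\<close>

lemma mb_psi_permute:
  assumes "\<sigma> permutes {1..n}" and x': "\<And>k. k \<in> {1..n} \<Longrightarrow> x' (n, k) = x (n, \<sigma> k)"
  shows "mb_psi q p n x' = mb_psi q p n x"
proof (cases n)
  case 0
  then show ?thesis by simp
next
  case (Suc m)
  have prod: "(\<Prod>k=1..Suc m. f (x' (Suc m, k))) = (\<Prod>k=1..Suc m. f (x (Suc m, k)))"
    for f :: "complex \<Rightarrow> complex"
    using prod.permute[OF assms(1), of "\<lambda>k. f (x (Suc m, k))"] x' by (simp add: Suc)
  have "encloses m x' (std_radius m x)"
    unfolding encloses_def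
  proof (intro ballI)
    fix k j assume kj: "k \<in> {1..m}" "j \<in> {1..Suc m}"
    then have "\<sigma> j \<in> {1..Suc m}" using permutes_in_image[OF assms(1)] Suc by simp
    then show "norm (x' (Suc m, j)) < std_radius m x (m, k)"
      using encloses_std_radius[of m x] kj x' Suc by (simp add: encloses_def)
  qed
  then have "mb_psi q p (Suc m) x' = row_prod (Suc m) x' powi p (Suc m) *
      pairing q m (std_radius m x) x' (\<lambda>y. row_prod m y powi (- p (Suc m)) * mb_psi q p m y)"
    by (rule mb_psi_Suc[OF q])
  also have "row_prod (Suc m) x' = row_prod (Suc m) x"
    using prod[of "\<lambda>w. w"] by (simp add: row_prod_def)
  also have "pairing q m (std_radius m x) x' (\<lambda>y. row_prod m y powi (- p (Suc m)) * mb_psi q p m y) =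
      pairing q m (std_radius m x) x (\<lambda>y. row_prod m y powi (- p (Suc m)) * mb_psi q p m y)"
  proof (rule pairing_transfer[OF encloses_std_radius, symmetric])
    fix y y' assume y: "y \<in> torus (std_radius m x) ({m} \<times> {1..m}) x"
      "y' \<in> torus (std_radius m x) ({m} \<times> {1..m}) x'" "\<And>k. k \<in> {1..m} \<Longrightarrow> y' (m, k) = y (m, k)"
    have "mb_kernel q m y' = mb_kernel q m y"
      unfolding mb_kernel_def torus_row_Suc[OF y(1)] torus_row_Suc[OF y(2)]
    proof (rule prod.cong[OF refl])
      fix k assume "k \<in> {1..m}"
      then show "(\<Prod>j=1..Suc m. inverse (q_poch q (x' (Suc m, j) / y' (m, k)))) =
          (\<Prod>j=1..Suc m. inverse (q_poch q (x (Suc m, j) / y (m, k))))"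
        using prod[of "\<lambda>w. inverse (q_poch q (w / y (m, k)))"] by (simp only: y(3))
    qed
    moreover have "mb_psi q p m y' = mb_psi q p m y" by (rule mb_psi_agree) (simp add: y(3))
    moreover have "row_prod m y' = row_prod m y" by (rule row_prod_agree) (simp add: y(3))
    ultimately show "mb_kernel q m y * (row_prod m y powi (- p (Suc m)) * mb_psi q p m y) =
        mb_kernel q m y' * (row_prod m y' powi (- p (Suc m)) * mb_psi q p m y')"
      by simp
  qed
  finally show ?thesis by (simp add: Suc)
qed

end

section \<open>Comparison with the iterated contour integral\<close>

lemma mb_indices_Suc: "mb_indices (Suc l) = row_indices (Suc l) @ mb_indices l"
  by (simp add: mb_indices_def row_indices_def)

lemma set_mb_indices: "set (mb_indices l) = {(n, j). n \<in> {1..l} \<and> j \<in> {1..n}}"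
proof (induction l)
  case 0
  show ?case by (simp add: mb_indices_def)
next
  case (Suc l)
  have "v \<in> set (mb_indices (Suc l)) \<longleftrightarrow> v \<in> {(n, j). n \<in> {1..Suc l} \<and> j \<in> {1..n}}" for v
    unfolding mb_indices_Suc set_append Suc.IH set_row_indices
    by (cases v; cases "fst v = Suc l") auto
  then show ?case by blast
qed

lemma distinct_mb_indices: "distinct (mb_indices l)"
proof (induction l)
  case 0
  show ?case by (simp add: mb_indices_def)
next
  case (Suc l)
  then show ?case by (auto simp: mb_indices_Suc set_mb_indices)
qed

lemma prod_power_int: "(\<Prod>i\<in>A. f i powi n) = (\<Prod>i\<in>A. f i :: complex) powi n"
  by (induction A rule: infinite_finite_induct) (simp_all add: power_int_mult_distrib)

definition mb_factor :: "real \<Rightarrow> (nat \<Rightarrow> int) \<Rightarrow> nat \<Rightarrow> (nat \<times> nat \<Rightarrow> complex) \<Rightarrow> complex" where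
  "mb_factor q p n x = (row_prod (Suc n) x / row_prod n x) powi p (Suc n) *
     (mb_kernel q n x * q_weight q n {} x / fact n)"

lemma mb_factor_agree:
  assumes "\<And>k. k \<in> {1..n} \<Longrightarrow> y (n, k) = y' (n, k)"
    and "\<And>m. m \<in> {1..Suc n} \<Longrightarrow> y (Suc n, m) = y' (Suc n, m)"
  shows "mb_factor q p n y = mb_factor q p n y'"
proof -
  have "mb_kernel q n y = mb_kernel q n y'" by (rule mb_kernel_agree) (fact assms)+
  moreover have "q_weight q n {} y = q_weight q n {} y'" by (rule q_weight_agree) (fact assms)
  moreover have "row_prod n y = row_prod n y'" by (rule row_prod_agree) (fact assms)
  moreover have "row_prod (Suc n) y = row_prod (Suc n) y'" by (rule row_prod_agree) (fact assms)
  ultimately show ?thesis by (simp add: mb_factor_def)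
qed

context
  fixes q :: real
  assumes q: "0 < q" "q < 1"
begin

text \<open>The convention that the entry just outside the triangle is 1 supplies the missing
  denominator of the last quotient, so the powers with the top exponent combine to a quotient of row
  products.\<close>

lemma mb_integrand_Suc:
  assumes "x (Suc m, Suc (Suc m)) = 1"
  shows "mb_integrand (Suc m) q p x = mb_factor q p (Suc m) x * mb_integrand m q p x"
proof -
  let ?n = "Suc m"
  have top: "(\<Prod>j=1..Suc ?n. (x (Suc ?n, j) / x (?n, j)) powi p (Suc ?n)) =
      (row_prod (Suc ?n) x / row_prod ?n x) powi p (Suc ?n)"
    unfolding prod_power_int prod_dividef using assms by (simp add: row_prod_def)
  have kernel: "(\<Prod>k=1..?n. \<Prod>j=1..Suc ?n. q_Gamma q (inverse (x (?n, k)) * x (Suc ?n, j))) = mb_kernel q ?n x"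
    unfolding mb_kernel_def q_Gamma_eq[OF q]
    by (simp only: divide_inverse mult.commute)
  have weight: "inverse (\<Prod>(s, t)\<in>{(s, t). s \<in> {1..?n} \<and> t \<in> {1..?n} \<and> s \<noteq> t}.
      q_Gamma q (x (?n, s) * inverse (x (?n, t)))) = q_weight q ?n {} x"
    unfolding q_weight_def off_diagonal_def q_Gamma_eq[OF q]
    by (simp add: divide_inverse case_prod_beta flip: prod_inversef)
  define A where "A = (\<lambda>n. \<Prod>j=1..n. (x (n, j) / x (n - 1, j)) powi p n)"
  define B where "B = (\<lambda>n. (\<Prod>k=1..n. \<Prod>m=1..n+1. q_Gamma q (inverse (x (n, k)) * x (n + 1, m))) /
        (fact n * (\<Prod>(s, t)\<in>{(s, t). s \<in> {1..n} \<and> t \<in> {1..n} \<and> s \<noteq> t}.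
            q_Gamma q (x (n, s) * inverse (x (n, t))))))"
  have integrand: "mb_integrand k q p x = (\<Prod>n=1..k+1. A n) * (\<Prod>n=1..k. B n)" for k
    by (simp only: mb_integrand_def A_def B_def)
  have "mb_integrand ?n q p x = A (Suc ?n) * B ?n * mb_integrand m q p x"
    unfolding integrand by simp
  also have "A (Suc ?n) = (row_prod (Suc ?n) x / row_prod ?n x) powi p (Suc ?n)"
    unfolding A_def diff_Suc_1 by (rule top)
  also have "B ?n = mb_kernel q ?n x * q_weight q ?n {} x / fact ?n"
    unfolding B_def Suc_eq_plus1[symmetric] kernel weight[symmetric]
    by (simp only: divide_inverse inverse_mult_distrib mult_ac)
  finally show ?thesis by (simp only: mb_factor_def)
qed

text \<open>Rows peel off from the top, since their integrals are outermost. Equal radii within a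
  row are admissible because \<open>mb_psi_Suc\<close> accepts any enclosing radii. The norm
  condition is guarded by \<open>1 \<le> m\<close>, as \<open>\<rho> 0\<close> belongs to no
  circle.\<close>

lemma torus_mean_mb_integrand:
  assumes "\<And>n. n \<in> {1..m} \<Longrightarrow> 0 < \<rho> n" and "\<And>n. n \<in> {1..<m} \<Longrightarrow> \<rho> (Suc n) < \<rho> n"
    and "\<And>j. 1 \<le> m \<Longrightarrow> j \<in> {1..Suc m} \<Longrightarrow> norm (x (Suc m, j)) < \<rho> m"
    and "\<And>n. n \<le> m \<Longrightarrow> x (n, Suc n) = 1"
  shows "torus_mean (\<lambda>v. \<rho> (fst v)) (mb_indices m) (mb_integrand m q p) x =
    mb_psi q p (Suc m) x / (\<Prod>n=1..m. fact n)"
  using assms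
proof (induction m arbitrary: x)
  case 0
  have "x (0, 1) = 1" using 0(4)[of 0] by simp
  then show ?case
    by (simp add: mb_indices_def mb_integrand_def pairing_def row_indices_def mb_kernel_def q_weight_def
        off_diagonal_def row_prod_def)
next
  case (Suc m)
  let ?r = "\<lambda>v :: nat \<times> nat. \<rho> (fst v)" and ?n = "Suc m"
  let ?F = "\<Prod>n=1..m. fact n :: complex"
  have pos: "0 < \<rho> n" if "n \<in> {1..?n}" for n using Suc.prems(1) that by blast
  have encl: "encloses ?n x ?r"
    using Suc.prems(3) by (simp add: encloses_def)
  have "torus_mean ?r (mb_indices ?n) (mb_integrand ?n q p) x =
      torus_mean ?r (row_indices ?n) (torus_mean ?r (mb_indices m) (mb_integrand ?n q p)) x"
    by (simp only: mb_indices_Suc torus_mean_append)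
  also have "\<dots> = torus_mean ?r (row_indices ?n) (\<lambda>y. (row_prod (Suc ?n) x powi p (Suc ?n) / (?F * fact ?n)) *
      (mb_kernel q ?n y * q_weight q ?n {} y * (row_prod ?n y powi (- p (Suc ?n)) * mb_psi q p ?n y))) x"
  proof (rule torus_mean_cong)
    fix y y' assume y: "\<And>v. v \<in> set (row_indices ?n) \<Longrightarrow> y' v = y v \<and> norm (y v) = ?r v"
      "\<And>v. v \<notin> set (row_indices ?n) \<Longrightarrow> y v = x v \<and> y' v = x v"
    have "y' v = y v" for v using y by (cases "v \<in> set (row_indices ?n)") simp_all
    then have y': "y' = y" by (rule ext)
    have one: "y (n, Suc n) = 1" if "n \<le> ?n" for n
      using y(2)[of "(n, Suc n)"] Suc.prems(4)[OF that] by simp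
    have top: "y (Suc ?n, j) = x (Suc ?n, j)" for j
      using y(2)[of "(Suc ?n, j)"] by simp
    \<comment> \<open>The new factor involves only rows above \<open>m\<close>, so it is constant
      for the inner integrals.\<close>
    have "torus_mean ?r (mb_indices m) (mb_integrand ?n q p) y =
        torus_mean ?r (mb_indices m) (\<lambda>u. mb_factor q p ?n y * mb_integrand m q p u) y"
    proof (rule torus_mean_cong[OF distinct_mb_indices])
      fix u u' assume u: "\<And>v. v \<in> set (mb_indices m) \<Longrightarrow> u' v = u v \<and> norm (u v) = ?r v"
        "\<And>v. v \<notin> set (mb_indices m) \<Longrightarrow> u v = y v \<and> u' v = y v"
      have "u' v = u v" for v using u by (cases "v \<in> set (mb_indices m)") simp_all
      then have u': "u' = u" by (rule ext)
      have fixed: "u (n, k) = y (n, k)" if "m < n" for n k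
        using u(2)[of "(n, k)"] that by (simp add: set_mb_indices)
      have "mb_factor q p ?n u = mb_factor q p ?n y"
        by (rule mb_factor_agree) (simp_all add: fixed)
      then show "mb_integrand ?n q p u = mb_factor q p ?n y * mb_integrand m q p u'"
        using mb_integrand_Suc[of u m p] fixed[of ?n "Suc ?n"] one[of ?n] u' by simp
    next
      fix v assume "v \<in> set (mb_indices m)"
      then show "0 \<le> ?r v" using pos by (auto simp: set_mb_indices intro: less_imp_le)
    qed
    also have "\<dots> = mb_factor q p ?n y * torus_mean ?r (mb_indices m) (mb_integrand m q p) y"
      by (rule torus_mean_cmult)
    also have "torus_mean ?r (mb_indices m) (mb_integrand m q p) y = mb_psi q p ?n y / ?F"
    proof (rule Suc.IH)
      show "norm (y (?n, j)) < \<rho> m" if "1 \<le> m" "j \<in> {1..?n}" for j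
        using y(1)[of "(?n, j)"] that Suc.prems(2)[of m] by simp
    qed (use Suc.prems one in auto)
    also have "mb_factor q p ?n y * (mb_psi q p ?n y / ?F) =
        row_prod (Suc ?n) x powi p (Suc ?n) / (?F * fact ?n) * (mb_kernel q ?n y * q_weight q ?n {} y *
          (row_prod ?n y powi (- p (Suc ?n)) * mb_psi q p ?n y))"
    proof -
      have "row_prod (Suc ?n) y = row_prod (Suc ?n) x" by (rule row_prod_agree) (rule top)
      moreover have power: "(a / b) powi i = a powi i * b powi (- i)" for a b :: complex and i
        by (simp add: power_int_divide_distrib power_int_minus field_simps)
      ultimately show ?thesis
        unfolding mb_factor_def power by (simp only: divide_inverse inverse_mult_distrib mult_ac)
    qed
    finally show "torus_mean ?r (mb_indices m) (mb_integrand ?n q p) y =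
        row_prod (Suc ?n) x powi p (Suc ?n) / (?F * fact ?n) * (mb_kernel q ?n y' * q_weight q ?n {} y' *
          (row_prod ?n y' powi (- p (Suc ?n)) * mb_psi q p ?n y'))"
      unfolding y' .
  next
    fix v assume "v \<in> set (row_indices ?n)"
    then show "0 \<le> ?r v" using pos by (auto intro: less_imp_le)
  qed simp
  also have "\<dots> = row_prod (Suc ?n) x powi p (Suc ?n) / (?F * fact ?n) *
      pairing q ?n ?r x (\<lambda>y. row_prod ?n y powi (- p (Suc ?n)) * mb_psi q p ?n y)"
    unfolding pairing_def by (rule torus_mean_cmult)
  also have "\<dots> = mb_psi q p (Suc ?n) x / (\<Prod>n=1..?n. fact n)"
    unfolding mb_psi_Suc[OF q encl] by (simp del: mb_psi.simps)
  finally show ?case .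
qed

text \<open>Here the extension by zero is reconciled with the integral: outside the dominant cone
  the left side is 0 by definition and the right side by \<open>mb_psi_zero\<close>.\<close>

lemma mb_Psi_eq:
  assumes "1 \<le> l" and "admissible_radii l w \<rho>" and w: "\<And>i. i \<in> {1..Suc l} \<Longrightarrow> w i \<noteq> 0"
  shows "mb_Psi l q \<rho> w p =
    of_real (qq_inf q) ^ (l * (l - 1) div 2) / (\<Prod>n=1..l. fact n) * mb_psi q p (Suc l) (mb_frame l w)"
proof (cases "\<forall>i\<in>{1..l}. p (i + 1) \<le> p i")
  case True
  have rad: "\<And>n. n \<in> {1..l} \<Longrightarrow> 0 < \<rho> n" "\<And>n. n \<in> {1..<l} \<Longrightarrow> \<rho> (Suc n) < \<rho> n"
    "\<And>m. m \<in> {1..Suc l} \<Longrightarrow> norm (w m) < \<rho> l"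
    using assms(2) by (auto simp: admissible_radii_def)
  have "torus_integral \<rho> (mb_indices l) (mb_integrand l q p) (mb_frame l w) =
      torus_mean (\<lambda>v. \<rho> (fst v)) (mb_indices l) (mb_integrand l q p) (mb_frame l w)"
  proof (rule torus_integral_eq_torus_mean)
    fix v assume "v \<in> set (mb_indices l)"
    then show "\<rho> (fst v) \<noteq> 0" using rad(1)[of "fst v"] by (auto simp: set_mb_indices)
  qed
  also have "\<dots> = mb_psi q p (Suc l) (mb_frame l w) / (\<Prod>n=1..l. fact n)"
    by (rule torus_mean_mb_integrand) (use rad in \<open>auto simp: mb_frame_def\<close>)
  finally show ?thesis using True by (simp add: mb_Psi_def del: mb_psi.simps)
next
  case False
  then obtain i where i: "i \<in> {1..<Suc l}" "p i < p (Suc i)" by force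
  have "mb_psi q p (Suc l) (mb_frame l w) = 0"
    by (rule mb_psi_zero[OF q _ i]) (simp add: mb_frame_def w)
  then show ?thesis by (simp only: mb_Psi_def False if_False mult_zero_right)
qed

end

section \<open>Translation of the Hamiltonians and conclusion\<close>

lemma X_tilde_prod_eq_toda_coeff:
  assumes I: "I \<subseteq> {1..l+1}" "card I = r"
  defines "is \<equiv> sorted_list_of_set I @ [l + 2]"
  shows "of_real (\<Prod>k<r. X_tilde l q p (is ! k) ^ (1 - (if is ! (k + 1) - is ! k = 1 then 1 else 0))) =
    toda_coeff q (Suc l) p I"
proof -
  define xs where "xs = sorted_list_of_set I"
  have fin: "finite I" using I finite_subset by blast
  have xs: "set xs = I" "length xs = r" "sorted_wrt (<) xs" "distinct xs"
    using fin I by (simp_all add: xs_def)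
  have xs_less: "xs ! j < xs ! k" if "j < k" "k < r" for j k
    using sorted_wrt_nth_less[OF xs(3)] that xs(2) by simp
  let ?h = "\<lambda>i. if i = Suc l \<or> Suc i \<in> I then 1 else 1 - q powi (p i - p (Suc i) + 1)"
  have "X_tilde l q p (is ! k) ^ (1 - (if is ! (k + 1) - is ! k = 1 then 1 else 0)) = ?h (xs ! k)"
    if k: "k < r" for k
  proof -
    have here: "is ! k = xs ! k" using k xs(2) by (simp add: is_def xs_def nth_append)
    have mem: "xs ! k \<in> I" using k xs by (metis nth_mem)
    then have bound: "1 \<le> xs ! k" "xs ! k \<le> l + 1" using I by auto
    have index: "\<exists>j<r. xs ! j = i" if "i \<in> I" for i
      using that xs by (metis in_set_conv_nth)
    \<comment> \<open>In a strictly increasing list the successor of an entry can only stand next to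
      it. The final \<open>l + 2\<close> gives gap 1 after the entry \<open>l + 1\<close>, where
      \<open>X_tilde\<close> equals 1 anyway.\<close>
    have consecutive: "is ! (k + 1) - is ! k = 1 \<longleftrightarrow> xs ! k = Suc l \<or> Suc (xs ! k) \<in> I"
    proof (cases "k + 1 < r")
      case True
      then have "is ! (k + 1) = xs ! (k + 1)" using xs(2) by (simp add: is_def xs_def nth_append)
      moreover have next_less: "xs ! k < xs ! (k + 1)" using True by (intro xs_less) auto
      moreover have next_mem: "xs ! (k + 1) \<in> I" using True xs by (metis nth_mem)
      moreover have "xs ! (k + 1) \<le> l + 1" using next_mem I by auto
      moreover have "xs ! (k + 1) = Suc (xs ! k)" if succ: "Suc (xs ! k) \<in> I"
      proof -
        obtain j where j: "j < r" "xs ! j = Suc (xs ! k)" using index[OF succ] by blast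
        have "\<not> j \<le> k" using xs_less[of j k] j k by (cases "j = k") auto
        then have "xs ! (k + 1) \<le> xs ! j" using xs_less[of "k + 1" j] j by (cases "j = k + 1") auto
        then show ?thesis using j next_less by simp
      qed
      ultimately show ?thesis
        unfolding here by (cases "xs ! (k + 1) = Suc (xs ! k)") auto
    next
      case False
      then have last: "k + 1 = r" using k by simp
      then have "is ! (k + 1) = l + 2" using xs(2) by (simp add: is_def xs_def nth_append)
      moreover have "Suc (xs ! k) \<notin> I"
      proof
        assume "Suc (xs ! k) \<in> I"
        then obtain j where j: "j < r" "xs ! j = Suc (xs ! k)" using index by blast
        then show False using xs_less[of j k] last by (cases "j = k") auto
      qed
      ultimately show ?thesis using here bound by auto
    qed
    show ?thesis
      unfolding consecutive unfolding here using bound by (auto simp: X_tilde_def)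
  qed
  then have "(\<Prod>k<r. X_tilde l q p (is ! k) ^ (1 - (if is ! (k + 1) - is ! k = 1 then 1 else 0))) =
      (\<Prod>k<r. ?h (xs ! k))"
    by (intro prod.cong) auto
  also have "\<dots> = (\<Prod>i\<in>I. ?h i)"
    by (rule prod.reindex_bij_betw) (use bij_betw_nth[OF xs(4), of "{..<r}" I] xs in simp)
  finally show ?thesis
    by (simp add: toda_coeff_def if_distrib[of of_real] cong: if_cong)
qed

lemma toda_H_eq:
  "toda_H l q r f p = (\<Sum>I\<in>subsets_of_card {1..Suc l} r. toda_coeff q (Suc l) p I * f (raise I p))"
  unfolding toda_H_def Let_def
proof (rule sum.cong)
  fix I assume "I \<in> subsets_of_card {1..Suc l} r"
  then have "I \<subseteq> {1..l+1}" "card I = r" by (auto simp: subsets_of_card_def)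
  from X_tilde_prod_eq_toda_coeff[OF this, of q p]
  show "of_real (\<Prod>k<r. X_tilde l q p ((sorted_list_of_set I @ [l + 2]) ! k) ^
        (1 - (if (sorted_list_of_set I @ [l + 2]) ! (k + 1) - (sorted_list_of_set I @ [l + 2]) ! k = 1 then 1 else 0))) *
      f (\<lambda>i. if i \<in> I then p i + 1 else p i) = toda_coeff q (Suc l) p I * f (raise I p)"
    by (simp only: raise_def)
qed (simp add: subsets_of_card_def)

theorem proposition2p4:
  fixes l :: nat and q :: real and z :: "nat \<Rightarrow> complex"
    and \<rho> :: "(nat \<Rightarrow> complex) \<Rightarrow> nat \<Rightarrow> real"
  assumes "1 \<le> l" and "0 < q" and "q < 1"
    and "\<forall>i\<in>{1..l+1}. z i \<noteq> 0"
    and "\<forall>w. (\<forall>i\<in>{1..l+1}. w i \<noteq> 0) \<longrightarrow> admissible_radii l w (\<rho> w)"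
  defines "\<Psi> \<equiv> \<lambda>w. mb_Psi l q (\<rho> w) w"
  shows "(\<forall>\<sigma> p. \<sigma> permutes {1..l+1} \<longrightarrow> \<Psi> (z \<circ> \<sigma>) p = \<Psi> z p) \<and>
    (\<forall>r\<in>{1..l+1}. \<forall>p.
       toda_H l q r (\<Psi> z) p = toda_chi l r z * \<Psi> z p \<and>
       (inj_on z {1..l+1} \<longrightarrow>
         of_real q powi (- int (r * (r - 1) div 2)) * toda_H_dual l q r (\<lambda>w. \<Psi> w p) z =
           (\<Prod>i=l+2-r..l+1. of_real q powi p i) * \<Psi> z p))"
proof -
  note q = assms(2,3)
  define C where "C = complex_of_real (qq_inf q) ^ (l * (l - 1) div 2) / (\<Prod>n=1..l. fact n)"
  have z: "z i \<noteq> 0" if "i \<in> {1..Suc l}" for i using assms(4) that by auto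
  \<comment> \<open>Each tuple has its own radii, and the dual Hamiltonian compares values at
    different tuples; this formula replaces them by one function without a choice of radii.\<close>
  have Psi: "\<Psi> w p = C * mb_psi q p (Suc l) (mb_frame l w)" if w: "\<And>i. i \<in> {1..Suc l} \<Longrightarrow> w i \<noteq> 0" for w p
    unfolding \<Psi>_def C_def
  proof (rule mb_Psi_eq[OF q assms(1)])
    show "admissible_radii l w (\<rho> w)" using assms(5) w by auto
  qed (rule w)
  have Psi_z: "\<Psi> z = (\<lambda>p. C * mb_psi q p (Suc l) (mb_frame l z))"
    by (rule ext) (rule Psi[OF z])
  have frame [simp]: "mb_frame l w (Suc l, k) = w k" for w k by (simp add: mb_frame_def)
  have "\<Psi> (z \<circ> \<sigma>) p = \<Psi> z p" if \<sigma>: "\<sigma> permutes {1..l+1}" for \<sigma> p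
  proof -
    have \<sigma>': "\<sigma> permutes {1..Suc l}" using \<sigma> by simp
    have "\<Psi> (z \<circ> \<sigma>) p = C * mb_psi q p (Suc l) (mb_frame l (z \<circ> \<sigma>))"
      by (rule Psi) (use z permutes_in_image[OF \<sigma>'] in simp)
    also have "mb_psi q p (Suc l) (mb_frame l (z \<circ> \<sigma>)) = mb_psi q p (Suc l) (mb_frame l z)"
      by (rule mb_psi_permute[OF q \<sigma>']) simp
    finally show ?thesis by (simp only: Psi_z)
  qed
  moreover have "toda_H l q r (\<Psi> z) p = toda_chi l r z * \<Psi> z p" for r p
  proof -
    have "toda_H l q r (\<Psi> z) p = C * (\<Sum>I\<in>subsets_of_card {1..Suc l} r.
        toda_coeff q (Suc l) p I * mb_psi q (raise I p) (Suc l) (mb_frame l z))"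
      unfolding toda_H_eq Psi_z by (simp only: sum_distrib_left mult_ac)
    also have "(\<Sum>I\<in>subsets_of_card {1..Suc l} r.
        toda_coeff q (Suc l) p I * mb_psi q (raise I p) (Suc l) (mb_frame l z)) =
        elem_sym {1..Suc l} r (\<lambda>k. mb_frame l z (Suc l, k)) * mb_psi q p (Suc l) (mb_frame l z)"
      by (rule toda_eigenvalue[OF q]) (simp add: z)
    also have "elem_sym {1..Suc l} r (\<lambda>k. mb_frame l z (Suc l, k)) = toda_chi l r z"
      by (simp add: elem_sym_def toda_chi_def subsets_of_card_def)
    finally show ?thesis by (simp only: Psi_z mult_ac)
  qed
  moreover have "of_real q powi (- int (r * (r - 1) div 2)) * toda_H_dual l q r (\<lambda>w. \<Psi> w p) z =
      (\<Prod>i=l+2-r..l+1. of_real q powi p i) * \<Psi> z p"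
    if r: "r \<in> {1..l+1}" and inj: "inj_on z {1..l+1}" for r p
  proof -
    have "\<Psi> (\<lambda>i. if i \<in> I then of_real q * z i else z i) p =
        C * mb_psi q p (Suc l) (dilate q (Suc l) I (mb_frame l z))" for I
    proof -
      have "\<Psi> (\<lambda>i. if i \<in> I then of_real q * z i else z i) p =
          C * mb_psi q p (Suc l) (mb_frame l (\<lambda>i. if i \<in> I then of_real q * z i else z i))"
        by (rule Psi) (use z q in simp)
      also have "mb_psi q p (Suc l) (mb_frame l (\<lambda>i. if i \<in> I then of_real q * z i else z i)) =
          mb_psi q p (Suc l) (dilate q (Suc l) I (mb_frame l z))"
        by (rule mb_psi_agree) simp
      finally show ?thesis .
    qed
    then have "toda_H_dual l q r (\<lambda>w. \<Psi> w p) z = of_real q ^ (r * (r - 1) div 2) * (C *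
        (\<Sum>I\<in>subsets_of_card {1..Suc l} r. dual_coeff {1..Suc l} (\<lambda>k. mb_frame l z (Suc l, k)) I *
          mb_psi q p (Suc l) (dilate q (Suc l) I (mb_frame l z))))"
      unfolding toda_H_dual_def subsets_of_card_def dual_coeff_def sum_distrib_left frame
      by (simp add: mult_ac del: mb_psi.simps)
    also have "(\<Sum>I\<in>subsets_of_card {1..Suc l} r. dual_coeff {1..Suc l} (\<lambda>k. mb_frame l z (Suc l, k)) I *
          mb_psi q p (Suc l) (dilate q (Suc l) I (mb_frame l z))) =
        (\<Prod>i=Suc (Suc l) - r..Suc l. of_real q powi p i) * mb_psi q p (Suc l) (mb_frame l z)"
      by (rule dual_eigenvalue[OF q]) (use inj z r in simp_all)
    finally show ?thesis
      using q by (simp add: Psi_z power_int_minus mult_ac del: mb_psi.simps)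
  qed
  ultimately show ?thesis by blast
qed

end
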